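(* Let $X$ be a Riemannian manifold of dimension $n$, let $\Phi_I$ and $\Phi_{II}$ be $N$-functions, and let $1\le k\le n$. Then $H^k_{\Phi_I,\Phi_{II}}(X)=0$ if and only if there exists a constant $C<\infty$ such that for any closed differential form $\omega\in L^{\Phi_{II}}(X,\Lambda^k)$ (i.e. $d\omega=0$) there exists a differential form $\theta\in L^{\Phi_I}(X,\Lambda^{k-1})$ such that $d\theta=\omega$ and $$\|\theta\|_{(\Phi_I)}\le C\,\|\omega\|_{(\Phi_{II})}.$$
   Context: An $N$-function is a function $\Phi:\mathbb{R}\to[0,\infty)$ that is even and convex, with $\Phi(x)=0\iff x=0$, $\lim_{x\to0}\Phi(x)/x=0$ and $\lim_{x\to\infty}\Phi(x)/x=\infty$. For a Riemannian manifold $X$ of dimension $n$ with volume element $d\mu_X$, and a measurable $k$-form $\omega$ on $X$ with pointwise norm $|\omega(x)|$ (induced by the Riemannian scalar product on exterior forms on $T_xX$), put $\rho_\Phi(\omega)=\int_X\Phi(|\omega(x)|)\,d\mu_X$. Forms differing on a set of measure zero are identified. $L^\Phi(X,\Lambda^k)$ is the space of measurable $k$-forms $\omega$ with $\rho_\Phi(\alpha\omega)<\infty$ for some $\alpha>0$, endowed with the gauge norm $\|\omega\|_{(\Phi)}=\inf\{K>0:\rho_\Phi(\omega/K)\le1\}$; it is a Banach space. Weak differential: a locally integrable $(j+1)$-form $\theta$ is the (weak) differential $d\omega$ of a locally integrable $j$-form $\omega$ if $\int_U\omega\wedge du=(-1)^{j+1}\int_U\theta\wedge u$ for every orientable domain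 $U\subset\mathrm{Int}\,X$ and every smooth compactly supported $(n-j-1)$-form $u$ with support in $U$. For $N$-functions $\Phi_I,\Phi_{II}$ put $Z^k_{\Phi_{II}}(X)=\{\omega\in L^{\Phi_{II}}(X,\Lambda^k): d\omega=0\}$ and $B^k_{\Phi_I,\Phi_{II}}(X)=\{\omega\in L^{\Phi_{II}}(X,\Lambda^k):\omega=d\beta\text{ for some }\beta\in L^{\Phi_I}(X,\Lambda^{k-1})\}$. The $k$th $L_{\Phi_I,\Phi_{II}}$-cohomology is $H^k_{\Phi_I,\Phi_{II}}(X)=Z^k_{\Phi_{II}}(X)/B^k_{\Phi_I,\Phi_{II}}(X)$. *)

theory Defs
  imports "HOL-Analysis.Analysis" "HOL-Combinatorics.Permutations"
begin

subsection \<open>Smooth maps\<close>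

primrec Ck_on :: "nat \<Rightarrow> 'e set \<Rightarrow> ('e::real_normed_vector \<Rightarrow> 'f::real_normed_vector) \<Rightarrow> bool" where
  "Ck_on 0 V f \<longleftrightarrow> continuous_on V f"
| "Ck_on (Suc r) V f \<longleftrightarrow>
     (\<exists>f'. (\<forall>x\<in>V. (f has_derivative f' x) (at x)) \<and> (\<forall>v. Ck_on r V (\<lambda>x. f' x v)))"

text \<open>On a set that need not be open (the image of a boundary chart), smoothness means the
  local existence of smooth extensions to open sets.\<close>

definition smooth_map_on :: "'e set \<Rightarrow> ('e::real_normed_vector \<Rightarrow> 'f::real_normed_vector) \<Rightarrow> bool" where
  "smooth_map_on S f \<longleftrightarrow>
     (\<forall>x\<in>S. \<exists>V h. open V \<and> x \<in> V \<and> (\<forall>r. Ck_on r V h) \<and> (\<forall>y\<in>S \<inter> V. h y = f y))"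

subsection \<open>Riemannian manifolds, possibly with boundary\<close>

text \<open>The dimension is \<open>CARD('n)\<close>. A chart is a pair of its domain and its coordinate map, the
  latter being relevant on the domain only. The metric is given by its Gram matrix in each chart:
  \<open>metric M c p\<close> is the matrix $(g_{ij}(p))$ in the coordinates \<open>c\<close>.\<close>

type_synonym ('a, 'n) chart = "'a set \<times> ('a \<Rightarrow> real^'n)"

record ('a, 'n) riem =
  top_of :: "'a topology"
  atlas :: "('a, 'n) chart set"
  metric :: "('a, 'n) chart \<Rightarrow> 'a \<Rightarrow> real^'n^'n"

definition halfspace :: "(real^'n::{finite,wellorder}) set" where
  "halfspace = {x. 0 \<le> x $ (LEAST i. True)}"

definition cdom :: "('a, 'n) chart \<Rightarrow> 'a set" where
  "cdom c = fst c"

definition cmap :: "('a, 'n) chart \<Rightarrow> 'a \<Rightarrow> real^'n" where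
  "cmap c = snd c"

definition cimg :: "('a, 'n) chart \<Rightarrow> (real^'n) set" where
  "cimg c = cmap c ` cdom c"

definition cinv :: "('a, 'n) chart \<Rightarrow> real^'n \<Rightarrow> 'a" where
  "cinv c = inv_into (cdom c) (cmap c)"

definition is_chart :: "'a topology \<Rightarrow> ('a, 'n::{finite,wellorder}) chart \<Rightarrow> bool" where
  "is_chart T c \<longleftrightarrow>
     openin T (cdom c) \<and>
     (open (cimg c) \<or> openin (top_of_set halfspace) (cimg c)) \<and>
     homeomorphic_map (subtopology T (cdom c)) (top_of_set (cimg c)) (cmap c)"

text \<open>Jacobian matrix at \<open>p\<close> of the transition map from the coordinates \<open>c\<close> to the coordinates
  \<open>d\<close>. The derivative is taken within the domain of the transition map, which matters only at
  boundary points; it is uniquely determined there as well.\<close>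

definition jac :: "('a, 'n::finite) chart \<Rightarrow> ('a, 'n) chart \<Rightarrow> 'a \<Rightarrow> real^'n^'n" where
  "jac c d p = matrix (frechet_derivative (cmap d \<circ> cinv c)
                 (at (cmap c p) within cmap c ` (cdom c \<inter> cdom d)))"

definition riemannian_manifold :: "('a, 'n::{finite,wellorder}) riem \<Rightarrow> bool" where
  "riemannian_manifold M \<longleftrightarrow>
     Hausdorff_space (top_of M) \<and> second_countable (top_of M) \<and>
     (\<forall>c\<in>atlas M. is_chart (top_of M) c) \<and>
     (\<Union>c\<in>atlas M. cdom c) = topspace (top_of M) \<and>
     (\<forall>c\<in>atlas M. \<forall>d\<in>atlas M.
        smooth_map_on (cmap c ` (cdom c \<inter> cdom d)) (cmap d \<circ> cinv c)) \<and>
     (\<forall>c\<in>atlas M. smooth_map_on (cimg c) (\<lambda>x. metric M c (cinv c x))) \<and>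
     (\<forall>c\<in>atlas M. \<forall>p\<in>cdom c. transpose (metric M c p) = metric M c p \<and>
        (\<forall>v. v \<noteq> 0 \<longrightarrow> 0 < v \<bullet> (metric M c p *v v))) \<and>
     (\<forall>c\<in>atlas M. \<forall>d\<in>atlas M. \<forall>p\<in>cdom c \<inter> cdom d.
        metric M c p = transpose (jac c d p) ** metric M d p ** jac c d p)"

definition interior_of_mfd :: "('a, 'n::finite) riem \<Rightarrow> 'a set" where
  "interior_of_mfd M = {p. \<exists>c\<in>atlas M. p \<in> cdom c \<and> cmap c p \<in> interior (cimg c)}"

text \<open>Chart used to evaluate coordinate independent expressions at \<open>p\<close>.\<close>

definition chart_at :: "('a, 'n::finite) riem \<Rightarrow> 'a \<Rightarrow> ('a, 'n) chart" where
  "chart_at M p = (SOME c. c \<in> atlas M \<and> p \<in> cdom c)"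

text \<open>The volume element: the Borel measure which is $\sqrt{\det g}\,dx$ in every chart. Since
  countably many charts cover the manifold, there is exactly one such measure.\<close>

definition is_volume :: "('a, 'n::finite) riem \<Rightarrow> 'a measure \<Rightarrow> bool" where
  "is_volume M m \<longleftrightarrow>
     space m = topspace (top_of M) \<and>
     sets m = sigma_sets (topspace (top_of M)) {U. openin (top_of M) U} \<and>
     (\<forall>c\<in>atlas M. \<forall>B\<in>sets m. B \<subseteq> cdom c \<longrightarrow>
        emeasure m B = (\<integral>\<^sup>+x\<in>cmap c ` B. ennreal (sqrt (det (metric M c (cinv c x)))) \<partial>lborel))"

definition volume :: "('a, 'n::finite) riem \<Rightarrow> 'a measure" where
  "volume M = completion (SOME m. is_volume M m)"

subsection \<open>Exterior forms and differential forms\<close>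

text \<open>An exterior \<open>k\<close>-form takes its arguments from a sequence of vectors, of which only the
  first \<open>k\<close> are used.\<close>

definition alt_form :: "nat \<Rightarrow> ((nat \<Rightarrow> real^'n) \<Rightarrow> real) \<Rightarrow> bool" where
  "alt_form k f \<longleftrightarrow>
     (\<forall>v w. (\<forall>i<k. v i = w i) \<longrightarrow> f v = f w) \<and>
     (\<forall>v. \<forall>i<k. linear (\<lambda>x. f (v(i := x)))) \<and>
     (\<forall>v i j. i < j \<and> j < k \<and> v i = v j \<longrightarrow> f v = 0)"

text \<open>A differential form is the family of its coordinate expressions: \<open>\<omega> c p\<close> is the form at the
  point \<open>p\<close> in the coordinates \<open>c\<close>. Values for \<open>c \<notin> atlas M\<close> or \<open>p \<notin> cdom c\<close> are irrelevant.\<close>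

type_synonym ('a, 'n) dform = "('a, 'n) chart \<Rightarrow> 'a \<Rightarrow> (nat \<Rightarrow> real^'n) \<Rightarrow> real"

definition is_dform :: "('a, 'n::finite) riem \<Rightarrow> nat \<Rightarrow> ('a, 'n) dform \<Rightarrow> bool" where
  "is_dform M k \<omega> \<longleftrightarrow>
     (\<forall>c\<in>atlas M. \<forall>p\<in>cdom c. alt_form k (\<omega> c p)) \<and>
     (\<forall>c\<in>atlas M. \<forall>d\<in>atlas M. \<forall>p\<in>cdom c \<inter> cdom d. \<forall>v.
        \<omega> c p v = \<omega> d p (\<lambda>i. jac c d p *v v i))"

definition zero_form :: "('a, 'n) dform" where
  "zero_form = (\<lambda>c p v. 0)"

definition diff_form :: "('a, 'n) dform \<Rightarrow> ('a, 'n) dform \<Rightarrow> ('a, 'n) dform" where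
  "diff_form \<omega> \<eta> = (\<lambda>c p v. \<omega> c p v - \<eta> c p v)"

definition scale_form :: "real \<Rightarrow> ('a, 'n) dform \<Rightarrow> ('a, 'n) dform" where
  "scale_form a \<omega> = (\<lambda>c p v. a * \<omega> c p v)"

text \<open>Lebesgue measurability: \<open>volume M\<close> is a complete measure.\<close>

definition measurable_form :: "('a, 'n::finite) riem \<Rightarrow> nat \<Rightarrow> ('a, 'n) dform \<Rightarrow> bool" where
  "measurable_form M k \<omega> \<longleftrightarrow> is_dform M k \<omega> \<and>
     (\<forall>c\<in>atlas M. \<forall>v. (\<lambda>p. \<omega> c p v) \<in> borel_measurable (restrict_space (volume M) (cdom c)))"

definition smooth_form :: "('a, 'n::finite) riem \<Rightarrow> nat \<Rightarrow> ('a, 'n) dform \<Rightarrow> bool" where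
  "smooth_form M k \<omega> \<longleftrightarrow> is_dform M k \<omega> \<and>
     (\<forall>c\<in>atlas M. \<forall>v. smooth_map_on (cimg c) (\<lambda>x. \<omega> c (cinv c x) v))"

definition form_support :: "('a, 'n::finite) riem \<Rightarrow> ('a, 'n) dform \<Rightarrow> 'a set" where
  "form_support M \<omega> =
     (top_of M) closure_of {p. \<exists>c\<in>atlas M. p \<in> cdom c \<and> (\<exists>v. \<omega> c p v \<noteq> 0)}"

text \<open>The scalar product on exterior \<open>k\<close>-forms induced by a scalar product with Gram matrix
  \<open>G\<close>, normalised so that the forms $e^{i_1}\wedge\dots\wedge e^{i_k}$, $i_1<\dots<i_k$, are
  orthonormal whenever $(e^i)$ is an orthonormal coframe:
  $\frac1{k!}\sum g^{i_1j_1}\cdots g^{i_kj_k}\alpha_{i_1\dots i_k}\beta_{j_1\dots j_k}$.\<close>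

definition alt_inner ::
    "real^'n^'n \<Rightarrow> nat \<Rightarrow> ((nat \<Rightarrow> real^'n::finite) \<Rightarrow> real) \<Rightarrow> ((nat \<Rightarrow> real^'n) \<Rightarrow> real) \<Rightarrow> real" where
  "alt_inner G k \<alpha> \<beta> =
     (\<Sum>i\<in>{..<k} \<rightarrow>\<^sub>E UNIV. \<Sum>j\<in>{..<k} \<rightarrow>\<^sub>E UNIV.
        (\<Prod>l<k. matrix_inv G $ i l $ j l) * \<alpha> (\<lambda>l. axis (i l) 1) * \<beta> (\<lambda>l. axis (j l) 1)) / fact k"

definition pt_norm :: "('a, 'n::finite) riem \<Rightarrow> nat \<Rightarrow> ('a, 'n) dform \<Rightarrow> 'a \<Rightarrow> real" where
  "pt_norm M k \<omega> p =
     (let c = chart_at M p in sqrt (alt_inner (metric M c p) k (\<omega> c p) (\<omega> c p)))"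

definition wedge :: "nat \<Rightarrow> nat \<Rightarrow> ('a, 'n) dform \<Rightarrow> ('a, 'n) dform \<Rightarrow> ('a, 'n) dform" where
  "wedge k m \<alpha> \<beta> = (\<lambda>c p v.
     (\<Sum>s | s permutes {..<k+m}.
        of_int (sign s) * \<alpha> c p (\<lambda>i. v (s i)) * \<beta> c p (\<lambda>i. v (s (k + i)))) / (fact k * fact m))"

text \<open>Exterior differential of a smooth \<open>m\<close>-form; the argument sequence with the entry \<open>v i\<close>
  omitted is \<open>\<lambda>j. if j < i then v j else v (Suc j)\<close>.\<close>

definition ext_d :: "nat \<Rightarrow> ('a, 'n::finite) dform \<Rightarrow> ('a, 'n) dform" where
  "ext_d m u = (\<lambda>c p v. \<Sum>i\<le>m. (-1) ^ i *
     frechet_derivative (\<lambda>x. u c (cinv c x) (\<lambda>j. if j < i then v j else v (Suc j)))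
       (at (cmap c p) within cimg c) (v i))"

subsection \<open>Orientation and integration\<close>

text \<open>An orientation of an open set \<open>U\<close>: a continuous choice of orientations of the tangent
  spaces. \<open>s c p\<close> is \<open>1\<close> if the coordinate frame of \<open>c\<close> at \<open>p\<close> is positive and \<open>-1\<close> otherwise.\<close>

definition orientation_on ::
    "('a, 'n::finite) riem \<Rightarrow> 'a set \<Rightarrow> (('a, 'n) chart \<Rightarrow> 'a \<Rightarrow> real) \<Rightarrow> bool" where
  "orientation_on M U s \<longleftrightarrow>
     (\<forall>c\<in>atlas M. continuous_map (subtopology (top_of M) (cdom c \<inter> U)) euclideanreal (s c) \<and>
        (\<forall>p\<in>cdom c \<inter> U. s c p \<in> {-1, 1})) \<and>
     (\<forall>c\<in>atlas M. \<forall>d\<in>atlas M. \<forall>p\<in>cdom c \<inter> cdom d \<inter> U.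
        s d p = sgn (det (jac c d p)) * s c p)"

definition coord_frame :: "nat \<Rightarrow> real^'n::{finite,wellorder}" where
  "coord_frame i = axis (sorted_list_of_set (UNIV :: 'n set) ! i) 1"

text \<open>Integral over \<open>U\<close>, oriented by \<open>s\<close>, of a form \<open>\<eta>\<close> of top degree: \<open>\<eta>\<close> is divided by the
  oriented volume form, which in the coordinates \<open>c\<close> is
  $\pm\sqrt{\det g}\,dx^1\wedge\dots\wedge dx^n$ with sign \<open>s c\<close>.\<close>

definition form_integral ::
    "('a, 'n::{finite,wellorder}) riem \<Rightarrow> 'a set \<Rightarrow> (('a, 'n) chart \<Rightarrow> 'a \<Rightarrow> real)
      \<Rightarrow> ('a, 'n) dform \<Rightarrow> real" where
  "form_integral M U s \<eta> =
     (LINT p:U|volume M. (let c = chart_at M p in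
        s c p * \<eta> c p coord_frame / sqrt (det (metric M c p))))"

definition loc_integrable_form :: "('a, 'n::finite) riem \<Rightarrow> nat \<Rightarrow> ('a, 'n) dform \<Rightarrow> bool" where
  "loc_integrable_form M k \<omega> \<longleftrightarrow> measurable_form M k \<omega> \<and>
     (\<forall>K. compactin (top_of M) K \<longrightarrow> (\<integral>\<^sup>+p\<in>K. ennreal (pt_norm M k \<omega> p) \<partial>volume M) < \<infinity>)"

text \<open>\<open>weak_d M j \<omega> \<theta>\<close>: the \<open>(j+1)\<close>-form \<open>\<theta>\<close> is the weak differential of the \<open>j\<close>-form \<open>\<omega>\<close>.
  The degree of the test forms is \<open>m = n - j - 1\<close>; for \<open>j = n\<close> there are no test forms.\<close>

definition weak_d ::
    "('a, 'n::{finite,wellorder}) riem \<Rightarrow> nat \<Rightarrow> ('a, 'n) dform \<Rightarrow> ('a, 'n) dform \<Rightarrow> bool" where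
  "weak_d M j \<omega> \<theta> \<longleftrightarrow>
     loc_integrable_form M j \<omega> \<and> loc_integrable_form M (j + 1) \<theta> \<and>
     (\<forall>U s m u.
        openin (top_of M) U \<and> connectedin (top_of M) U \<and> U \<subseteq> interior_of_mfd M \<and>
        orientation_on M U s \<and> j + 1 + m = CARD('n) \<and>
        smooth_form M m u \<and> compactin (top_of M) (form_support M u) \<and> form_support M u \<subseteq> U
        \<longrightarrow> form_integral M U s (wedge j (m + 1) \<omega> (ext_d m u)) =
            (-1) ^ (j + 1) * form_integral M U s (wedge (j + 1) m \<theta> u))"

subsection \<open>Orlicz spaces and cohomology\<close>

definition N_function :: "(real \<Rightarrow> real) \<Rightarrow> bool" where
  "N_function \<Phi> \<longleftrightarrow>
     (\<forall>x. 0 \<le> \<Phi> x) \<and> (\<forall>x. \<Phi> (- x) = \<Phi> x) \<and> convex_on UNIV \<Phi> \<and> (\<forall>x. \<Phi> x = 0 \<longleftrightarrow> x = 0) \<and>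
     ((\<lambda>x. \<Phi> x / x) \<longlongrightarrow> 0) (at 0) \<and> filterlim (\<lambda>x. \<Phi> x / x) at_top at_top"

definition modular ::
    "('a, 'n::finite) riem \<Rightarrow> (real \<Rightarrow> real) \<Rightarrow> nat \<Rightarrow> ('a, 'n) dform \<Rightarrow> ennreal" where
  "modular M \<Phi> k \<omega> = (\<integral>\<^sup>+p. ennreal (\<Phi> (pt_norm M k \<omega> p)) \<partial>volume M)"

text \<open>The elements are forms rather than classes of forms modulo equality almost everywhere;
  all the notions below are invariant under changes of the forms on null sets.\<close>

definition L_space :: "('a, 'n::finite) riem \<Rightarrow> (real \<Rightarrow> real) \<Rightarrow> nat \<Rightarrow> ('a, 'n) dform set" where
  "L_space M \<Phi> k = {\<omega>. measurable_form M k \<omega> \<and> (\<exists>a>0. modular M \<Phi> k (scale_form a \<omega>) < \<infinity>)}"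

definition gauge_norm :: "('a, 'n::finite) riem \<Rightarrow> (real \<Rightarrow> real) \<Rightarrow> nat \<Rightarrow> ('a, 'n) dform \<Rightarrow> real" where
  "gauge_norm M \<Phi> k \<omega> = Inf {K. 0 < K \<and> modular M \<Phi> k (scale_form (1 / K) \<omega>) \<le> 1}"

definition Z_space ::
    "('a, 'n::{finite,wellorder}) riem \<Rightarrow> (real \<Rightarrow> real) \<Rightarrow> nat \<Rightarrow> ('a, 'n) dform set" where
  "Z_space M \<Phi> k = {\<omega> \<in> L_space M \<Phi> k. weak_d M k \<omega> zero_form}"

definition B_space ::
    "('a, 'n::{finite,wellorder}) riem \<Rightarrow> (real \<Rightarrow> real) \<Rightarrow> (real \<Rightarrow> real) \<Rightarrow> nat
      \<Rightarrow> ('a, 'n) dform set" where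
  "B_space M \<Phi>1 \<Phi>2 k =
     {\<omega> \<in> L_space M \<Phi>2 k. \<exists>\<beta>\<in>L_space M \<Phi>1 (k - 1). weak_d M (k - 1) \<beta> \<omega>}"

definition cohom_rel ::
    "('a, 'n::{finite,wellorder}) riem \<Rightarrow> (real \<Rightarrow> real) \<Rightarrow> (real \<Rightarrow> real) \<Rightarrow> nat
      \<Rightarrow> (('a, 'n) dform \<times> ('a, 'n) dform) set" where
  "cohom_rel M \<Phi>1 \<Phi>2 k =
     {(\<omega>, \<eta>). \<omega> \<in> Z_space M \<Phi>2 k \<and> \<eta> \<in> Z_space M \<Phi>2 k \<and> diff_form \<omega> \<eta> \<in> B_space M \<Phi>1 \<Phi>2 k}"

definition H_space ::
    "('a, 'n::{finite,wellorder}) riem \<Rightarrow> (real \<Rightarrow> real) \<Rightarrow> (real \<Rightarrow> real) \<Rightarrow> nat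
      \<Rightarrow> ('a, 'n) dform set set" where
  "H_space M \<Phi>1 \<Phi>2 k = Z_space M \<Phi>2 k // cohom_rel M \<Phi>1 \<Phi>2 k"

definition H_zero ::
    "('a, 'n::{finite,wellorder}) riem \<Rightarrow> (real \<Rightarrow> real) \<Rightarrow> (real \<Rightarrow> real) \<Rightarrow> nat
      \<Rightarrow> ('a, 'n) dform set" where
  "H_zero M \<Phi>1 \<Phi>2 k = cohom_rel M \<Phi>1 \<Phi>2 k `` {zero_form}"

end

theory Submission
  imports Defs "HOL-Library.Function_Algebras"
begin

text \<open>
The cohomology vanishes if and only if every cocycle \<open>\<omega>\<close> of class \<open>\<Phi>\<^sub>I\<^sub>I\<close> has a primitive of class
\<open>\<Phi>\<^sub>I\<close> (\<open>cohomology_zero_iff\<close>), so the estimate trivially implies vanishing. For the converse, let \<open>Z\<close> be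
the space of cocycles. The pairs \<open>(\<theta>, \<omega>)\<close> with \<open>\<omega> \<in> Z\<close> and \<open>d \<theta> = \<omega>\<close> form a linear relation
between two complete seminormed spaces. It is closed, and if the cohomology vanishes, then it is onto
\<open>Z\<close>. The open mapping theorem for such relations (\<open>open_mapping_relation\<close>) provides primitives
whose norms are bounded by a multiple of the norm of \<open>\<omega>\<close>.

Three facts have to be supplied. First, the spaces of forms are complete (\<open>L_series_complete\<close>).
Secondly, the Orlicz norm controls integrals of the pointwise norm over compact sets (\<open>L1_bound\<close>),
because \<open>\<Phi>\<close> grows superlinearly. Thirdly, the integral of \<open>\<omega> \<and> \<beta>\<close> against a compactly supported
continuous form \<open>\<beta>\<close> is linear in \<open>\<omega>\<close> and bounded by such an integral (\<open>integrand_bound\<close>). With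
\<open>\<beta> = u\<close> and \<open>\<beta> = d u\<close> for test forms \<open>u\<close>, the last two facts show that both sides of the identity
defining the weak differential are linear and continuous, so the relation is linear and closed
(\<open>weak_d_closed\<close>); in particular \<open>Z\<close> is complete.

The geometric input is that integrands and pointwise norms do not depend on the chart that is selected
at each point. For the norms this is an invariance of the scalar product (\<open>form_norm_pullback\<close>), for
the integrands it is the transformation of top degree forms by determinants
(\<open>wedge_val_top_degree\<close>), together with the fact that the exterior differential commutes with
coordinate changes (\<open>pullback_exterior_derivative\<close>). Since the volume is introduced as a measure with
prescribed densities in all charts, its existence (\<open>volume_exists\<close>) is needed as well; it follows from
the transformation formula and a countable partition subordinate to the atlas.
\<close>

section \<open>An open mapping theorem for closed linear relations\<close>

text \<open>Differential forms are curried functions into the reals, so the pointwise operations below make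
them a real vector space.\<close>

instantiation "fun" :: (type, scaleR) scaleR
begin
definition "scaleR_fun a f = (\<lambda>x. a *\<^sub>R f x)"
instance ..
end

instance "fun" :: (type, real_vector) real_vector
  by standard (auto simp: scaleR_fun_def fun_eq_iff algebra_simps)

lemma sum_fun_apply: "sum f A x = (\<Sum>i\<in>A. f i x)"
  by (induction A rule: infinite_finite_induct) auto

text \<open>Forms that agree almost everywhere are not identified, so only seminorms are available.\<close>

locale seminormed =
  fixes X :: "'a::real_vector set" and p :: "'a \<Rightarrow> real"
  assumes X_subspace: "subspace X"
    and p_nonneg: "x \<in> X \<Longrightarrow> 0 \<le> p x"
    and p_triangle: "x \<in> X \<Longrightarrow> y \<in> X \<Longrightarrow> p (x + y) \<le> p x + p y"
    and p_scaleR: "x \<in> X \<Longrightarrow> p (a *\<^sub>R x) = \<bar>a\<bar> * p x"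
begin

lemma p_zero [simp]: "p 0 = 0"
  using p_scaleR[of 0 0] X_subspace by (simp add: subspace_0)

lemma p_minus: "x \<in> X \<Longrightarrow> p (- x) = p x"
  using p_scaleR[of x "-1"] by simp

lemma p_diff: "x \<in> X \<Longrightarrow> y \<in> X \<Longrightarrow> p (x - y) \<le> p x + p y"
  using p_triangle[of x "- y"] p_minus[of y] subspace_neg[OF X_subspace] by simp

lemma p_sum: "(\<And>i. i \<in> I \<Longrightarrow> f i \<in> X) \<Longrightarrow> p (sum f I) \<le> (\<Sum>i\<in>I. p (f i))"
proof (induction I rule: infinite_finite_induct)
  case (insert i I)
  have "p (f i + sum f I) \<le> p (f i) + p (sum f I)"
    using insert by (intro p_triangle subspace_sum[OF X_subspace]) auto
  then show ?case using insert by auto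
qed auto

end

text \<open>Completeness is stated for absolutely convergent series, the form in which it is proved for
Orlicz spaces and in which it is used.\<close>

locale complete_seminormed = seminormed +
  assumes series_complete:
    "(\<And>j::nat. x j \<in> X) \<Longrightarrow> summable (\<lambda>j. p (x j)) \<Longrightarrow>
       \<exists>s\<in>X. (\<lambda>n. p (s - (\<Sum>j<n. x j))) \<longlonglongrightarrow> 0"
begin

lemma series_sum_bound:
  assumes x: "\<And>j::nat. x j \<in> X" and s: "s \<in> X" "(\<lambda>n. p (s - (\<Sum>j<n. x j))) \<longlonglongrightarrow> 0"
    and a: "\<And>j. p (x j) \<le> a j" "summable a"
  shows "p s \<le> suminf a"
proof -
  have "p s \<le> p (s - (\<Sum>j<n. x j)) + suminf a" for n
  proof -
    have S: "(\<Sum>j<n. x j) \<in> X" by (simp add: subspace_sum[OF X_subspace] x)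
    have "p (s - (\<Sum>j<n. x j) + (\<Sum>j<n. x j)) \<le> p (s - (\<Sum>j<n. x j)) + p (\<Sum>j<n. x j)"
      using S s(1) subspace_diff[OF X_subspace] by (intro p_triangle) auto
    also have "p (\<Sum>j<n. x j) \<le> (\<Sum>j<n. p (x j))" by (rule p_sum) (rule x)
    also have "\<dots> \<le> (\<Sum>j<n. a j)" by (intro sum_mono a)
    also have "\<dots> \<le> suminf a"
      by (rule sum_le_suminf[OF a(2)]) (auto intro: order_trans[OF p_nonneg[OF x] a(1)])
    finally show ?thesis by simp
  qed
  moreover have "(\<lambda>n. p (s - (\<Sum>j<n. x j)) + suminf a) \<longlonglongrightarrow> 0 + suminf a"
    by (intro tendsto_intros s)
  ultimately show ?thesis by (intro LIMSEQ_le_const[where X="\<lambda>n. p (s - (\<Sum>j<n. x j)) + suminf a"]) auto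
qed

text \<open>The Baire category theorem. If no ball were contained in the closure of any \<open>A n\<close>, balls avoiding
\<open>A 0\<close>, \<open>A 1\<close>, and so on could be nested, and their centres would converge to a point outside every
\<open>A n\<close>.\<close>

lemma countable_cover_somewhere_dense:
  assumes cover: "X \<subseteq> (\<Union>n::nat. A n)"
  obtains (1) n y r where "y \<in> X" "r > 0"
    "\<And>z e. z \<in> X \<Longrightarrow> p (z - y) < r \<Longrightarrow> e > 0 \<Longrightarrow> \<exists>w\<in>A n \<inter> X. p (w - z) < e"
proof (rule ccontr)
  assume contra: "\<not> thesis"
  have *: False if "y \<in> X" "r > 0"
    "\<And>z e. z \<in> X \<Longrightarrow> p (z - y) < r \<Longrightarrow> e > 0 \<Longrightarrow> \<exists>w\<in>A n \<inter> X. p (w - z) < e" for n y r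
    using contra 1[of y r n] that by blast
  have step: "\<exists>z\<in>X. \<exists>e>0. p (z - y) < r \<and> (\<forall>w\<in>A n \<inter> X. p (w - z) \<ge> e)" if "y \<in> X" "r > 0" for n y r
  proof (rule ccontr)
    assume "\<not> (\<exists>z\<in>X. \<exists>e>0. p (z - y) < r \<and> (\<forall>w\<in>A n \<inter> X. p (w - z) \<ge> e))"
    then have "\<exists>w\<in>A n \<inter> X. p (w - z) < e" if "z \<in> X" "p (z - y) < r" "e > 0" for z e
      using that by (simp add: not_le)
    with *[OF \<open>y \<in> X\<close> \<open>r > 0\<close>] show False by blast
  qed
  have "\<exists>f. \<forall>n. (fst (f n) \<in> X \<and> snd (f n) > 0) \<and>
      (p (fst (f (Suc n)) - fst (f n)) < snd (f n) / 4 \<and> snd (f (Suc n)) \<le> snd (f n) / 4 \<and>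
       (\<forall>w\<in>A n \<inter> X. p (w - fst (f (Suc n))) \<ge> snd (f (Suc n))))"
  proof (rule dependent_nat_choice)
    show "\<exists>x. fst x \<in> X \<and> snd x > (0::real)"
      using subspace_0[OF X_subspace] by (intro exI[of _ "(0,1)"]) auto
  next
    fix x :: "'a \<times> real" and n assume x: "fst x \<in> X \<and> 0 < snd x"
    from step[of "fst x" "snd x / 4" n] x obtain z e where
      z: "z \<in> X" "e > 0" "p (z - fst x) < snd x / 4" "\<forall>w\<in>A n \<inter> X. p (w - z) \<ge> e"
      by auto
    show "\<exists>y. (fst y \<in> X \<and> 0 < snd y) \<and> p (fst y - fst x) < snd x / 4 \<and>
          snd y \<le> snd x / 4 \<and> (\<forall>w\<in>A n \<inter> X. snd y \<le> p (w - fst y))"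
      using z x by (intro exI[of _ "(z, min e (snd x / 4))"]) (auto simp: min_le_iff_disj)
  qed
  then obtain g where g: "\<And>n. (fst (g n) \<in> X \<and> snd (g n) > 0) \<and>
      (p (fst (g (Suc n)) - fst (g n)) < snd (g n) / 4 \<and> snd (g (Suc n)) \<le> snd (g n) / 4 \<and>
       (\<forall>w\<in>A n \<inter> X. p (w - fst (g (Suc n))) \<ge> snd (g (Suc n))))"
    by meson
  define y r where "y n = fst (g n)" and "r n = snd (g n)" for n
  have f: "\<And>n. y n \<in> X" "\<And>n. r n > 0" "\<And>n. p (y (Suc n) - y n) < r n / 4" "\<And>n. r (Suc n) \<le> r n / 4"
      "\<And>n w. w \<in> A n \<inter> X \<Longrightarrow> p (w - y (Suc n)) \<ge> r (Suc n)"
    using g by (auto simp: y_def r_def)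
  define x where "x j = y (Suc j) - y j" for j
  \<comment> \<open>The radii shrink by the factor 4, so all later centres stay within a third of \<open>r n\<close>.\<close>
  have r_bound: "r (n + j) \<le> r n * (1/4)^j" for n j
  proof (induction j)
    case (Suc j) then show ?case using f(4)[of "n+j"] by simp
  qed simp
  have xX: "x j \<in> X" for j unfolding x_def by (intro subspace_diff[OF X_subspace] f)
  have px: "p (x (n + j)) \<le> r n / 4 * (1/4)^j" for n j
    using f(3)[of "n+j"] r_bound[of n j] unfolding x_def by simp
  have geo: "summable (\<lambda>j. r n / 4 * (1/4)^j)" "(\<Sum>j. r n / 4 * (1/4)^j) = r n / 3" for n
    using sums_mult[OF geometric_sums[of "1/4::real"], of "r n / 4"]
    by (auto simp: sums_iff)
  have "summable (\<lambda>j. p (x j))"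
    by (rule summable_comparison_test'[OF geo(1)[of 0], of 0]) (use px[of 0] p_nonneg xX in auto)
  from series_complete[OF xX this] obtain s where
    s: "s \<in> X" "(\<lambda>n. p (s - (\<Sum>j<n. x j))) \<longlonglongrightarrow> 0" by auto
  have tele: "(\<Sum>j<n. x (m + j)) = y (m + n) - y m" for n m
    by (induction n) (auto simp: x_def)
  define l where "l = s + y 0"
  have lX: "l \<in> X" unfolding l_def by (intro subspace_add[OF X_subspace] s f)
  have lim: "(\<lambda>n. p (l - y n)) \<longlonglongrightarrow> 0"
  proof -
    have "l - y n = s - (\<Sum>j<n. x j)" for n
      using tele[where m=0 and n=n] by (simp add: l_def)
    with s(2) show ?thesis by simp
  qed
  have near: "p (l - y n) \<le> r n / 3" for n
  proof -
    have *: "(\<lambda>k. p (l - y n - (\<Sum>j<k. x (n + j)))) \<longlonglongrightarrow> 0"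
      using LIMSEQ_ignore_initial_segment[OF lim, of n] unfolding tele by (simp add: add.commute)
    show ?thesis
      using series_sum_bound[OF xX subspace_diff[OF X_subspace lX f(1)] * px geo(1)] unfolding geo(2) .
  qed
  obtain n where "l \<in> A n" using cover lX by auto
  then have "r (Suc n) \<le> p (l - y (Suc n))" using f(5)[of l n] lX by auto
  with near[of "Suc n"] f(2)[of "Suc n"] show False by linarith
qed

end

text \<open>Banach's argument. By the category theorem the points with a preimage of norm at most some \<open>c\<close> are
dense in a ball, hence, by convexity and symmetry, in a ball around \<open>0\<close>. Successive approximation
with radii halved in each step writes every \<open>y\<close> of that ball as a series of points with preimages of
norms \<open>c\<close>, \<open>c/2\<close>, \<open>c/4\<close>, and so on; the preimages can be summed by completeness, and the relation is
preserved because it is closed.\<close>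

lemma open_mapping_relation:
  fixes X :: "'a::real_vector set" and Y :: "'b::real_vector set"
  assumes X: "complete_seminormed X p" and Y: "complete_seminormed Y q"
    and R_add: "\<And>x y x' y'. x \<in> X \<Longrightarrow> x' \<in> X \<Longrightarrow> y \<in> Y \<Longrightarrow> y' \<in> Y \<Longrightarrow> R x y \<Longrightarrow> R x' y' \<Longrightarrow> R (x + x') (y + y')"
    and R_scale: "\<And>x y a. x \<in> X \<Longrightarrow> y \<in> Y \<Longrightarrow> R x y \<Longrightarrow> R (a *\<^sub>R x) (a *\<^sub>R y)"
    and R_closed: "\<And>x y u v. (\<And>n::nat. x n \<in> X) \<Longrightarrow> (\<And>n. y n \<in> Y) \<Longrightarrow> (\<And>n. R (x n) (y n)) \<Longrightarrow>
        u \<in> X \<Longrightarrow> v \<in> Y \<Longrightarrow> (\<lambda>n. p (u - x n)) \<longlonglongrightarrow> 0 \<Longrightarrow> (\<lambda>n. q (v - y n)) \<longlonglongrightarrow> 0 \<Longrightarrow> R u v"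
    and surj: "\<And>y. y \<in> Y \<Longrightarrow> \<exists>x\<in>X. R x y"
  shows "\<exists>C. \<forall>y\<in>Y. \<exists>x\<in>X. R x y \<and> p x \<le> C * q y"
proof -
  interpret X: complete_seminormed X p by (rule X)
  interpret Y: complete_seminormed Y q by (rule Y)
  note Xs = X.X_subspace and Ys = Y.X_subspace
  define A where "A n = {y. \<exists>x\<in>X. R x y \<and> p x \<le> real n}" for n
  have "Y \<subseteq> (\<Union>n. A n)"
    using surj real_arch_simple unfolding A_def by (fastforce dest: surj)
  then obtain n y0 r where y0: "y0 \<in> Y" "r > 0" and
    dense: "\<And>z e. z \<in> Y \<Longrightarrow> q (z - y0) < r \<Longrightarrow> e > 0 \<Longrightarrow> \<exists>w\<in>A n \<inter> Y. q (w - z) < e"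
    by (rule Y.countable_cover_somewhere_dense) blast
  define c where "c = real n"
  have c: "c \<ge> 0" by (simp add: c_def)
  \<comment> \<open>Averages of approximations to \<open>y0 + z\<close> and \<open>- (y0 - z)\<close> approximate \<open>z\<close>.\<close>
  have half: "\<exists>w\<in>Y. \<exists>x\<in>X. R x w \<and> p x \<le> c \<and> q (z - w) < e"
    if z: "z \<in> Y" "q z < r" and e: "e > 0" for z e
  proof -
    have "q (y0 + z - y0) < r" "q (y0 - z - y0) < r" using z Y.p_minus by auto
    moreover have "y0 + z \<in> Y" "y0 - z \<in> Y"
      using y0 z subspace_add[OF Ys] subspace_diff[OF Ys] by auto
    ultimately obtain w w' where w: "w \<in> A n \<inter> Y" "q (w - (y0 + z)) < e"
      and w': "w' \<in> A n \<inter> Y" "q (w' - (y0 - z)) < e" using dense e by meson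
    obtain x x' where x: "x \<in> X" "R x w" "p x \<le> c" "x' \<in> X" "R x' w'" "p x' \<le> c"
      using w w' unfolding A_def c_def by auto
    define v where "v = (1/2) *\<^sub>R (w + (-1) *\<^sub>R w')"
    define u where "u = (1/2) *\<^sub>R (x + (-1) *\<^sub>R x')"
    have mem: "v \<in> Y" "u \<in> X" unfolding v_def u_def
      using w w' x by (simp_all add: subspace_diff[OF Xs] subspace_diff[OF Ys] subspace_scale[OF Xs] subspace_scale[OF Ys])
    have "R u v" unfolding u_def v_def
      using w w' x by (intro R_scale R_add)
          (simp_all add: subspace_neg[OF Xs] subspace_neg[OF Ys] subspace_diff[OF Xs] subspace_diff[OF Ys])
    moreover have "p u \<le> c"
      using x X.p_diff[of x x'] X.p_scaleR[of "x - x'" "1/2"] subspace_diff[OF Xs, of x x']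
      unfolding u_def by auto
    moreover have "q (z - v) < e"
    proof -
      define s t where "s = w - (y0 + z)" and "t = w' - (y0 - z)"
      have st: "s \<in> Y" "t \<in> Y" unfolding s_def t_def using w w' z y0
        by (auto intro!: subspace_add[OF Ys] subspace_diff[OF Ys])
      have "z - v = (1/2) *\<^sub>R (t - s)" unfolding v_def s_def t_def
        by (simp add: algebra_simps scaleR_2[symmetric])
      then have "q (z - v) = 1/2 * q (t - s)"
        using Y.p_scaleR[of "t - s" "1/2"] st subspace_diff[OF Ys] by auto
      also have "\<dots> < e" using Y.p_diff[of t s] st w(2) w'(2) unfolding s_def t_def by auto
      finally show ?thesis .
    qed
    ultimately show ?thesis using mem by blast
  qed
  have scaled: "\<exists>w\<in>Y. \<exists>x\<in>X. R x w \<and> p x \<le> c * t \<and> q (z - w) < e"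
    if z: "z \<in> Y" "q z < r * t" and t: "t > 0" and e: "e > 0" for z e t
  proof -
    have "(1/t) *\<^sub>R z \<in> Y" "q ((1/t) *\<^sub>R z) < r"
      using z t Y.p_scaleR[of z "1/t"] by (auto simp: subspace_scale[OF Ys] pos_divide_less_eq)
    from half[OF this, of "e / t"] e t obtain w x where
      w: "w \<in> Y" "x \<in> X" "R x w" "p x \<le> c" "q ((1/t) *\<^sub>R z - w) < e / t" by auto
    have "q (z - t *\<^sub>R w) = t * q ((1/t) *\<^sub>R z - w)"
      using Y.p_scaleR[of "(1/t) *\<^sub>R z - w" t] w z t subspace_diff[OF Ys] subspace_scale[OF Ys]
      by (auto simp: algebra_simps)
    then have "q (z - t *\<^sub>R w) < e" using w(5) t by (simp add: field_simps)
    moreover have "p (t *\<^sub>R x) \<le> c * t" using w X.p_scaleR[of x t] t by (simp add: mult.commute)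
    ultimately show ?thesis using w R_scale subspace_scale[OF Ys] subspace_scale[OF Xs] by blast
  qed
  have main: "\<exists>x\<in>X. R x z \<and> p x \<le> c * (2 * t)" if z: "z \<in> Y" "q z < r * t" and t: "t > 0" for z t
  proof -
    \<comment> \<open>The remainders of the successive approximation.\<close>
    have "\<exists>f. \<forall>j. (f j \<in> Y \<and> q (f j) < r * (t * (1/2)^j) \<and> (j = 0 \<longrightarrow> f j = z)) \<and>
        (\<exists>x\<in>X. R x (f j - f (Suc j)) \<and> p x \<le> c * (t * (1/2)^j))"
    proof (rule dependent_nat_choice)
      show "\<exists>x. x \<in> Y \<and> q x < r * (t * (1/2)^0) \<and> ((0::nat) = 0 \<longrightarrow> x = z)" using z by auto
    next
      fix x j assume x: "x \<in> Y \<and> q x < r * (t * (1/2)^j) \<and> (j = 0 \<longrightarrow> x = z)"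
      have "\<exists>w\<in>Y. \<exists>u\<in>X. R u w \<and> p u \<le> c * (t * (1/2)^j) \<and> q (x - w) < r * (t * (1/2)^Suc j)"
        using x t y0(2) by (intro scaled) auto
      then obtain w u where "w \<in> Y" "u \<in> X" "R u w" "p u \<le> c * (t * (1/2)^j)"
          "q (x - w) < r * (t * (1/2)^Suc j)" by auto
      then show "\<exists>y. (y \<in> Y \<and> q y < r * (t * (1/2)^Suc j) \<and> (Suc j = 0 \<longrightarrow> y = z)) \<and>
            (\<exists>u\<in>X. R u (x - y) \<and> p u \<le> c * (t * (1/2)^j))"
        using x by (intro exI[of _ "x - w"]) (auto intro: subspace_diff[OF Ys])
    qed
    then obtain f where F: "\<And>j. (f j \<in> Y \<and> q (f j) < r * (t * (1/2)^j) \<and> (j = 0 \<longrightarrow> f j = z)) \<and>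
        (\<exists>x\<in>X. R x (f j - f (Suc j)) \<and> p x \<le> c * (t * (1/2)^j))"
      by meson
    then have f: "\<And>j. f j \<in> Y" "\<And>j. q (f j) < r * (t * (1/2)^j)" and f0: "f 0 = z"
      by auto
    from F have "\<forall>j. \<exists>x. x \<in> X \<and> R x (f j - f (Suc j)) \<and> p x \<le> c * (t * (1/2)^j)" by auto
    then obtain x where x: "\<And>j. x j \<in> X" "\<And>j. R (x j) (f j - f (Suc j))" "\<And>j. p (x j) \<le> c * (t * (1/2)^j)"
      by (auto dest!: choice)
    have geo: "summable (\<lambda>j. c * (t * (1/2)^j))" "(\<Sum>j. c * (t * (1/2)^j)) = c * (2 * t)"
      using sums_mult[OF geometric_sums[of "1/2::real"], of "c * t"]
      by (auto simp: sums_iff mult_ac)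
    have "summable (\<lambda>j. p (x j))"
      by (rule summable_comparison_test'[OF geo(1), of 0]) (use x X.p_nonneg in auto)
    from X.series_complete[OF x(1) this] obtain u where
      u: "u \<in> X" "(\<lambda>n. p (u - (\<Sum>j<n. x j))) \<longlonglongrightarrow> 0" by auto
    have "p u \<le> c * (2 * t)"
      using X.series_sum_bound[OF x(1) u x(3) geo(1)] unfolding geo(2) .
    moreover have "R u z"
    proof (rule R_closed[OF _ _ _ u(1) z(1) u(2)])
      show "(\<Sum>j<n. x j) \<in> X" for n by (rule subspace_sum[OF Xs]) (rule x)
      show "z - f n \<in> Y" for n by (intro subspace_diff[OF Ys] z f)
      have R0: "R 0 0"
        using R_scale[OF x(1) subspace_diff[OF Ys f(1) f(1)] x(2), of 0] by simp
      show "R (\<Sum>j<n. x j) (z - f n)" for n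
      proof (induction n)
        case 0 then show ?case using R0 f0 by simp
      next
        case (Suc n)
        have "R ((\<Sum>j<n. x j) + x n) ((z - f n) + (f n - f (Suc n)))"
          using Suc x by (intro R_add subspace_sum[OF Xs] subspace_diff[OF Ys] z f) auto
        then show ?case by simp
      qed
      have "(\<lambda>n. r * (t * (1/2)^n)) \<longlonglongrightarrow> r * (t * 0)"
        by (intro tendsto_intros LIMSEQ_power_zero) auto
      moreover have "norm (q (f n)) \<le> r * (t * (1/2)^n)" for n
        using f(2)[of n] Y.p_nonneg[OF f(1)[of n]] by simp
      ultimately have "(\<lambda>n. q (f n)) \<longlonglongrightarrow> 0"
        by (intro Lim_null_comparison[of "\<lambda>n. q (f n)" "\<lambda>n. r * (t * (1/2)^n)"]) auto
      then show "(\<lambda>n. q (z - (z - f n))) \<longlonglongrightarrow> 0" by simp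
    qed
    ultimately show ?thesis using u(1) by auto
  qed
  have "\<exists>x\<in>X. R x y \<and> p x \<le> (c * (2 * (2 / r))) * q y" if y: "y \<in> Y" for y
  proof (cases "q y = 0")
    case False
    then have "q y > 0" using Y.p_nonneg[OF y] by simp
    then have "q y < r * (2 / r * q y)" "2 / r * q y > 0" using y0(2) by auto
    from main[OF y this] show ?thesis by (simp add: mult.assoc)
  next
    case True
    \<comment> \<open>Here the primitive must have norm exactly \<open>0\<close>, and closedness of the relation yields that \<open>0\<close> is one.\<close>
    have "\<exists>x. x \<in> X \<and> R x y \<and> p x \<le> c * (2 * (1 / real (Suc n)))" for n
      using main[OF y, of "1 / real (Suc n)"] True y0(2) by auto
    then obtain x where x: "\<And>n. x n \<in> X" "\<And>n. R (x n) y" "\<And>n. p (x n) \<le> c * (2 * (1 / real (Suc n)))"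
      using choice[of "\<lambda>n x. x \<in> X \<and> R x y \<and> p x \<le> c * (2 * (1 / real (Suc n)))"] by auto
    have "(\<lambda>n. c * (2 * (1 / real (Suc n)))) \<longlonglongrightarrow> c * (2 * 0)"
      by (intro tendsto_intros LIMSEQ_Suc[OF lim_1_over_n])
    moreover have "norm (p (x n)) \<le> c * (2 * (1 / real (Suc n)))" for n
      using x(3)[of n] X.p_nonneg[OF x(1)[of n]] by simp
    ultimately have "(\<lambda>n. p (x n)) \<longlonglongrightarrow> 0"
      by (intro Lim_null_comparison[of "\<lambda>n. p (x n)" "\<lambda>n. c * (2 * (1 / real (Suc n)))"]) auto
    then have "R 0 y"
      using R_closed[of x "\<lambda>_. y" 0 y] x(1,2) y X.p_minus subspace_0[OF Xs] by simp
    then show ?thesis using True subspace_0[OF Xs] by (intro bexI[of _ 0]) auto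
  qed
  then show ?thesis by blast
qed

section \<open>Multilinear forms and the scalar product on them\<close>

text \<open>Exterior differentials and wedge products are handled as multilinear maps; that wedge products
alternate enters through explicit identities.\<close>

definition multilinear_form :: "nat \<Rightarrow> ((nat \<Rightarrow> real^'n) \<Rightarrow> real) \<Rightarrow> bool" where
  "multilinear_form k f \<longleftrightarrow>
     (\<forall>v w. (\<forall>i<k. v i = w i) \<longrightarrow> f v = f w) \<and> (\<forall>v. \<forall>i<k. linear (\<lambda>x. f (v(i := x))))"

lemma alt_form_multilinear: "alt_form k f \<Longrightarrow> multilinear_form k f"
  by (simp add: alt_form_def multilinear_form_def)

lemma multilinear_form_cong: "multilinear_form k f \<Longrightarrow> (\<And>i. i < k \<Longrightarrow> v i = w i) \<Longrightarrow> f v = f w"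
  by (simp add: multilinear_form_def)

lemma multilinear_form_linear: "multilinear_form k f \<Longrightarrow> i < k \<Longrightarrow> linear (\<lambda>x. f (v(i := x)))"
  by (simp add: multilinear_form_def)

text \<open>The slots are expanded one after the other; the induction is on the number of expanded slots.\<close>

lemma multilinear_form_expand:
  fixes f :: "(nat \<Rightarrow> real^'n::finite) \<Rightarrow> real" and b :: "'m::finite \<Rightarrow> real^'n"
  assumes f: "multilinear_form k f" and v: "\<And>l. l < k \<Longrightarrow> v l = (\<Sum>m\<in>UNIV. c l m *\<^sub>R b m)"
  shows "f v = (\<Sum>I\<in>{..<k} \<rightarrow>\<^sub>E UNIV. (\<Prod>l<k. c l (I l)) * f (\<lambda>l. b (I l)))"
proof -
  have "f v = (\<Sum>I\<in>{..<r} \<rightarrow>\<^sub>E UNIV. (\<Prod>l<r. c l (I l)) * f (\<lambda>l. if l < r then b (I l) else v l))"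
    if "r \<le> k" for r
    using that
  proof (induction r)
    case 0 then show ?case by simp
  next
    case (Suc r)
    define g where "g I l = (if l < r then b (I l) else v l)" for I l
    have step: "f (g I) = (\<Sum>m\<in>UNIV. c r m * f ((g I)(r := b m)))" for I
    proof -
      have "f (g I) = f ((g I)(r := (\<Sum>m\<in>UNIV. c r m *\<^sub>R b m)))"
        using v[of r] Suc.prems by (intro arg_cong[of _ _ f]) (auto simp: g_def)
      also have "\<dots> = (\<Sum>m\<in>UNIV. c r m * f ((g I)(r := b m)))"
      proof -
        have lin: "linear (\<lambda>x. f ((g I)(r := x)))"
          using multilinear_form_linear[OF f, of r "g I"] Suc.prems by simp
        have "f ((g I)(r := \<Sum>m\<in>UNIV. c r m *\<^sub>R b m)) = (\<Sum>m\<in>UNIV. f ((g I)(r := c r m *\<^sub>R b m)))"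
          by (rule linear_sum[OF lin])
        also have "\<dots> = (\<Sum>m\<in>UNIV. c r m * f ((g I)(r := b m)))"
          by (intro sum.cong refl) (simp only: linear_cmul[OF lin] real_scaleR_def)
        finally show ?thesis .
      qed
      finally show ?thesis .
    qed
    let ?h = "\<lambda>J. (\<Prod>l<Suc r. c l (J l)) * f (\<lambda>l. if l < Suc r then b (J l) else v l)"
    have "f v = (\<Sum>I\<in>{..<r} \<rightarrow>\<^sub>E UNIV. (\<Prod>l<r. c l (I l)) * f (g I))"
      using Suc unfolding g_def by simp
    also have "\<dots> = (\<Sum>I\<in>{..<r} \<rightarrow>\<^sub>E UNIV. \<Sum>m\<in>UNIV. ?h (I(r := m)))"
    proof (intro sum.cong refl)
      fix I :: "nat \<Rightarrow> 'm"
      have "(g I)(r := b m) = (\<lambda>l. if l < Suc r then b ((I(r := m)) l) else v l)" for m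
        by (auto simp: g_def fun_eq_iff)
      moreover have "(\<Prod>l<Suc r. c l ((I(r := m)) l)) = (\<Prod>l<r. c l (I l)) * c r m" for m
        by simp
      ultimately show "(\<Prod>l<r. c l (I l)) * f (g I) = (\<Sum>m\<in>UNIV. ?h (I(r := m)))"
        by (simp only: step sum_distrib_left mult.assoc)
    qed
    also have "\<dots> = (\<Sum>(m,I)\<in>UNIV \<times> ({..<r} \<rightarrow>\<^sub>E UNIV). ?h (I(r := m)))"
      by (subst sum.swap) (simp add: sum.cartesian_product)
    also have "\<dots> = sum ?h ((\<lambda>(m,I). I(r := m)) ` (UNIV \<times> ({..<r} \<rightarrow>\<^sub>E UNIV)))"
      by (subst sum.reindex) (use inj_combinator[of r "{..<r}" "\<lambda>_. UNIV :: 'm set"] in \<open>auto simp: case_prod_unfold\<close>)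
    also have "(\<lambda>(m,I). I(r := m)) ` (UNIV \<times> ({..<r} \<rightarrow>\<^sub>E UNIV)) = ({..<Suc r} \<rightarrow>\<^sub>E (UNIV :: 'm set))"
      by (simp add: lessThan_Suc PiE_insert_eq)
    finally show ?case .
  qed
  from this[of k] have "f v = (\<Sum>I\<in>{..<k} \<rightarrow>\<^sub>E UNIV. (\<Prod>l<k. c l (I l)) * f (\<lambda>l. if l < k then b (I l) else v l))"
    by simp
  moreover have "f (\<lambda>l. if l < k then b (I l) else v l) = f (\<lambda>l. b (I l))" for I
    by (rule multilinear_form_cong[OF f]) simp
  ultimately show ?thesis by simp
qed

lemma vec_axis_expand: "(x :: real^'n::finite) = (\<Sum>m\<in>UNIV. x $ m *\<^sub>R axis m 1)"
  using basis_expansion[of x] by (simp add: scalar_mult_eq_scaleR)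

lemma multilinear_form_axis_expand:
  fixes f :: "(nat \<Rightarrow> real^'n::finite) \<Rightarrow> real"
  assumes f: "multilinear_form k f"
  shows "f v = (\<Sum>I\<in>{..<k} \<rightarrow>\<^sub>E UNIV. (\<Prod>l<k. v l $ I l) * f (\<lambda>l. axis (I l) 1))"
  by (rule multilinear_form_expand[OF f]) (rule vec_axis_expand)

lemma multilinear_form_comp_linear:
  "multilinear_form k f \<Longrightarrow> multilinear_form k (\<lambda>v. f (\<lambda>i. (J :: real^'n^'n) *v v i))"
  unfolding multilinear_form_def
proof (intro conjI allI impI)
  fix v :: "nat \<Rightarrow> real^'n" and i assume a: "(\<forall>v w. (\<forall>i<k. v i = w i) \<longrightarrow> f v = f w) \<and> (\<forall>v. \<forall>i<k. linear (\<lambda>x. f (v(i := x))))" "i < k"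
  have "(\<lambda>x. f (\<lambda>j. J *v (v(i := x)) j)) = (\<lambda>y. f ((\<lambda>j. J *v v j)(i := y))) \<circ> (\<lambda>x. J *v x)"
    by (auto simp: fun_eq_iff intro!: arg_cong[of _ _ f])
  then show "linear (\<lambda>x. f (\<lambda>j. J *v (v(i := x)) j))"
    using a by (auto intro!: linear_compose)
qed auto

definition orthonormal_frame :: "real^'n^'n \<Rightarrow> real^'n^'n \<Rightarrow> bool" where
  "orthonormal_frame G A \<longleftrightarrow> transpose A ** G ** A = mat 1"

definition posdef :: "real^'n^'n \<Rightarrow> bool" where
  "posdef G \<longleftrightarrow> transpose G = G \<and> (\<forall>v. v \<noteq> 0 \<longrightarrow> 0 < v \<bullet> (G *v v))"

lemma symmetric_matrix_inner: "transpose G = G \<Longrightarrow> u \<bullet> (G *v v) = v \<bullet> (G *v (u :: real^'n))"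
  by (metis dot_lmul_matrix inner_commute transpose_matrix_vector)

text \<open>Gram-Schmidt: as long as \<open>k < n\<close>, some vector lies outside the span of the family, and subtracting
its projections leaves a nonzero vector to be normalised.\<close>

lemma posdef_orthonormal_family:
  fixes G :: "real^'n::finite^'n"
  assumes G: "posdef G" and k: "k \<le> CARD('n)"
  shows "\<exists>b :: nat \<Rightarrow> real^'n. \<forall>i<k. \<forall>j<k. b i \<bullet> (G *v b j) = (if i = j then 1 else 0)"
  using k
proof (induction k)
  case (Suc k)
  note sym = symmetric_matrix_inner[of G] 
  have GT: "transpose G = G" using G by (simp add: posdef_def)
  from Suc obtain b :: "nat \<Rightarrow> real^'n" where b: "\<And>i j. i < k \<Longrightarrow> j < k \<Longrightarrow> b i \<bullet> (G *v b j) = (if i = j then 1 else 0)"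
    by auto
  have "dim (b ` {..<k}) \<le> k"
    by (rule order_trans[OF dim_le_card'])(auto intro: order_trans[OF card_image_le])
  then have "span (b ` {..<k}) \<noteq> UNIV"
    using Suc.prems by (metis dim_span dim_UNIV Suc_le_lessD DIM_cart DIM_real mult_1_right leD)
  then obtain v where v: "v \<notin> span (b ` {..<k})" by auto
  define w where "w = v - (\<Sum>i<k. (b i \<bullet> (G *v v)) *\<^sub>R b i)"
  have w0: "w \<noteq> 0"
  proof
    assume "w = 0"
    then have "v = (\<Sum>i<k. (b i \<bullet> (G *v v)) *\<^sub>R b i)" by (simp add: w_def)
    also have "\<dots> \<in> span (b ` {..<k})" by (intro span_sum span_scale span_base) auto
    finally show False using v by simp
  qed
  define c where "c = w \<bullet> (G *v w)"
  have c: "c > 0" using G w0 by (simp add: c_def posdef_def)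
  have orth: "b j \<bullet> (G *v w) = 0" if "j < k" for j
  proof -
    have "b j \<bullet> (G *v w) = b j \<bullet> (G *v v) - (\<Sum>i<k. (b i \<bullet> (G *v v)) * (b j \<bullet> (G *v b i)))"
      unfolding w_def
      by (simp add: matrix_vector_mult_diff_distrib inner_diff_right linear_sum[OF matrix_vector_mul_linear]
          inner_sum_right linear_cmul[OF matrix_vector_mul_linear])
    also have "(\<Sum>i<k. (b i \<bullet> (G *v v)) * (b j \<bullet> (G *v b i))) = (\<Sum>i<k. if i = j then b j \<bullet> (G *v v) else 0)"
      using that b by (intro sum.cong) auto
    finally show ?thesis using that by simp
  qed
  define b' where "b' = b(k := (1 / sqrt c) *\<^sub>R w)"
  have "b' i \<bullet> (G *v b' j) = (if i = j then 1 else 0)" if ij: "i < Suc k" "j < Suc k" for i j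
  proof -
    consider "i < k" "j < k" | "i = k" "j < k" | "i < k" "j = k" | "i = k" "j = k"
      using ij by linarith
    then show ?thesis
    proof cases
      case 4
      then show ?thesis using c by (simp add: b'_def linear_cmul[OF matrix_vector_mul_linear] c_def[symmetric])
    next
      case 2
      then show ?thesis using orth[of j] sym[OF GT, of w "b j"] by (simp add: b'_def)
    next
      case 3
      then show ?thesis using orth[of i] by (simp add: b'_def linear_cmul[OF matrix_vector_mul_linear])
    qed (use b in \<open>auto simp: b'_def\<close>)
  qed
  then show ?case by blast
qed simp

lemma posdef_orthonormal_frame:
  fixes G :: "real^'n::finite^'n"
  assumes G: "posdef G"
  obtains A where "orthonormal_frame G A"
proof -
  obtain b :: "nat \<Rightarrow> real^'n" where b: "\<And>i j. i < CARD('n) \<Longrightarrow> j < CARD('n) \<Longrightarrow> b i \<bullet> (G *v b j) = (if i = j then 1 else 0)"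
    using posdef_orthonormal_family[OF G order_refl] by auto
  obtain h :: "'n \<Rightarrow> nat" where h: "bij_betw h UNIV {0..<CARD('n)}"
    using ex_bij_betw_finite_nat[of "UNIV :: 'n set"] by auto
  define A :: "real^'n^'n" where "A = (\<chi> i m. b (h m) $ i)"
  have col: "column m A = b (h m)" for m by (simp add: column_def A_def vec_eq_iff)
  have "(transpose A ** G ** A) $ m $ m' = b (h m) \<bullet> (G *v b (h m'))" for m m'
  proof -
    have "(transpose A ** G ** A) $ m $ m' = (transpose A ** (G ** A)) $ m $ m'"
      by (simp add: matrix_mul_assoc)
    also have "\<dots> = row m (transpose A) \<bullet> column m' (G ** A)"
      by (simp add: matrix_mult_dot inner_vec_def row_def column_def matrix_matrix_mult_def)
    also have "column m' (G ** A) = G *v column m' A"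
      by (simp add: column_def matrix_matrix_mult_def matrix_vector_mult_def vec_eq_iff)
    also have "row m (transpose A) = column m A" by (simp)
    finally show ?thesis by (simp add: col)
  qed
  moreover have "h m < CARD('n)" for m using h by (auto simp: bij_betw_def)
  moreover have "h m = h m' \<longleftrightarrow> m = m'" for m m' using h by (auto simp: bij_betw_def inj_on_def)
  ultimately have "transpose A ** G ** A = mat 1"
    using b by (simp add: vec_eq_iff mat_def)
  then show ?thesis using that by (simp add: orthonormal_frame_def)
qed

lemma matrix_inv_both:
  fixes G :: "real^'n::finite^'n"
  assumes "invertible G"
  shows "G ** matrix_inv G = mat 1" "matrix_inv G ** G = mat 1"
  using someI_ex[OF assms[unfolded invertible_def]] by (auto simp: matrix_inv_def)

lemma matrix_inv_eqI:
  fixes G :: "real^'n::finite^'n"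
  assumes "G ** H = mat 1" "H ** G = mat 1"
  shows "matrix_inv G = H"
proof -
  have "invertible G" using assms by (auto simp: invertible_def)
  then have "matrix_inv G ** (G ** H) = H"
    by (simp add: matrix_mul_assoc matrix_inv_both)
  then show ?thesis by (simp add: assms)
qed

lemma orthonormal_frame_inverse:
  fixes G :: "real^'n::finite^'n"
  assumes "orthonormal_frame G A"
  shows "matrix_inv G = A ** transpose A" "invertible A" "det A ^ 2 * det G = 1"
proof -
  have "transpose A ** (G ** A) = mat 1" using assms by (simp add: orthonormal_frame_def matrix_mul_assoc)
  then have "(G ** A) ** transpose A = mat 1" using matrix_left_right_inverse by blast
  then have 1: "G ** (A ** transpose A) = mat 1" by (simp add: matrix_mul_assoc)
  then have 2: "(A ** transpose A) ** G = mat 1" using matrix_left_right_inverse by blast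
  show "matrix_inv G = A ** transpose A" by (rule matrix_inv_eqI[OF 1 2])
  have "det (transpose A ** G ** A) = 1" using assms by (simp add: orthonormal_frame_def)
  then show "det A ^ 2 * det G = 1" by (simp add: det_mul power2_eq_square mult_ac)
  then show "invertible A" by (auto simp: invertible_det_nz)
qed

lemma posdef_det_pos:
  fixes G :: "real^'n::finite^'n"
  assumes "posdef G" shows "0 < det G"
proof -
  obtain A where "orthonormal_frame G A" using posdef_orthonormal_frame[OF assms] .
  from orthonormal_frame_inverse(3)[OF this] have *: "det A ^ 2 * det G = 1" .
  then have "det A ^ 2 > 0" by (metis mult_zero_left zero_less_power2 zero_neq_one power_zero_numeral)
  then show ?thesis using * by (metis zero_less_mult_pos zero_less_one)
qed

lemma orthonormal_frame_pullback:
  assumes "orthonormal_frame (transpose J ** G ** J) A"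
  shows "orthonormal_frame G (J ** A)"
  using assms by (simp add: orthonormal_frame_def matrix_transpose_mul matrix_mul_assoc)

text \<open>In an orthonormal frame the scalar product is a sum over components: the inverse Gram matrix is
\<open>A ** transpose A\<close>, so the product of its entries splits by the distributive law. This reduces all
properties of the norm to those of the Euclidean one.\<close>

lemma alt_inner_orthonormal:
  fixes G :: "real^'n::finite^'n"
  assumes A: "orthonormal_frame G A" and f: "multilinear_form k f" and g: "multilinear_form k g"
  shows "alt_inner G k f g =
    (\<Sum>m\<in>{..<k} \<rightarrow>\<^sub>E UNIV. f (\<lambda>l. column (m l) A) * g (\<lambda>l. column (m l) A)) / fact k"
proof -
  let ?P = "{..<k} \<rightarrow>\<^sub>E (UNIV :: 'n set)"
  have ex: "f (\<lambda>l. column (m l) A) = (\<Sum>i\<in>?P. (\<Prod>l<k. A $ i l $ m l) * f (\<lambda>l. axis (i l) 1))"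
    if "multilinear_form k f" for f m
    by (subst multilinear_form_axis_expand[OF that]) (simp add: column_def)
  have inv: "(\<Prod>l<k. matrix_inv G $ i l $ j l) = (\<Sum>m\<in>?P. (\<Prod>l<k. A $ i l $ m l) * (\<Prod>l<k. A $ j l $ m l))" for i j
    unfolding orthonormal_frame_inverse(1)[OF A]
    by (simp add: matrix_matrix_mult_def transpose_def prod_sum_PiE prod.distrib)
  have "(\<Sum>i\<in>?P. \<Sum>j\<in>?P. (\<Prod>l<k. matrix_inv G $ i l $ j l) * f (\<lambda>l. axis (i l) 1) * g (\<lambda>l. axis (j l) 1))
    = (\<Sum>i\<in>?P. \<Sum>j\<in>?P. \<Sum>m\<in>?P. ((\<Prod>l<k. A $ i l $ m l) * f (\<lambda>l. axis (i l) 1)) * ((\<Prod>l<k. A $ j l $ m l) * g (\<lambda>l. axis (j l) 1)))"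
    unfolding inv by (intro sum.cong refl) (simp add: sum_distrib_right sum_distrib_left mult_ac)
  also have "\<dots> = (\<Sum>i\<in>?P. \<Sum>m\<in>?P. \<Sum>j\<in>?P. ((\<Prod>l<k. A $ i l $ m l) * f (\<lambda>l. axis (i l) 1)) * ((\<Prod>l<k. A $ j l $ m l) * g (\<lambda>l. axis (j l) 1)))"
    by (intro sum.cong refl sum.swap)
  also have "\<dots> = (\<Sum>m\<in>?P. \<Sum>i\<in>?P. \<Sum>j\<in>?P. ((\<Prod>l<k. A $ i l $ m l) * f (\<lambda>l. axis (i l) 1)) * ((\<Prod>l<k. A $ j l $ m l) * g (\<lambda>l. axis (j l) 1)))"
    by (rule sum.swap)
  also have "\<dots> = (\<Sum>m\<in>?P. f (\<lambda>l. column (m l) A) * g (\<lambda>l. column (m l) A))"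
    unfolding ex[OF f] ex[OF g] by (simp only: sum_product)
  finally show ?thesis by (simp add: alt_inner_def)
qed

definition form_norm :: "real^'n^'n \<Rightarrow> nat \<Rightarrow> ((nat \<Rightarrow> real^'n::finite) \<Rightarrow> real) \<Rightarrow> real" where
  "form_norm G k f = sqrt (alt_inner G k f f)"

lemma form_norm_orthonormal:
  fixes G :: "real^'n::finite^'n"
  assumes "orthonormal_frame G A" and "multilinear_form k f"
  shows "form_norm G k f = L2_set (\<lambda>m. f (\<lambda>l. column (m l) A)) ({..<k} \<rightarrow>\<^sub>E UNIV) / sqrt (fact k)"
  using assms by (simp add: form_norm_def alt_inner_orthonormal L2_set_def real_sqrt_divide power2_eq_square)

lemma form_norm_nonneg:
  "posdef G \<Longrightarrow> multilinear_form k f \<Longrightarrow> 0 \<le> form_norm G k f"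
  by (metis posdef_orthonormal_frame form_norm_orthonormal L2_set_nonneg divide_nonneg_nonneg real_sqrt_ge_zero fact_ge_zero)

lemma form_norm_scale: "form_norm G k (\<lambda>v. a * f v) = \<bar>a\<bar> * form_norm G k f"
proof -
  have "alt_inner G k (\<lambda>v. a * f v) (\<lambda>v. a * f v) = a\<^sup>2 * alt_inner G k f f"
    unfolding alt_inner_def times_divide_eq_right sum_distrib_left
    by (intro arg_cong2[of _ _ _ _ "(/)"] refl sum.cong) (simp add: power2_eq_square)
  then show ?thesis by (simp add: form_norm_def real_sqrt_mult)
qed

lemma multilinear_form_add:
  assumes "multilinear_form k f" "multilinear_form k g"
  shows "multilinear_form k (\<lambda>v. f v + g v)"
  unfolding multilinear_form_def
proof (intro conjI allI impI)
  show "(f v + g v) = f w + g w" if "\<forall>i<k. v i = w i" for v w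
    using that assms by (auto simp: multilinear_form_def intro!: arg_cong2[of _ _ _ _ "(+)"])
  show "linear (\<lambda>x. f (v(i := x)) + g (v(i := x)))" if "i < k" for v i
    using that assms by (intro linear_compose_add multilinear_form_linear)
qed

lemma form_norm_triangle:
  assumes G: "posdef G" and f: "multilinear_form k f" and g: "multilinear_form k g"
  shows "form_norm G k (\<lambda>v. f v + g v) \<le> form_norm G k f + form_norm G k g"
proof -
  obtain A where A: "orthonormal_frame G A" using posdef_orthonormal_frame[OF G] .
  show ?thesis
    unfolding form_norm_orthonormal[OF A f] form_norm_orthonormal[OF A g]
      form_norm_orthonormal[OF A multilinear_form_add[OF f g]] add_divide_distrib[symmetric]
    by (intro divide_right_mono L2_set_triangle_ineq) simp
qed

lemma form_norm_frame_component:
  fixes G :: "real^'n::finite^'n"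
  assumes A: "orthonormal_frame G A" and f: "multilinear_form k f"
  shows "\<bar>f (\<lambda>l. column (m l) A)\<bar> \<le> sqrt (fact k) * form_norm G k f"
proof -
  let ?m = "restrict m {..<k}"
  have "\<bar>f (\<lambda>l. column (m l) A)\<bar> = \<bar>f (\<lambda>l. column (?m l) A)\<bar>"
  proof -
    have "f (\<lambda>l. column (m l) A) = f (\<lambda>l. column (?m l) A)"
      by (rule multilinear_form_cong[OF f]) (simp only: restrict_apply' lessThan_iff)
    then show ?thesis by (rule arg_cong)
  qed
  also have "\<dots> = sqrt ((f (\<lambda>l. column (?m l) A))\<^sup>2)" by simp
  also have "\<dots> \<le> sqrt (\<Sum>m\<in>{..<k} \<rightarrow>\<^sub>E UNIV. (f (\<lambda>l. column (m l) A))\<^sup>2)"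
  proof (intro real_sqrt_le_mono member_le_sum[of ?m _ "\<lambda>m. (f (\<lambda>l. column (m l) A))\<^sup>2"])
    show "?m \<in> {..<k} \<rightarrow>\<^sub>E UNIV" by simp
    show "finite ({..<k} \<rightarrow>\<^sub>E (UNIV :: 'n set))" by (simp add: finite_PiE)
  qed simp
  also have "\<dots> = sqrt (fact k) * form_norm G k f"
    by (simp add: form_norm_orthonormal[OF A f] L2_set_def)
  finally show ?thesis .
qed

lemma form_norm_bounds_values:
  fixes G :: "real^'n::finite^'n"
  assumes G: "posdef G"
  shows "\<exists>C\<ge>0. \<forall>f. multilinear_form k f \<longrightarrow> \<bar>f v\<bar> \<le> C * form_norm G k f"
proof -
  obtain A where A: "orthonormal_frame G A" using posdef_orthonormal_frame[OF G] .
  define c where "c l = matrix_inv A *v v l" for l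
  have vl: "v l = (\<Sum>m\<in>UNIV. c l $ m *\<^sub>R column m A)" for l
  proof -
    have "A ** matrix_inv A = mat 1" by (rule matrix_inv_both[OF orthonormal_frame_inverse(2)[OF A]])
    then have "v l = A *v c l" unfolding c_def by (simp add: matrix_vector_mul_assoc)
    then show ?thesis by (simp add: matrix_mult_sum scalar_mult_eq_scaleR)
  qed
  define C where "C = (\<Sum>I\<in>{..<k} \<rightarrow>\<^sub>E UNIV. \<bar>\<Prod>l<k. c l $ I l\<bar>) * sqrt (fact k)"
  have "\<bar>f v\<bar> \<le> C * form_norm G k f" if f: "multilinear_form k f" for f
  proof -
    have "f v = (\<Sum>I\<in>{..<k} \<rightarrow>\<^sub>E UNIV. (\<Prod>l<k. c l $ I l) * f (\<lambda>l. column (I l) A))"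
      by (rule multilinear_form_expand[OF f vl])
    also have "\<bar>\<dots>\<bar> \<le> (\<Sum>I\<in>{..<k} \<rightarrow>\<^sub>E UNIV. \<bar>\<Prod>l<k. c l $ I l\<bar> * (sqrt (fact k) * form_norm G k f))"
    proof (rule order_trans[OF sum_abs], rule sum_mono)
      fix I :: "nat \<Rightarrow> 'n"
      show "\<bar>(\<Prod>l<k. c l $ I l) * f (\<lambda>l. column (I l) A)\<bar>
          \<le> \<bar>\<Prod>l<k. c l $ I l\<bar> * (sqrt (fact k) * form_norm G k f)"
        unfolding abs_mult[of "\<Prod>l<k. c l $ I l"]
        by (intro mult_left_mono form_norm_frame_component[OF A f] abs_ge_zero)
    qed
    also have "\<dots> = C * form_norm G k f"
      by (simp add: C_def sum_distrib_right mult.assoc)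
    finally show ?thesis .
  qed
  moreover have "C \<ge> 0" by (simp add: C_def sum_nonneg)
  ultimately show ?thesis by blast
qed

text \<open>A frame that is orthonormal for the pulled back scalar product is mapped to an orthonormal frame.
Hence the pointwise norm of a form is the same in all charts.\<close>

lemma form_norm_pullback:
  fixes G J :: "real^'n::finite^'n"
  assumes GJ: "posdef (transpose J ** G ** J)" and f: "multilinear_form k f"
  shows "form_norm (transpose J ** G ** J) k (\<lambda>v. f (\<lambda>i. J *v v i)) = form_norm G k f"
proof -
  obtain A where A: "orthonormal_frame (transpose J ** G ** J) A" using posdef_orthonormal_frame[OF GJ] .
  have "column m (J ** A) = J *v column m A" for m
    by (simp add: column_def matrix_matrix_mult_def matrix_vector_mult_def vec_eq_iff)
  then show ?thesis
    by (simp add: form_norm_orthonormal[OF A multilinear_form_comp_linear[OF f, of J]]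
        form_norm_orthonormal[OF orthonormal_frame_pullback[OF A] f])
qed

lemma form_norm_tendsto:
  assumes "\<And>v. (\<lambda>n. f n v) \<longlonglongrightarrow> g v"
  shows "(\<lambda>n. form_norm G k (f n)) \<longlonglongrightarrow> form_norm G k g"
  unfolding form_norm_def alt_inner_def by (intro tendsto_intros assms) simp


text \<open>This separates the algebra at a point from the dependence on points and charts.\<close>

definition wedge_val :: "nat \<Rightarrow> nat \<Rightarrow> ((nat \<Rightarrow> 'v) \<Rightarrow> real) \<Rightarrow> ((nat \<Rightarrow> 'v) \<Rightarrow> real) \<Rightarrow> (nat \<Rightarrow> 'v) \<Rightarrow> real" where
  "wedge_val k m f g v = (\<Sum>s | s permutes {..<k+m}.
     of_int (sign s) * f (\<lambda>i. v (s i)) * g (\<lambda>i. v (s (k + i)))) / (fact k * fact m)"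

lemma wedge_eq_wedge_val: "wedge k m \<alpha> \<beta> c p = wedge_val k m (\<alpha> c p) (\<beta> c p)"
  by (simp add: wedge_def wedge_val_def fun_eq_iff)

text \<open>Reindexing the sum over permutations moves \<open>p\<close> into the summation variable.\<close>

lemma wedge_val_permute:
  assumes p: "p permutes {..<k+m}"
  shows "wedge_val k m f g (\<lambda>i. v (p i)) = of_int (sign p) * wedge_val k m f g v"
proof -
  let ?F = "\<lambda>s. of_int (sign s) * f (\<lambda>i. v (s i)) * g (\<lambda>i. v (s (k + i)))"
  have pp: "permutation p" using p by (rule permutes_imp_permutation[rotated]) simp
  have "(\<Sum>s | s permutes {..<k+m}. ?F s) = (\<Sum>s | s permutes {..<k+m}. ?F (p \<circ> s))"
    by (rule setum_permutations_compose_left[OF p])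
  also have "\<dots> = (\<Sum>s | s permutes {..<k+m}. of_int (sign p) *
      (of_int (sign s) * f (\<lambda>i. v (p (s i))) * g (\<lambda>i. v (p (s (k + i))))))"
    by (intro sum.cong refl) (auto simp: sign_compose[OF pp permutes_imp_permutation[of "{..<k+m}"]])
  finally have "(\<Sum>s | s permutes {..<k+m}. ?F s) = of_int (sign p) *
     (\<Sum>s | s permutes {..<k+m}. of_int (sign s) * f (\<lambda>i. v (p (s i))) * g (\<lambda>i. v (p (s (k + i)))))"
    by (simp add: sum_distrib_left)
  moreover have "of_int (sign p) * (of_int (sign p) * x) = (x :: real)" for x
    by (simp add: sign_def)
  ultimately show ?thesis unfolding wedge_val_def by (simp add: mult.assoc)
qed

lemma wedge_val_alternating:
  assumes ab: "a < k + m" "b < k + m" "a \<noteq> b" "v a = v b"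
  shows "wedge_val k m f g v = 0"
proof -
  let ?t = "Transposition.transpose a b"
  have "wedge_val k m f g (\<lambda>i. v (?t i)) = of_int (sign ?t) * wedge_val k m f g v"
    using ab by (intro wedge_val_permute permutes_swap_id) auto
  moreover have "(\<lambda>i. v (?t i)) = v" using ab by (auto simp: fun_eq_iff Transposition.transpose_def)
  ultimately show ?thesis using ab by (simp add: sign_swap_id)
qed

lemma wedge_val_multilinear:
  fixes f g :: "(nat \<Rightarrow> real^'n::finite) \<Rightarrow> real"
  assumes f: "multilinear_form k f" and g: "multilinear_form m g"
  shows "multilinear_form (k + m) (wedge_val k m f g)"
  unfolding multilinear_form_def
proof (intro conjI allI impI)
  fix v w :: "nat \<Rightarrow> real^'n" assume vw: "\<forall>i<k+m. v i = w i"
  show "wedge_val k m f g v = wedge_val k m f g w" unfolding wedge_val_def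
  proof (intro arg_cong2[of _ _ _ _ "(/)"] arg_cong2[of _ _ _ _ "(*)"] sum.cong refl)
    fix s assume "s \<in> {s. s permutes {..<k+m}}"
    then have s: "s i < k + m" if "i < k + m" for i using permutes_in_image[of s "{..<k+m}" i] that by auto
    show "f (\<lambda>i. v (s i)) = f (\<lambda>i. w (s i))" using vw s by (intro multilinear_form_cong[OF f]) auto
    show "g (\<lambda>i. v (s (k+i))) = g (\<lambda>i. w (s (k+i)))" using vw s by (intro multilinear_form_cong[OF g]) auto
  qed
next
  fix v :: "nat \<Rightarrow> real^'n" and i assume i: "i < k + m"
  have "linear (\<lambda>x. of_int (sign s) * f (\<lambda>l. (v(i := x)) (s l)) * g (\<lambda>l. (v(i := x)) (s (k + l))))"
    if s: "s permutes {..<k+m}" for s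
  proof -
    obtain j where j: "s j = i" "j < k + m" using permutes_in_image[OF s] s i
      by (metis lessThan_iff permutes_inverses(1))
    have sj: "s l = i \<longleftrightarrow> l = j" for l using j(1) s by (metis permutes_def)
    show ?thesis
    proof (cases "j < k")
      case True
      have "f (\<lambda>l. (v(i := x)) (s l)) = f ((\<lambda>l. v (s l))(j := x))" for x
        by (rule multilinear_form_cong[OF f]) (simp add: sj)
      moreover have "g (\<lambda>l. (v(i := x)) (s (k + l))) = g (\<lambda>l. v (s (k + l)))" for x
        using True by (intro multilinear_form_cong[OF g]) (simp add: sj)
      moreover have "linear (\<lambda>x. (of_int (sign s) * g (\<lambda>l. v (s (k + l)))) *\<^sub>R f ((\<lambda>l. v (s l))(j := x)))"
        by (intro linear_compose_scale_right multilinear_form_linear[OF f True])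
      ultimately show ?thesis by (simp add: mult_ac)
    next
      case False
      then have jm: "j - k < m" using j by auto
      have "g (\<lambda>l. (v(i := x)) (s (k + l))) = g ((\<lambda>l. v (s (k + l)))(j - k := x))" for x
        using False by (intro multilinear_form_cong[OF g]) (auto simp: sj)
      moreover have "f (\<lambda>l. (v(i := x)) (s l)) = f (\<lambda>l. v (s l))" for x
        using False by (intro multilinear_form_cong[OF f]) (auto simp: sj)
      moreover have "linear (\<lambda>x. (of_int (sign s) * f (\<lambda>l. v (s l))) *\<^sub>R g ((\<lambda>l. v (s (k + l)))(j - k := x)))"
        by (intro linear_compose_scale_right multilinear_form_linear[OF g jm])
      ultimately show ?thesis by (simp add: mult_ac)
    qed
  qed
  then have "linear (\<lambda>x. (1 / (fact k * fact m)) *\<^sub>R (\<Sum>s | s permutes {..<k+m}.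
      of_int (sign s) * f (\<lambda>l. (v(i := x)) (s l)) * g (\<lambda>l. (v(i := x)) (s (k + l)))))"
    by (intro linear_compose_scale_right linear_compose_sum) auto
  then show "linear (\<lambda>x. wedge_val k m f g (v(i := x)))"
    by (simp add: wedge_val_def)
qed

lemma coord_frame_bij:
  "bij_betw (\<lambda>i. sorted_list_of_set (UNIV :: 'n::{finite,wellorder} set) ! i) {..<CARD('n)} UNIV"
  by (rule bij_betw_nth) (auto simp: length_sorted_list_of_set)

text \<open>The Leibniz formula: in the expansion of the left-hand side over multi-indices, those with a
repetition contribute nothing and the others are permutations.\<close>

lemma wedge_val_top_degree:
  fixes f g :: "(nat \<Rightarrow> real^'n::{finite,wellorder}) \<Rightarrow> real"
  assumes f: "multilinear_form k f" and g: "multilinear_form m g" and n: "k + m = CARD('n)"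
  shows "wedge_val k m f g (\<lambda>i. J *v coord_frame i) = det J * wedge_val k m f g coord_frame"
proof -
  define e where "e i = sorted_list_of_set (UNIV :: 'n set) ! i" for i
  define N where "N = {..<CARD('n)}"
  define F where "F = wedge_val k m f g"
  have e: "bij_betw e N UNIV" using coord_frame_bij unfolding e_def N_def .
  have cf: "coord_frame i = axis (e i) 1" for i by (simp add: coord_frame_def e_def)
  have inj: "inj_on e N" and surj: "e ` N = UNIV" using e by (auto simp: bij_betw_def)
  define q where "q = inv_into N e"
  have q: "e (q a) = a" "q a \<in> N" for a using surj unfolding q_def by (auto intro: f_inv_into_f inv_into_into)
  have qe: "q (e i) = i" if "i \<in> N" for i using inj that by (simp add: q_def)
  have F: "multilinear_form (CARD('n)) F" using wedge_val_multilinear[OF f g] unfolding F_def n .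
  let ?c = "\<lambda>I. (\<Prod>i\<in>N. J $ (I i) $ e i)"
  have col: "J *v coord_frame l = (\<Sum>r\<in>UNIV. J $ r $ e l *\<^sub>R axis r 1)" for l
    by (subst vec_axis_expand) (simp add: cf matrix_vector_mult_basis column_def)
  have "F (\<lambda>i. J *v coord_frame i) = (\<Sum>I\<in>N \<rightarrow>\<^sub>E UNIV. ?c I * F (\<lambda>l. axis (I l) 1))"
    unfolding N_def by (rule multilinear_form_expand[OF F]) (rule col)
  also have "\<dots> = (\<Sum>I\<in>{I \<in> N \<rightarrow>\<^sub>E UNIV. inj_on I N}. ?c I * F (\<lambda>l. axis (I l) 1))"
  proof (rule sum.mono_neutral_right)
    show "\<forall>I\<in>(N \<rightarrow>\<^sub>E UNIV) - {I \<in> N \<rightarrow>\<^sub>E UNIV. inj_on I N}. ?c I * F (\<lambda>l. axis (I l) 1) = 0"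
    proof
      fix I :: "nat \<Rightarrow> 'n" assume "I \<in> (N \<rightarrow>\<^sub>E UNIV) - {I \<in> N \<rightarrow>\<^sub>E UNIV. inj_on I N}"
      then obtain a b where "a \<in> N" "b \<in> N" "a \<noteq> b" "I a = I b" by (auto simp: inj_on_def)
      then have "F (\<lambda>l. axis (I l) 1) = 0" unfolding F_def
        by (intro wedge_val_alternating[of a _ _ b]) (auto simp: N_def n)
      then show "?c I * F (\<lambda>l. axis (I l) 1) = 0" by simp
    qed
  qed (auto simp: finite_PiE N_def)
  also have "\<dots> = (\<Sum>p | p permutes (UNIV :: 'n set). of_int (sign p) * (\<Prod>i\<in>UNIV. J $ p i $ i) * F coord_frame)"
  proof (rule sum.reindex_bij_witness[of _ "\<lambda>p. restrict (\<lambda>i. p (e i)) N" "\<lambda>I a. I (q a)"])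
    fix I assume I: "I \<in> {I \<in> N \<rightarrow>\<^sub>E (UNIV :: 'n set). inj_on I N}"
    show "restrict (\<lambda>i. I (q (e i))) N = I" using I qe by (auto simp: fun_eq_iff PiE_def extensional_def)
    have "inj (\<lambda>a. I (q a))"
      using I q by (auto simp: inj_on_def) (metis q)
    then have P: "(\<lambda>a. I (q a)) permutes UNIV"
      using finite_UNIV_inj_surj[OF finite] by (intro bij_imp_permutes) (simp_all add: bij_betw_def)
    then show "(\<lambda>a. I (q a)) \<in> {p. p permutes UNIV}" by simp
    define s where "s = map_permutation UNIV q (\<lambda>a. I (q a))"
    have bq: "bij_betw q UNIV N" unfolding q_def using bij_betw_inv_into[OF e] .
    have sN: "s permutes N" unfolding s_def by (rule map_permutation_permutes[OF bq P])
    have "s i = q (I i)" if "i \<in> N" for i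
      using map_permutation_apply[of q UNIV "e i" "\<lambda>a. I (q a)"] bq qe[OF that] unfolding s_def
      by (auto simp: bij_betw_def)
    then have "F (\<lambda>l. axis (I l) 1) = F (\<lambda>l. coord_frame (s l))"
      by (intro multilinear_form_cong[OF F]) (simp add: cf q N_def)
    also have "\<dots> = of_int (sign s) * F coord_frame"
      unfolding F_def by (rule wedge_val_permute) (use sN in \<open>simp add: N_def n\<close>)
    also have "sign s = sign (\<lambda>a. I (q a))" unfolding s_def
      using bq by (intro sign_map_permutation P) (auto simp: bij_betw_def)
    finally have 1: "F (\<lambda>l. axis (I l) 1) = of_int (sign (\<lambda>a. I (q a))) * F coord_frame" .
    have "?c I = (\<Prod>a\<in>UNIV. J $ I (q a) $ a)"
      using bq by (intro prod.reindex_bij_witness[of _ q e]) (auto simp: q qe)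
    with 1 show "of_int (sign (\<lambda>a. I (q a))) * (\<Prod>a\<in>UNIV. J $ I (q a) $ a) * F coord_frame
       = ?c I * F (\<lambda>l. axis (I l) 1)" by simp
  next
    fix p assume "p \<in> {p. p permutes (UNIV :: 'n set)}"
    then have p: "p permutes UNIV" by simp
    show "(\<lambda>a. restrict (\<lambda>i. p (e i)) N (q a)) = p" by (auto simp: q fun_eq_iff)
    have "inj p" using p by (rule permutes_inj)
    then show "restrict (\<lambda>i. p (e i)) N \<in> {I \<in> N \<rightarrow>\<^sub>E UNIV. inj_on I N}"
      using inj by (auto simp: inj_on_def)
  qed
  also have "\<dots> = det (transpose J) * F coord_frame"
    by (simp add: det_def sum_distrib_right transpose_def)
  finally show ?thesis unfolding F_def by simp
qed

text \<open>In an orthonormal frame every factor of every summand is a component, hence bounded by the norm;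
passing to the coordinate frame costs the factor \<open>\<bar>det A\<bar>\<close>, the inverse of the square root of
\<open>det G\<close>.\<close>

lemma wedge_val_form_norm_bound:
  fixes f g :: "(nat \<Rightarrow> real^'n::{finite,wellorder}) \<Rightarrow> real"
  assumes f: "multilinear_form k f" and g: "multilinear_form m g" and n: "k + m = CARD('n)"
    and G: "posdef G"
  shows "\<bar>wedge_val k m f g coord_frame\<bar> / sqrt (det G)
     \<le> real (card {s. s permutes {..<k+m}}) * sqrt (fact k) * sqrt (fact m) * (form_norm G k f * form_norm G m g)"
proof -
  obtain A where A: "orthonormal_frame G A" using posdef_orthonormal_frame[OF G] .
  have dA: "\<bar>det A\<bar> = 1 / sqrt (det G)"
  proof -
    have "sqrt (det A ^ 2 * det G) = 1" using orthonormal_frame_inverse(3)[OF A] by simp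
    then show ?thesis using posdef_det_pos[OF G] by (simp add: real_sqrt_mult field_simps)
  qed
  have cols: "\<exists>c. \<forall>i. A *v coord_frame i = column (c i) A" 
    by (auto simp: coord_frame_def matrix_vector_mult_basis)
  then obtain c where c: "\<And>i. A *v coord_frame i = column (c i) A" by auto
  let ?F = "form_norm G k f" and ?G = "form_norm G m g"
  have F0: "?F \<ge> 0" "?G \<ge> 0" using form_norm_nonneg[OF G] f g by auto
  have "\<bar>wedge_val k m f g coord_frame\<bar> / sqrt (det G) = \<bar>wedge_val k m f g (\<lambda>i. column (c i) A)\<bar>"
    using wedge_val_top_degree[OF f g n, of A] dA by (simp add: c abs_mult)
  also have "\<dots> \<le> (\<Sum>s | s permutes {..<k+m}. \<bar>of_int (sign s) * f (\<lambda>i. column (c (s i)) A) * g (\<lambda>i. column (c (s (k + i))) A)\<bar>) / (fact k * fact m)"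
    unfolding wedge_val_def abs_divide by (intro frac_le sum_abs) auto
  also have "\<dots> \<le> (\<Sum>s | s permutes {..<k+m}. (sqrt (fact k) * ?F) * (sqrt (fact m) * ?G)) / 1"
  proof (intro frac_le sum_mono)
    fix s :: "nat \<Rightarrow> nat"
    have "\<bar>of_int (sign s) :: real\<bar> = 1" by (simp add: sign_def)
    then show "\<bar>of_int (sign s) * f (\<lambda>i. column (c (s i)) A) * g (\<lambda>i. column (c (s (k + i))) A)\<bar>
      \<le> (sqrt (fact k) * ?F) * (sqrt (fact m) * ?G)"
      using form_norm_frame_component[OF A f, of "\<lambda>i. c (s i)"] form_norm_frame_component[OF A g, of "\<lambda>i. c (s (k + i))"] F0
      by (auto simp: abs_mult intro!: mult_mono)
    show "1 \<le> fact k * (fact m :: real)" using mult_mono[of 1 "fact k :: real" 1 "fact m"] by (simp add: fact_ge_1)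
  qed (auto intro!: sum_nonneg mult_nonneg_nonneg F0)
  also have "\<dots> = real (card {s. s permutes {..<k+m}}) * sqrt (fact k) * sqrt (fact m) * (?F * ?G)"
    by simp
  finally show ?thesis .
qed

section \<open>The exterior differential under changes of coordinates\<close>

text \<open>The mean value theorem, applied to the difference \<open>f (x + a v + h w) - f (x + a v)\<close> as a function
of \<open>a\<close> and then to its derivative as a function of the other increment.\<close>

lemma second_difference_mvt:
  fixes f :: "'e::real_normed_vector \<Rightarrow> real"
  assumes f1: "\<And>x. x \<in> V \<Longrightarrow> (f has_derivative f' x) (at x)"
    and f2: "\<And>x. x \<in> V \<Longrightarrow> ((\<lambda>x. f' x v) has_derivative g x) (at x)"
    and h: "h > 0" and inV: "\<And>a b. 0 \<le> a \<Longrightarrow> a \<le> h \<Longrightarrow> 0 \<le> b \<Longrightarrow> b \<le> h \<Longrightarrow> x + a *\<^sub>R v + b *\<^sub>R w \<in> V"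
  shows "\<exists>a b. 0 < a \<and> a < h \<and> 0 < b \<and> b < h \<and>
    f (x + h *\<^sub>R v + h *\<^sub>R w) - f (x + h *\<^sub>R v) - f (x + h *\<^sub>R w) + f x = h * h * g (x + a *\<^sub>R v + b *\<^sub>R w) w"
proof -
  let ?F = "\<lambda>a. f (x + a *\<^sub>R v + h *\<^sub>R w) - f (x + a *\<^sub>R v + 0 *\<^sub>R w)"
  have dF: "(?F has_real_derivative f' (x + a *\<^sub>R v + h *\<^sub>R w) v - f' (x + a *\<^sub>R v + 0 *\<^sub>R w) v) (at a)"
    if "0 \<le> a" "a \<le> h" for a
  proof -
    have "((\<lambda>a. f (x + a *\<^sub>R v + b *\<^sub>R w)) has_derivative (\<lambda>t. f' (x + a *\<^sub>R v + b *\<^sub>R w) (t *\<^sub>R v))) (at a)"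
      if b: "0 \<le> b" "b \<le> h" for b
    proof (rule has_derivative_compose[where f="\<lambda>a. x + a *\<^sub>R v + b *\<^sub>R w" and g=f, OF _ f1[OF inV[OF \<open>0 \<le> a\<close> \<open>a \<le> h\<close> b]]])
      show "((\<lambda>a. x + a *\<^sub>R v + b *\<^sub>R w) has_derivative (\<lambda>t. t *\<^sub>R v)) (at a)"
        by (auto intro!: derivative_eq_intros)
    qed
    moreover have "f' (x + a *\<^sub>R v + b *\<^sub>R w) (t *\<^sub>R v) = f' (x + a *\<^sub>R v + b *\<^sub>R w) v * t"
      if b: "0 \<le> b" "b \<le> h" for b t
      using linear_cmul[OF has_derivative_linear[OF f1[OF inV[OF \<open>0 \<le> a\<close> \<open>a \<le> h\<close> b]]]] by simp
    ultimately have "((\<lambda>a. f (x + a *\<^sub>R v + b *\<^sub>R w)) has_real_derivative f' (x + a *\<^sub>R v + b *\<^sub>R w) v) (at a)"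
      if b: "0 \<le> b" "b \<le> h" for b
      using b unfolding has_field_derivative_def by (simp add: fun_eq_iff)
    from this[of h] this[of 0] h show ?thesis by (intro DERIV_diff) auto
  qed
  obtain a where a: "0 < a" "a < h"
    "?F h - ?F 0 = (h - 0) * (f' (x + a *\<^sub>R v + h *\<^sub>R w) v - f' (x + a *\<^sub>R v + 0 *\<^sub>R w) v)"
    using MVT2[OF h, of ?F, OF dF] by blast
  have dG: "((\<lambda>b. f' (x + a *\<^sub>R v + b *\<^sub>R w) v) has_real_derivative g (x + a *\<^sub>R v + b *\<^sub>R w) w) (at b)"
    if b: "0 \<le> b" "b \<le> h" for b
  proof -
    have V: "x + a *\<^sub>R v + b *\<^sub>R w \<in> V" using a b by (intro inV) auto
    have "((\<lambda>b. f' (x + a *\<^sub>R v + b *\<^sub>R w) v) has_derivative (\<lambda>t. g (x + a *\<^sub>R v + b *\<^sub>R w) (t *\<^sub>R w))) (at b)"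
    proof (rule has_derivative_compose[where f="\<lambda>b. x + a *\<^sub>R v + b *\<^sub>R w" and g="\<lambda>x. f' x v", OF _ f2[OF V]])
      show "((\<lambda>b. x + a *\<^sub>R v + b *\<^sub>R w) has_derivative (\<lambda>t. t *\<^sub>R w)) (at b)"
        by (auto intro!: derivative_eq_intros)
    qed
    moreover have "g (x + a *\<^sub>R v + b *\<^sub>R w) (t *\<^sub>R w) = g (x + a *\<^sub>R v + b *\<^sub>R w) w * t" for t
      using linear_cmul[OF has_derivative_linear[OF f2[OF V]]] by simp
    ultimately show ?thesis unfolding has_field_derivative_def by (simp add: fun_eq_iff)
  qed
  obtain b where b: "0 < b" "b < h"
    "f' (x + a *\<^sub>R v + h *\<^sub>R w) v - f' (x + a *\<^sub>R v + 0 *\<^sub>R w) v = (h - 0) * g (x + a *\<^sub>R v + b *\<^sub>R w) w"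
    using MVT2[OF h, of "\<lambda>b. f' (x + a *\<^sub>R v + b *\<^sub>R w) v", OF dG] by blast
  show ?thesis
    using a b by (intro exI[of _ a] exI[of _ b]) (simp add: algebra_simps)
qed

text \<open>Schwarz's theorem: the second difference is symmetric in \<open>v\<close> and \<open>w\<close>, and by
\<open>second_difference_mvt\<close> it approximates both mixed derivatives.\<close>

lemma second_derivative_symmetric:
  fixes f :: "'e::real_normed_vector \<Rightarrow> real"
  assumes V: "open V" "x \<in> V"
    and f1: "\<And>x. x \<in> V \<Longrightarrow> (f has_derivative f' x) (at x)"
    and f2: "\<And>v x. x \<in> V \<Longrightarrow> ((\<lambda>x. f' x v) has_derivative f'' v x) (at x)"
    and cont: "\<And>v w. continuous_on V (\<lambda>x. f'' v x w)"
  shows "f'' v x w = f'' w x v"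
proof (rule ccontr)
  assume ne: "f'' v x w \<noteq> f'' w x v"
  define e where "e = \<bar>f'' v x w - f'' w x v\<bar> / 2"
  have e: "e > 0" using ne by (simp add: e_def)
  have near: "\<exists>d>0. \<forall>y. dist y x < d \<longrightarrow> y \<in> V \<and> \<bar>f'' v y w - f'' v x w\<bar> < e" for v w
  proof -
    have "isCont (\<lambda>x. f'' v x w) x" using cont V by (simp add: continuous_on_eq_continuous_at)
    then obtain d1 where d1: "d1 > 0" "\<And>y. dist y x < d1 \<Longrightarrow> \<bar>f'' v y w - f'' v x w\<bar> < e"
      using e unfolding continuous_at_eps_delta dist_real_def by metis
    obtain d2 where d2: "d2 > 0" "ball x d2 \<subseteq> V" using V openE by blast
    show ?thesis using d1 d2 by (intro exI[of _ "min d1 d2"]) (auto simp: dist_commute subset_iff)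
  qed
  from near[of v w] near[of w v] obtain d1 d2 where d: "d1 > 0" "d2 > 0"
    "\<And>y. dist y x < d1 \<Longrightarrow> y \<in> V \<and> \<bar>f'' v y w - f'' v x w\<bar> < e"
    "\<And>y. dist y x < d2 \<Longrightarrow> y \<in> V \<and> \<bar>f'' w y v - f'' w x v\<bar> < e" by blast
  \<comment> \<open>Small enough for all points of the second difference to lie in both neighbourhoods.\<close>
  define h where "h = min d1 d2 / (2 * (norm v + norm w + 1))"
  have h: "h > 0" unfolding h_def using d by (intro divide_pos_pos) (auto simp: add_nonneg_pos)
  have hn: "h * (norm v + norm w) < min d1 d2"
  proof -
    have "h * (norm v + norm w) \<le> h * (norm v + norm w + 1)" using h by (intro mult_left_mono) auto
    also have "\<dots> = min d1 d2 / 2"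
      unfolding h_def using norm_ge_zero[of v] norm_ge_zero[of w] by (simp add: field_simps add_nonneg_eq_0_iff)
    also have "\<dots> < min d1 d2"
    proof -
      have "min d1 d2 > 0" using d by simp
      then show ?thesis by linarith
    qed
    finally show ?thesis .
  qed
  have close: "dist (x + a *\<^sub>R v + b *\<^sub>R w) x < min d1 d2" "dist (x + b *\<^sub>R w + a *\<^sub>R v) x < min d1 d2"
    if "0 \<le> a" "a \<le> h" "0 \<le> b" "b \<le> h" for a b
  proof -
    have "norm (a *\<^sub>R v + b *\<^sub>R w) \<le> a * norm v + b * norm w"
      using norm_triangle_ineq[of "a *\<^sub>R v" "b *\<^sub>R w"] that by simp
    also have "\<dots> \<le> h * norm v + h * norm w" using that by (intro add_mono mult_right_mono) auto
    finally have "norm (a *\<^sub>R v + b *\<^sub>R w) < min d1 d2" using hn by (simp add: algebra_simps)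
    then show "dist (x + a *\<^sub>R v + b *\<^sub>R w) x < min d1 d2" "dist (x + b *\<^sub>R w + a *\<^sub>R v) x < min d1 d2"
      by (simp_all add: dist_norm add.assoc add.commute)
  qed
  have "\<exists>a b. 0 < a \<and> a < h \<and> 0 < b \<and> b < h \<and>
    f (x + h *\<^sub>R v + h *\<^sub>R w) - f (x + h *\<^sub>R v) - f (x + h *\<^sub>R w) + f x = h * h * f'' v (x + a *\<^sub>R v + b *\<^sub>R w) w"
    by (rule second_difference_mvt[OF f1 f2 h]) (use close(1) d(3) in auto)
  then obtain a b where ab: "0 < a" "a < h" "0 < b" "b < h"
    "f (x + h *\<^sub>R v + h *\<^sub>R w) - f (x + h *\<^sub>R v) - f (x + h *\<^sub>R w) + f x = h * h * f'' v (x + a *\<^sub>R v + b *\<^sub>R w) w"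
    by blast
  have "\<exists>a b. 0 < a \<and> a < h \<and> 0 < b \<and> b < h \<and>
    f (x + h *\<^sub>R w + h *\<^sub>R v) - f (x + h *\<^sub>R w) - f (x + h *\<^sub>R v) + f x = h * h * f'' w (x + a *\<^sub>R w + b *\<^sub>R v) v"
    by (rule second_difference_mvt[OF f1 f2 h]) (use close(2) d(3) in auto)
  then obtain a' b' where ab': "0 < a'" "a' < h" "0 < b'" "b' < h"
    "f (x + h *\<^sub>R w + h *\<^sub>R v) - f (x + h *\<^sub>R w) - f (x + h *\<^sub>R v) + f x = h * h * f'' w (x + a' *\<^sub>R w + b' *\<^sub>R v) v"
    by blast
  have comm: "x + h *\<^sub>R w + h *\<^sub>R v = x + h *\<^sub>R v + h *\<^sub>R w" by simp
  have "h * h * f'' v (x + a *\<^sub>R v + b *\<^sub>R w) w = h * h * f'' w (x + a' *\<^sub>R w + b' *\<^sub>R v) v"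
    using ab(5) ab'(5) unfolding comm by linarith
  then have eq: "f'' v (x + a *\<^sub>R v + b *\<^sub>R w) w = f'' w (x + a' *\<^sub>R w + b' *\<^sub>R v) v" using h by simp
  have "\<bar>f'' v (x + a *\<^sub>R v + b *\<^sub>R w) w - f'' v x w\<bar> < e"
    using d(3) close(1)[of a b] ab by auto
  moreover have "\<bar>f'' w (x + a' *\<^sub>R w + b' *\<^sub>R v) v - f'' w x v\<bar> < e"
    using d(4) close(2)[of b' a'] ab' by auto
  ultimately show False using eq unfolding e_def by (simp add: field_simps abs_if split: if_splits)
qed

lemma alt_form_swap:
  assumes f: "alt_form k f" and pq: "p < q" "q < k"
  shows "f (v(p := v q, q := v p)) = - f v"
proof -
  define g where "g x y = f (v(p := x, q := y))" for x y
  have lin1: "linear (\<lambda>x. g x y)" for y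
  proof -
    have "linear (\<lambda>x. f ((v(q := y))(p := x)))" using f pq by (simp add: alt_form_def)
    moreover have "(v(q := y))(p := x) = v(p := x, q := y)" for x using pq by (auto simp: fun_eq_iff)
    ultimately show ?thesis by (simp add: g_def)
  qed
  have lin2: "linear (g x)" for x
    using f pq by (simp add: alt_form_def g_def[abs_def])
  have diag: "g x x = 0" for x
  proof -
    have "(v(p := x, q := x)) p = (v(p := x, q := x)) q" using pq by simp
    then show ?thesis
      unfolding g_def using f[unfolded alt_form_def, THEN conjunct2, THEN conjunct2, rule_format, of p q] pq by blast
  qed
  have "g (v p + v q) (v p + v q) = g (v p) (v p) + g (v p) (v q) + (g (v q) (v p) + g (v q) (v q))"
    by (simp add: linear_add[OF lin1] linear_add[OF lin2])
  then have "g (v q) (v p) = - g (v p) (v q)" using diag by simp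
  then show ?thesis by (simp add: g_def)
qed

definition omit :: "nat \<Rightarrow> (nat \<Rightarrow> 'v) \<Rightarrow> nat \<Rightarrow> 'v" where
  "omit i v = (\<lambda>j. if j < i then v j else v (Suc j))"

definition insert_at :: "nat \<Rightarrow> 'v \<Rightarrow> (nat \<Rightarrow> 'v) \<Rightarrow> nat \<Rightarrow> 'v" where
  "insert_at q b w = (\<lambda>j. if j < q then w j else if j = q then b else w (j - 1))"

text \<open>Each step of the inserted argument to the right is a transposition.\<close>

lemma alt_form_insert_at:
  assumes f: "alt_form k f"
  shows "l + r < k \<Longrightarrow> f (insert_at (l + r) b w) = (-1) ^ r * f (insert_at l b w)"
proof (induction r)
  case (Suc r)
  have "(insert_at (l + r) b w)(l + r := insert_at (l + r) b w (Suc (l + r)), Suc (l + r) := insert_at (l + r) b w (l + r))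
      = insert_at (l + Suc r) b w"
    by (auto simp: insert_at_def fun_eq_iff)
  then have "f (insert_at (l + Suc r) b w) = - f (insert_at (l + r) b w)"
    using alt_form_swap[OF f, of "l + r" "Suc (l + r)" "insert_at (l + r) b w"] Suc.prems by simp
  then show ?case using Suc by simp
qed simp

text \<open>Each pair of distinct indices is met twice, in both orders; the two terms differ by moving one
argument from one position to the other, and cancel because of the alternating signs.\<close>

lemma alternating_omit_cancel:
  fixes f :: "(nat \<Rightarrow> real^'n::finite) \<Rightarrow> real"
  assumes f: "alt_form m f" and B: "\<And>i j. B i j = B j i"
  shows "(\<Sum>i\<le>m. \<Sum>l<m. (-1) ^ i * f ((omit i u)(l := B i (if l < i then l else Suc l)))) = 0"
proof -
  define t where "t x = (case x of (i, l) \<Rightarrow> (-1) ^ i * f ((omit i u)(l := B i (if l < i then l else Suc l))))" for x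
  \<comment> \<open>The involution that exchanges the omitted index and the index of the slot that is filled.\<close>
  define \<sigma> where "\<sigma> x = (case x of (i, l) \<Rightarrow> if l < i then (l, i - 1) else (Suc l, i :: nat))" for x
  have key: "t (l, i - 1) = - t (i, l)" if "l < i" "i \<le> m" for i l
  proof -
    define w where "w j = (if j < l then u j else if j < i - 1 then u (Suc j) else u (Suc (Suc j)))" for j
    define b where "b = B i l"
    have 1: "(omit i u)(l := b) = insert_at l b w"
      using that by (auto simp: omit_def insert_at_def w_def fun_eq_iff)
    have 2: "(omit l u)(i - 1 := b) = insert_at (l + (i - 1 - l)) b w"
      using that by (auto simp: omit_def insert_at_def w_def fun_eq_iff)
    have "t (l, i - 1) = (-1) ^ l * f ((omit l u)(i - 1 := b))"
    proof -
      have "\<not> i - 1 < l" "Suc (i - 1) = i" using that by auto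
      then show ?thesis unfolding t_def b_def prod.case B[of i l] by (simp only: if_False)
    qed
    also have "\<dots> = (-1) ^ l * ((-1) ^ (i - 1 - l) * f ((omit i u)(l := b)))"
      unfolding 1 2 using that by (subst alt_form_insert_at[OF f]) auto
    also have "(-1) ^ l * ((-1) ^ (i - 1 - l) * f ((omit i u)(l := b))) = (-1) ^ (i - 1) * f ((omit i u)(l := b))"
      using that by (simp add: mult.assoc[symmetric] power_add[symmetric])
    also have "\<dots> = - ((-1) ^ i * f ((omit i u)(l := b)))"
      using that by (cases i) auto
    also have "(-1) ^ i * f ((omit i u)(l := b)) = t (i, l)" using that by (simp add: t_def b_def)
    finally show ?thesis .
  qed
  let ?S = "{..m} \<times> {..<m}"
  have \<sigma>S: "\<sigma> x \<in> ?S" if "x \<in> ?S" for x using that by (auto simp: \<sigma>_def)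
  have \<sigma>\<sigma>: "\<sigma> (\<sigma> x) = x" for x by (auto simp: \<sigma>_def split: prod.split)
  have "t (\<sigma> x) = - t x" if x: "x \<in> ?S" for x
  proof -
    obtain i l where [simp]: "x = (i, l)" by fastforce
    show ?thesis
    proof (cases "l < i")
      case True then show ?thesis using key[of l i] x by (simp add: \<sigma>_def)
    next
      case False then show ?thesis using key[of i "Suc l"] x by (simp add: \<sigma>_def)
    qed
  qed
  then have "sum t ?S = (\<Sum>x\<in>?S. - t (\<sigma> x))" by (intro sum.cong) auto
  also have "\<dots> = - (\<Sum>x\<in>?S. t (\<sigma> x))" by (rule sum_negf)
  also have "(\<Sum>x\<in>?S. t (\<sigma> x)) = sum t ?S"
    by (rule sum.reindex_bij_witness[of _ \<sigma> \<sigma>]) (use \<sigma>S \<sigma>\<sigma> in auto)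
  finally have "sum t ?S = 0" by simp
  moreover have "sum t ?S = (\<Sum>i\<le>m. \<Sum>l<m. t (i, l))" by (simp add: sum.cartesian_product)
  ultimately show ?thesis by (simp add: t_def)
qed

text \<open>The product rule, obtained by expanding in coordinates: the coefficients of \<open>a\<close> contribute the
first summand, and each slot, where the derivative of the coordinate change is plugged in,
contributes a second derivative.\<close>

lemma pullback_form_derivative:
  fixes a :: "real^'n::finite \<Rightarrow> (nat \<Rightarrow> real^'n) \<Rightarrow> real"
  assumes W: "open W" "x0 \<in> W" and W': "open W'" "\<phi> x0 \<in> W'" "\<And>x. x \<in> W \<Longrightarrow> \<phi> x \<in> W'"
    and \<phi>: "(\<phi> has_derivative \<phi>' x0) (at x0)"
    and \<phi>2: "\<And>v. ((\<lambda>x. \<phi>' x v) has_derivative \<phi>'' v) (at x0)"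
    and a_lin: "\<And>y. y \<in> W' \<Longrightarrow> multilinear_form m (a y)"
    and a_der: "\<And>w. ((\<lambda>y. a y w) has_derivative a' w) (at (\<phi> x0))"
    and b: "\<And>x w. x \<in> W \<Longrightarrow> b x w = a (\<phi> x) (\<lambda>i. \<phi>' x (w i))"
  shows "((\<lambda>x. b x w) has_derivative
     (\<lambda>h. a' (\<lambda>i. \<phi>' x0 (w i)) (\<phi>' x0 h) + (\<Sum>l<m. a (\<phi> x0) ((\<lambda>i. \<phi>' x0 (w i))(l := \<phi>'' (w l) h))))) (at x0)"
proof -
  let ?P = "{..<m} \<rightarrow>\<^sub>E (UNIV :: 'n set)"
  let ?e = "\<lambda>I l. axis (I l) 1 :: real^'n"
  let ?u = "\<lambda>i. \<phi>' x0 (w i)"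
  have expand: "a y v = (\<Sum>I\<in>?P. a y (?e I) * (\<Prod>l<m. v l $ I l))" if "y \<in> W'" for y v
    using multilinear_form_axis_expand[OF a_lin[OF that], of v] by (simp add: mult.commute)
  have expand_b: "b x w = (\<Sum>I\<in>?P. a (\<phi> x) (?e I) * (\<Prod>l<m. \<phi>' x (w l) $ I l))" if "x \<in> W" for x
    using expand[OF W'(3)[OF that], of "\<lambda>i. \<phi>' x (w i)"] b[OF that] by simp
  have d1: "((\<lambda>x. a (\<phi> x) v) has_derivative (\<lambda>h. a' v (\<phi>' x0 h))) (at x0)" for v
    using has_derivative_compose[where g="\<lambda>y. a y v", OF \<phi> a_der] .
  have d2: "((\<lambda>x. \<phi>' x (w l) $ I) has_derivative (\<lambda>h. \<phi>'' (w l) h $ I)) (at x0)" for l I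
    by (rule bounded_linear.has_derivative[OF bounded_linear_vec_nth \<phi>2])
  let ?D = "\<lambda>h. \<Sum>I\<in>?P. a (\<phi> x0) (?e I) * (\<Sum>l<m. \<phi>'' (w l) h $ I l * (\<Prod>j\<in>{..<m} - {l}. \<phi>' x0 (w j) $ I j))
      + a' (?e I) (\<phi>' x0 h) * (\<Prod>l<m. \<phi>' x0 (w l) $ I l)"
  have "((\<lambda>x. \<Sum>I\<in>?P. a (\<phi> x) (?e I) * (\<Prod>l<m. \<phi>' x (w l) $ I l)) has_derivative ?D) (at x0)"
    by (intro has_derivative_sum has_derivative_mult d1 has_derivative_prod d2)
  then have D: "((\<lambda>x. b x w) has_derivative ?D) (at x0)"
    by (rule has_derivative_transform_within_open[OF _ W]) (simp add: expand_b)
  have A: "a (\<phi> x0) (?u(l := z)) = (\<Sum>I\<in>?P. a (\<phi> x0) (?e I) * (z $ I l * (\<Prod>j\<in>{..<m} - {l}. ?u j $ I j)))"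
    if "l < m" for l z
  proof -
    have "(\<Prod>j<m. (?u(l := z)) j $ I j) = z $ I l * (\<Prod>j\<in>{..<m} - {l}. ?u j $ I j)" for I
      using that by (subst prod.remove[of "{..<m}" l]) auto
    then show ?thesis using expand[OF W'(2), of "?u(l := z)"] by simp
  qed
  have B: "a' ?u k = (\<Sum>I\<in>?P. a' (?e I) k * (\<Prod>l<m. ?u l $ I l))" for k
  proof -
    have "((\<lambda>y. \<Sum>I\<in>?P. a y (?e I) * (\<Prod>l<m. ?u l $ I l)) has_derivative
        (\<lambda>k. \<Sum>I\<in>?P. a' (?e I) k * (\<Prod>l<m. ?u l $ I l))) (at (\<phi> x0))"
      by (intro has_derivative_sum has_derivative_mult_left a_der)
    then have "((\<lambda>y. a y ?u) has_derivative (\<lambda>k. \<Sum>I\<in>?P. a' (?e I) k * (\<Prod>l<m. ?u l $ I l))) (at (\<phi> x0))"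
      by (rule has_derivative_transform_within_open[OF _ W'(1,2)]) (simp add: expand)
    from has_derivative_unique[OF a_der this] show ?thesis by (rule fun_cong)
  qed
  have "?D h = a' ?u (\<phi>' x0 h) + (\<Sum>l<m. a (\<phi> x0) (?u(l := \<phi>'' (w l) h)))" for h
  proof -
    have "?D h = (\<Sum>I\<in>?P. \<Sum>l<m. a (\<phi> x0) (?e I) * (\<phi>'' (w l) h $ I l * (\<Prod>j\<in>{..<m} - {l}. ?u j $ I j))) + a' ?u (\<phi>' x0 h)"
      unfolding B sum.distrib sum_distrib_left ..
    also have "(\<Sum>I\<in>?P. \<Sum>l<m. a (\<phi> x0) (?e I) * (\<phi>'' (w l) h $ I l * (\<Prod>j\<in>{..<m} - {l}. ?u j $ I j)))
       = (\<Sum>l<m. \<Sum>I\<in>?P. a (\<phi> x0) (?e I) * (\<phi>'' (w l) h $ I l * (\<Prod>j\<in>{..<m} - {l}. ?u j $ I j)))"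
      by (rule sum.swap)
    also have "\<dots> = (\<Sum>l<m. a (\<phi> x0) (?u(l := \<phi>'' (w l) h)))"
      by (intro sum.cong refl) (simp only: A lessThan_iff)
    finally show ?thesis by simp
  qed
  then have "?D = (\<lambda>h. a' ?u (\<phi>' x0 h) + (\<Sum>l<m. a (\<phi> x0) (?u(l := \<phi>'' (w l) h))))" by (rule ext)
  with D show ?thesis by simp
qed

text \<open>The exterior differential commutes with pullbacks: after alternation, the terms with second
derivatives of the coordinate change cancel because these derivatives are symmetric.\<close>

lemma pullback_exterior_derivative:
  fixes a :: "real^'n::finite \<Rightarrow> (nat \<Rightarrow> real^'n) \<Rightarrow> real"
  assumes W: "open W" "x0 \<in> W" and W': "open W'" "\<phi> x0 \<in> W'" "\<And>x. x \<in> W \<Longrightarrow> \<phi> x \<in> W'"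
    and \<phi>: "(\<phi> has_derivative \<phi>' x0) (at x0)"
    and \<phi>2: "\<And>v. ((\<lambda>x. \<phi>' x v) has_derivative \<phi>'' v) (at x0)"
    and sym: "\<And>v w. \<phi>'' v w = \<phi>'' w v"
    and a_alt: "\<And>y. y \<in> W' \<Longrightarrow> alt_form m (a y)"
    and a_der: "\<And>w. ((\<lambda>y. a y w) has_derivative a' w) (at (\<phi> x0))"
    and b: "\<And>x w. x \<in> W \<Longrightarrow> b x w = a (\<phi> x) (\<lambda>i. \<phi>' x (w i))"
  shows "(\<Sum>i\<le>m. (-1) ^ i * frechet_derivative (\<lambda>x. b x (omit i v)) (at x0) (v i)) =
    (\<Sum>i\<le>m. (-1) ^ i * frechet_derivative (\<lambda>y. a y (omit i (\<lambda>j. \<phi>' x0 (v j)))) (at (\<phi> x0)) (\<phi>' x0 (v i)))"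
proof -
  let ?u = "\<lambda>j. \<phi>' x0 (v j)"
  have om: "(\<lambda>j. \<phi>' x0 (omit i v j)) = omit i ?u" for i by (auto simp: omit_def)
  have "frechet_derivative (\<lambda>x. b x (omit i v)) (at x0) (v i) =
     frechet_derivative (\<lambda>y. a y (omit i ?u)) (at (\<phi> x0)) (\<phi>' x0 (v i))
     + (\<Sum>l<m. a (\<phi> x0) ((omit i ?u)(l := \<phi>'' (v (if l < i then l else Suc l)) (v i))))" for i
  proof -
    have "((\<lambda>x. b x (omit i v)) has_derivative
     (\<lambda>h. a' (\<lambda>j. \<phi>' x0 (omit i v j)) (\<phi>' x0 h)
        + (\<Sum>l<m. a (\<phi> x0) ((\<lambda>j. \<phi>' x0 (omit i v j))(l := \<phi>'' (omit i v l) h))))) (at x0)"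
      using W W' \<phi> \<phi>2 alt_form_multilinear[OF a_alt] a_der b by (rule pullback_form_derivative)
    from frechet_derivative_at[OF this, symmetric] frechet_derivative_at[OF a_der, symmetric]
    show ?thesis unfolding om by (simp add: omit_def[of i v] if_distrib[of v] cong: if_cong)
  qed
  then have "(\<Sum>i\<le>m. (-1) ^ i * frechet_derivative (\<lambda>x. b x (omit i v)) (at x0) (v i)) =
    (\<Sum>i\<le>m. (-1) ^ i * frechet_derivative (\<lambda>y. a y (omit i ?u)) (at (\<phi> x0)) (\<phi>' x0 (v i))) +
    (\<Sum>i\<le>m. \<Sum>l<m. (-1) ^ i * a (\<phi> x0) ((omit i ?u)(l := \<phi>'' (v (if l < i then l else Suc l)) (v i))))"
    by (simp only: distrib_left sum.distrib sum_distrib_left)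
  also have "(\<Sum>i\<le>m. \<Sum>l<m. (-1) ^ i * a (\<phi> x0) ((omit i ?u)(l := \<phi>'' (v (if l < i then l else Suc l)) (v i)))) = 0"
    using alternating_omit_cancel[OF a_alt[OF W'(2)], of "\<lambda>i j. \<phi>'' (v j) (v i)" ?u] sym by simp
  finally show ?thesis by simp
qed

section \<open>Charts and the volume measure\<close>

text \<open>The transformation formula for Henstock-Kurzweil integrals yields the one for nonnegative integrals
because, for nonnegative functions, a finite integral is the same in both senses, and infinite
values are matched by exclusion.\<close>

lemma nn_integral_change_of_variables:
  fixes \<phi> :: "real^'n::{finite,wellorder} \<Rightarrow> real^'n::_"
  assumes S: "S \<in> sets borel" and T: "\<phi> ` S \<in> sets borel"
    and der: "\<And>x. x \<in> S \<Longrightarrow> (\<phi> has_derivative \<phi>' x) (at x within S)" and inj: "inj_on \<phi> S"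
    and f: "(\<lambda>y. indicator (\<phi> ` S) y * f y) \<in> borel_measurable borel" "\<And>y. y \<in> \<phi> ` S \<Longrightarrow> 0 \<le> f y"
    and g: "(\<lambda>x. indicator S x * g x) \<in> borel_measurable borel"
    and gf: "\<And>x. x \<in> S \<Longrightarrow> g x = \<bar>det (matrix (\<phi>' x))\<bar> * f (\<phi> x)"
  shows "(\<integral>\<^sup>+x\<in>S. ennreal (g x) \<partial>lborel) = (\<integral>\<^sup>+y\<in>\<phi> ` S. ennreal (f y) \<partial>lborel)"
proof -
  have g0: "0 \<le> g x" if "x \<in> S" for x using gf[OF that] f(2)[of "\<phi> x"] that by simp
  \<comment> \<open>The transformation formula asks for vector values, hence the detour through \<open>real^1\<close>.\<close>
  have change: "(f has_integral r) (\<phi> ` S) \<longleftrightarrow> (g has_integral r) S" for r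
  proof -
    have "S \<in> sets lebesgue" using S by simp
    note * = has_absolute_integral_change_of_variables[OF this der inj, of "\<lambda>y. vec (f y) :: real^1" "vec r"]
    have "(\<lambda>x. \<bar>det (matrix (\<phi>' x))\<bar> *\<^sub>R vec (f (\<phi> x)) :: real^1) absolutely_integrable_on S \<longleftrightarrow> g absolutely_integrable_on S"
      unfolding absolutely_integrable_on_1_iff
      using gf by (intro set_integrable_cong) auto
    moreover have "integral S (\<lambda>x. \<bar>det (matrix (\<phi>' x))\<bar> *\<^sub>R vec (f (\<phi> x)) :: real^1) = vec (integral S g)"
      unfolding integral_on_1_eq
      using gf by (intro arg_cong[of _ _ vec] integral_cong) auto
    moreover have "f absolutely_integrable_on T \<longleftrightarrow> (\<lambda>y. vec (f y) :: real^1) absolutely_integrable_on T"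
        "integral T (\<lambda>y. vec (f y) :: real^1) = vec (integral T f)" for T
      unfolding absolutely_integrable_on_1_iff integral_on_1_eq by auto
    ultimately have "(g absolutely_integrable_on S \<and> integral S g = r) \<longleftrightarrow>
        (f absolutely_integrable_on (\<phi> ` S) \<and> integral (\<phi> ` S) f = r)"
      using * by (simp add: vec_eq_iff)
    moreover have "(h has_integral r) A \<longleftrightarrow> h absolutely_integrable_on A \<and> integral A h = r"
      if "\<And>x. x \<in> A \<Longrightarrow> 0 \<le> h x" for h :: "real^'n::_ \<Rightarrow> real" and A
      using nonnegative_absolutely_integrable_1[OF _ that] set_lebesgue_integral_eq_integral(1)
      by (auto simp: has_integral_iff)
    ultimately show ?thesis using g0 f(2) by simp
  qed
  have fin: "(h has_integral r) A" if "(\<integral>\<^sup>+x\<in>A. ennreal (h x) \<partial>lborel) = ennreal r" "r \<ge> 0"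
    "(\<lambda>x. indicator A x * h x) \<in> borel_measurable borel" "\<And>x. x \<in> A \<Longrightarrow> 0 \<le> h x"
    for h :: "real^'n::_ \<Rightarrow> real" and A r
  proof -
    have "(\<integral>\<^sup>+x. ennreal (indicator A x * h x) \<partial>lborel) = ennreal r"
      using that(1) by (simp add: nn_integral_set_ennreal mult.commute)
    from nn_integral_has_integral[OF that(3) _ this that(2)] that(4)
    have "((\<lambda>x. indicator A x * h x) has_integral r) UNIV" by (auto simp: indicator_def)
    moreover have "(\<lambda>x. indicator A x * h x) = (\<lambda>x. if x \<in> A then h x else 0)"
      by (auto simp: indicator_def)
    ultimately show ?thesis by (simp add: has_integral_restrict_UNIV)
  qed
  have fin': "(\<integral>\<^sup>+x\<in>A. ennreal (h x) \<partial>lborel) = ennreal r" if "(h has_integral r) A" "\<And>x. x \<in> A \<Longrightarrow> 0 \<le> h x"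
    for h :: "real^'n::_ \<Rightarrow> real" and A r
    using nn_integral_has_integral_lebesgue[OF that(2,1)] by (simp add: nn_integral_set_ennreal mult.commute)
  show ?thesis
  proof (cases "\<integral>\<^sup>+x\<in>S. ennreal (g x) \<partial>lborel" rule: ennreal_cases)
    case (real r)
    from fin[OF real(2,1) g g0] have "(f has_integral r) (\<phi> ` S)" by (simp add: change)
    from fin'[OF this f(2)] real show ?thesis by simp
  next
    case top
    show ?thesis
    proof (cases "\<integral>\<^sup>+y\<in>\<phi> ` S. ennreal (f y) \<partial>lborel" rule: ennreal_cases)
      case (real r)
      from fin[OF real(2,1) f] have "(g has_integral r) S" by (simp add: change)
      from fin'[OF this g0] top show ?thesis by simp
    qed (use top in simp)
  qed
qed

lemma ennreal_suminf_swap: "(\<Sum>i. \<Sum>j. f i j) = (\<Sum>j. \<Sum>i. f i j :: ennreal)"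
  using nn_integral_suminf[of "\<lambda>i j. f i j" "count_space (UNIV :: nat set)"]
  by (simp add: nn_integral_count_space_nat)

text \<open>Local extensions are the only access to derivatives at points of a boundary chart; the radius \<open>d\<close>
is what the transfer lemmas for limits and derivatives ask for.\<close>

lemma smooth_map_on_extension:
  assumes f: "smooth_map_on S f" and x: "x \<in> S"
  obtains V h d where "open V" "x \<in> V" "\<And>r. Ck_on r V h" "\<And>y. y \<in> S \<inter> V \<Longrightarrow> h y = f y"
    "d > 0" "\<And>y. y \<in> S \<Longrightarrow> dist y x < d \<Longrightarrow> h y = f y"
proof -
  obtain V h where V: "open V" "x \<in> V" "\<forall>r. Ck_on r V h" "\<forall>y\<in>S \<inter> V. h y = f y"
    using bspec[OF f[unfolded smooth_map_on_def] x] by (elim exE conjE) (rule that)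
  obtain d where "d > 0" "ball x d \<subseteq> V" using V(1,2) openE by blast
  moreover have "h y = f y" if "y \<in> S" "dist y x < d" for y
    using V(4) that \<open>ball x d \<subseteq> V\<close> by (force simp: dist_commute)
  ultimately show ?thesis using V by (intro that[of V h d]) (simp_all del: Ck_on.simps)
qed

lemma smooth_map_on_continuous:
  assumes "smooth_map_on S f" shows "continuous_on S f"
  unfolding continuous_on_eq_continuous_within
proof
  fix x assume x: "x \<in> S"
  obtain V h d where V: "open V" "x \<in> V" "\<And>r. Ck_on r V h" "\<And>y. y \<in> S \<inter> V \<Longrightarrow> h y = f y"
    "d > 0" "\<And>y. y \<in> S \<Longrightarrow> dist y x < d \<Longrightarrow> h y = f y"
    using smooth_map_on_extension[OF assms x] by metis
  have "continuous_on V h" using V(3)[of 0] by simp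
  then have "continuous (at x within S) h"
    using V(1,2) by (simp add: continuous_on_eq_continuous_at continuous_at_imp_continuous_at_within)
  then show "continuous (at x within S) f"
    by (rule continuous_transform_within[OF _ V(5) x V(6)])
qed

lemma smooth_map_on_differentiable_within:
  assumes "smooth_map_on S f" and x: "x \<in> S"
  shows "f differentiable (at x within S)"
proof -
  obtain V h d where V: "open V" "x \<in> V" "\<And>r. Ck_on r V h" "\<And>y. y \<in> S \<inter> V \<Longrightarrow> h y = f y"
    "d > 0" "\<And>y. y \<in> S \<Longrightarrow> dist y x < d \<Longrightarrow> h y = f y"
    using smooth_map_on_extension[OF assms] by metis
  obtain h' where "(h has_derivative h' x) (at x)" using V(2) V(3)[of 1] by auto
  then have "(h has_derivative h' x) (at x within S)" by (rule has_derivative_at_withinI)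
  then have "(f has_derivative h' x) (at x within S)"
    by (rule has_derivative_transform_within[where d=d]) (use V x in auto)
  then show ?thesis by (auto simp: differentiable_def)
qed

lemma continuous_on_det [continuous_intros]:
  fixes A :: "'a::topological_space \<Rightarrow> real^'n::finite^'n"
  shows "continuous_on S A \<Longrightarrow> continuous_on S (\<lambda>x. det (A x))"
  unfolding det_def by (intro continuous_intros) auto

locale riem_manifold =
  fixes M :: "('a, 'n::{finite,wellorder}) riem"
  assumes riemannian: "riemannian_manifold M"
begin

abbreviation T where "T \<equiv> top_of M"

lemma hausdorff: "Hausdorff_space T" and second_countable_T: "second_countable T"
  using riemannian by (auto simp: riemannian_manifold_def)

lemma atlas_cover: "(\<Union>c\<in>atlas M. cdom c) = topspace T"
  using riemannian by (auto simp: riemannian_manifold_def)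

lemma chart: "c \<in> atlas M \<Longrightarrow> is_chart T c"
  using riemannian by (auto simp: riemannian_manifold_def)

lemma smooth_transition:
  "c \<in> atlas M \<Longrightarrow> d \<in> atlas M \<Longrightarrow> smooth_map_on (cmap c ` (cdom c \<inter> cdom d)) (cmap d \<circ> cinv c)"
  by (rule riemannian[unfolded riemannian_manifold_def, THEN conjunct2, THEN conjunct2, THEN conjunct2,
        THEN conjunct2, THEN conjunct1, rule_format])

lemma smooth_metric: "c \<in> atlas M \<Longrightarrow> smooth_map_on (cimg c) (\<lambda>x. metric M c (cinv c x))"
  by (rule riemannian[unfolded riemannian_manifold_def, THEN conjunct2, THEN conjunct2, THEN conjunct2,
        THEN conjunct2, THEN conjunct2, THEN conjunct1, rule_format])

lemma metric_posdef: "c \<in> atlas M \<Longrightarrow> p \<in> cdom c \<Longrightarrow> posdef (metric M c p)"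
  unfolding posdef_def
  by (rule riemannian[unfolded riemannian_manifold_def, THEN conjunct2, THEN conjunct2, THEN conjunct2,
        THEN conjunct2, THEN conjunct2, THEN conjunct2, THEN conjunct1, THEN bspec, THEN bspec])

lemma metric_change: "c \<in> atlas M \<Longrightarrow> d \<in> atlas M \<Longrightarrow> p \<in> cdom c \<inter> cdom d \<Longrightarrow>
    metric M c p = transpose (jac c d p) ** metric M d p ** jac c d p"
  by (rule riemannian[unfolded riemannian_manifold_def, THEN conjunct2, THEN conjunct2, THEN conjunct2,
        THEN conjunct2, THEN conjunct2, THEN conjunct2, THEN conjunct2, THEN bspec, THEN bspec, THEN bspec])

lemma cdom_open: "c \<in> atlas M \<Longrightarrow> openin T (cdom c)"
  using chart by (auto simp: is_chart_def)

lemma cdom_sub: "c \<in> atlas M \<Longrightarrow> cdom c \<subseteq> topspace T"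
  using cdom_open openin_subset by blast

lemma cmap_homeo:
  assumes "c \<in> atlas M"
  shows "continuous_map (subtopology T (cdom c)) (top_of_set (cimg c)) (cmap c)"
    "open_map (subtopology T (cdom c)) (top_of_set (cimg c)) (cmap c)"
    "inj_on (cmap c) (cdom c)"
  using chart[OF assms] cdom_sub[OF assms]
  by (auto simp: is_chart_def homeomorphic_eq_everything_map Int_absorb1)

lemma cinv_cmap [simp]: "c \<in> atlas M \<Longrightarrow> p \<in> cdom c \<Longrightarrow> cinv c (cmap c p) = p"
  using cmap_homeo(3) by (simp add: cinv_def)

lemma cmap_cimg [simp]: "p \<in> cdom c \<Longrightarrow> cmap c p \<in> cimg c"
  by (simp add: cimg_def)

lemma cmap_cinv [simp]: "x \<in> cimg c \<Longrightarrow> cmap c (cinv c x) = x"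
  by (simp add: cinv_def cimg_def f_inv_into_f)

lemma cinv_cdom [simp]: "x \<in> cimg c \<Longrightarrow> cinv c x \<in> cdom c"
  by (simp add: cinv_def cimg_def inv_into_into)

lemma chart_at: "p \<in> topspace T \<Longrightarrow> chart_at M p \<in> atlas M \<and> p \<in> cdom (chart_at M p)"
proof -
  assume "p \<in> topspace T"
  then have "\<exists>c. c \<in> atlas M \<and> p \<in> cdom c" using atlas_cover by blast
  then show ?thesis unfolding chart_at_def by (rule someI_ex)
qed

lemma image_openin:
  assumes c: "c \<in> atlas M" and U: "openin T U"
  shows "openin (top_of_set (cimg c)) (cmap c ` (cdom c \<inter> U))"
proof -
  have "openin (subtopology T (cdom c)) (cdom c \<inter> U)"
    using U by (auto simp: openin_subtopology)
  then show ?thesis using cmap_homeo(2)[OF c] by (auto simp: open_map_def)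
qed

text \<open>Images under a chart are preimages under its inverse, which is how their measurability is obtained.\<close>

lemma image_eq_preimage: "c \<in> atlas M \<Longrightarrow> cmap c ` (cdom c \<inter> B) = {x \<in> cimg c. cinv c x \<in> B}"
proof (intro subset_antisym subsetI)
  assume c: "c \<in> atlas M"
  show "x \<in> {x \<in> cimg c. cinv c x \<in> B}" if "x \<in> cmap c ` (cdom c \<inter> B)" for x
    using that c by auto
  show "x \<in> cmap c ` (cdom c \<inter> B)" if "x \<in> {x \<in> cimg c. cinv c x \<in> B}" for x
    using that imageI[of "cinv c x" "cdom c \<inter> B" "cmap c"] by simp
qed

lemma cimg_borel [measurable]: "c \<in> atlas M \<Longrightarrow> cimg c \<in> sets borel"
proof -
  assume c: "c \<in> atlas M"
  have "closed (halfspace :: (real^'n::_) set)"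
    unfolding halfspace_def by (intro closed_Collect_le continuous_intros)
  moreover have "open (cimg c) \<or> openin (top_of_set halfspace) (cimg c)"
    using chart[OF c] by (simp add: is_chart_def)
  ultimately show ?thesis by (auto simp: openin_open)
qed

definition borel_T :: "'a measure" where
  "borel_T = sigma (topspace T) {U. openin T U}"

lemma opens_Pow: "{U. openin T U} \<subseteq> Pow (topspace T)"
  using openin_subset by auto

lemma space_borel_T [simp]: "space borel_T = topspace T"
  and sets_borel_T: "sets borel_T = sigma_sets (topspace T) {U. openin T U}"
  using opens_Pow by (auto simp: borel_T_def)

lemma open_borel_T: "openin T U \<Longrightarrow> U \<in> sets borel_T"
  by (auto simp: sets_borel_T)

lemma cinv_measurable:
  assumes c: "c \<in> atlas M"
  shows "cinv c \<in> measurable (restrict_space borel (cimg c)) borel_T"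
  unfolding borel_T_def
proof (rule measurable_measure_of[OF opens_Pow])
  show "cinv c \<in> space (restrict_space borel (cimg c)) \<rightarrow> topspace T"
    using cdom_sub[OF c] by (auto simp: space_restrict_space)
  fix U assume "U \<in> {U. openin T U}"
  then have "openin (top_of_set (cimg c)) (cmap c ` (cdom c \<inter> U))" using image_openin[OF c] by auto
  then obtain V where "open V" "cmap c ` (cdom c \<inter> U) = cimg c \<inter> V" by (auto simp: openin_open)
  moreover have "cinv c -` U \<inter> space (restrict_space borel (cimg c)) = cmap c ` (cdom c \<inter> U)"
    using image_eq_preimage[OF c, of U] by (auto simp: space_restrict_space)
  ultimately show "cinv c -` U \<inter> space (restrict_space borel (cimg c)) \<in> sets (restrict_space borel (cimg c))"
    using cimg_borel[OF c] by (simp add: sets_restrict_space_iff)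
qed

lemma image_borel:
  assumes c: "c \<in> atlas M" and B: "B \<in> sets borel_T" "B \<subseteq> cdom c"
  shows "cmap c ` B \<in> sets borel"
proof -
  have "cinv c -` B \<inter> space (restrict_space borel (cimg c)) \<in> sets (restrict_space borel (cimg c))"
    using measurable_sets[OF cinv_measurable[OF c] B(1)] .
  moreover have "cinv c -` B \<inter> space (restrict_space borel (cimg c)) = cmap c ` B"
    using image_eq_preimage[OF c, of B] B(2) by (auto simp: space_restrict_space Int_absorb1)
  ultimately show ?thesis using cimg_borel[OF c] by (simp add: sets_restrict_space_iff)
qed

definition density_in :: "('a, 'n) chart \<Rightarrow> real^'n::_ \<Rightarrow> real" where
  "density_in c x = sqrt (det (metric M c (cinv c x)))"

lemma density_continuous: "c \<in> atlas M \<Longrightarrow> continuous_on (cimg c) (density_in c)"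
  unfolding density_in_def
  by (intro continuous_intros smooth_map_on_continuous smooth_metric)

lemma density_measurable:
  assumes "c \<in> atlas M" "S \<in> sets borel" "S \<subseteq> cimg c"
  shows "(\<lambda>x. indicator S x * density_in c x) \<in> borel_measurable borel"
  using borel_measurable_continuous_on_indicator[OF assms(2) continuous_on_subset[OF density_continuous[OF assms(1)] assms(3)]]
  by simp

lemma density_pos: "c \<in> atlas M \<Longrightarrow> x \<in> cimg c \<Longrightarrow> 0 < density_in c x"
  unfolding density_in_def using posdef_det_pos[OF metric_posdef] by simp

definition chart_volume :: "('a, 'n) chart \<Rightarrow> 'a measure" where
  "chart_volume c = distr (density (restrict_space lborel (cimg c)) (\<lambda>x. ennreal (density_in c x))) borel_T (cinv c)"

lemma chart_volume:
  assumes c: "c \<in> atlas M"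
  shows "sets (chart_volume c) = sets borel_T"
    and "B \<in> sets borel_T \<Longrightarrow> B \<subseteq> cdom c \<Longrightarrow>
      emeasure (chart_volume c) B = (\<integral>\<^sup>+x\<in>cmap c ` B. ennreal (density_in c x) \<partial>lborel)"
proof -
  show "sets (chart_volume c) = sets borel_T" by (simp add: chart_volume_def)
  assume B: "B \<in> sets borel_T" "B \<subseteq> cdom c"
  let ?R = "restrict_space lborel (cimg c)"
  let ?D = "density ?R (\<lambda>x. ennreal (density_in c x))"
  have R: "measurable ?R = measurable (restrict_space borel (cimg c))"
    by (intro ext measurable_cong_sets sets_restrict_space_cong) auto
  have sR: "space ?R = cimg c" by (simp add: space_restrict_space)
  have "density_in c \<in> borel_measurable (restrict_space borel (cimg c))"
    by (rule borel_measurable_continuous_on_restrict) (rule density_continuous[OF c])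
  then have dm: "(\<lambda>x. ennreal (density_in c x)) \<in> borel_measurable ?R" by (simp add: R)
  have m: "cinv c \<in> measurable ?D borel_T"
  proof -
    have "measurable ?D borel_T = measurable ?R borel_T" by (rule measurable_cong_sets) simp_all
    then show ?thesis using cinv_measurable[OF c] R by simp
  qed
  have pre: "cinv c -` B \<inter> space ?D = cmap c ` B"
    using image_eq_preimage[OF c, of B] B(2) sR by (auto simp: Int_absorb1)
  have im: "cmap c ` B \<in> sets borel" "cmap c ` B \<subseteq> cimg c"
    using image_borel[OF c B] B(2) by (auto simp: cimg_def)
  have imR: "cmap c ` B \<in> sets ?R" using im cimg_borel[OF c] by (simp add: sets_restrict_space_iff)
  have "emeasure (chart_volume c) B = emeasure ?D (cmap c ` B)"
    unfolding chart_volume_def by (subst emeasure_distr[OF m B(1)]) (simp only: pre)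
  also have "\<dots> = (\<integral>\<^sup>+x. ennreal (density_in c x) * indicator (cmap c ` B) x \<partial>?R)"
    by (rule emeasure_density[OF dm imR])
  also have "\<dots> = (\<integral>\<^sup>+x. ennreal (density_in c x) * indicator (cmap c ` B) x * indicator (cimg c) x \<partial>lborel)"
    using cimg_borel[OF c] by (subst nn_integral_restrict_space) auto
  also have "\<dots> = (\<integral>\<^sup>+x\<in>cmap c ` B. ennreal (density_in c x) \<partial>lborel)"
    using im(2) by (intro nn_integral_cong) (auto simp: indicator_def)
  finally show "emeasure (chart_volume c) B = (\<integral>\<^sup>+x\<in>cmap c ` B. ennreal (density_in c x) \<partial>lborel)" .
qed

text \<open>\<open>frechet_derivative\<close> selects some derivative within the domain, and \<open>jac\<close> is its matrix.\<close>

lemma transition_derivative: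
  assumes c: "c \<in> atlas M" and d: "d \<in> atlas M" and p: "p \<in> cdom c \<inter> cdom d"
  shows "((cmap d \<circ> cinv c) has_derivative (\<lambda>h. jac c d p *v h)) (at (cmap c p) within cmap c ` (cdom c \<inter> cdom d))"
proof -
  have "(cmap d \<circ> cinv c) differentiable (at (cmap c p) within cmap c ` (cdom c \<inter> cdom d))"
    using p by (intro smooth_map_on_differentiable_within smooth_transition c d) auto
  then have 1: "((cmap d \<circ> cinv c) has_derivative frechet_derivative (cmap d \<circ> cinv c)
      (at (cmap c p) within cmap c ` (cdom c \<inter> cdom d))) (at (cmap c p) within cmap c ` (cdom c \<inter> cdom d))"
    by (simp add: frechet_derivative_works)
  then have "linear (frechet_derivative (cmap d \<circ> cinv c) (at (cmap c p) within cmap c ` (cdom c \<inter> cdom d)))"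
    by (rule has_derivative_linear)
  then have "frechet_derivative (cmap d \<circ> cinv c) (at (cmap c p) within cmap c ` (cdom c \<inter> cdom d)) = (\<lambda>h. jac c d p *v h)"
    by (simp add: jac_def matrix_works fun_eq_iff)
  with 1 show ?thesis by simp
qed

lemma density_change:
  assumes c: "c \<in> atlas M" and d: "d \<in> atlas M" and p: "p \<in> cdom c \<inter> cdom d"
  shows "sqrt (det (metric M c p)) = \<bar>det (jac c d p)\<bar> * sqrt (det (metric M d p))"
  by (subst metric_change[OF c d p]) (simp add: det_mul real_sqrt_mult)

text \<open>The transformation formula: the density changes by the modulus of the Jacobian determinant, since the
Gram matrix of \<open>c\<close> is \<open>transpose J ** G ** J\<close> for that of \<open>d\<close>.\<close>

lemma chart_volume_agree:
  assumes c: "c \<in> atlas M" and d: "d \<in> atlas M" and B: "B \<in> sets borel_T" "B \<subseteq> cdom c" "B \<subseteq> cdom d"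
  shows "emeasure (chart_volume c) B = emeasure (chart_volume d) B"
proof -
  let ?\<phi> = "cmap d \<circ> cinv c" and ?S = "cmap c ` B"
  have im: "?\<phi> ` ?S = cmap d ` B" using B c by (auto simp: image_image intro!: image_cong)
  have "(\<integral>\<^sup>+x\<in>?S. ennreal (density_in c x) \<partial>lborel) = (\<integral>\<^sup>+x\<in>?\<phi> ` ?S. ennreal (density_in d x) \<partial>lborel)"
  proof (rule nn_integral_change_of_variables[where \<phi>' = "\<lambda>x h. jac c d (cinv c x) *v h"])
    show S: "?S \<in> sets borel" "?\<phi> ` ?S \<in> sets borel"
      unfolding im using image_borel c d B by auto
    have pre: "\<exists>p. p \<in> cdom c \<inter> cdom d \<and> x = cmap c p" if "x \<in> ?S" for x
      using that B by blast
    show "(?\<phi> has_derivative (\<lambda>h. jac c d (cinv c x) *v h)) (at x within ?S)" if x: "x \<in> ?S" for x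
    proof (rule has_derivative_subset)
      obtain p where p: "p \<in> cdom c \<inter> cdom d" "x = cmap c p" using pre[OF x] by blast
      show "(?\<phi> has_derivative (\<lambda>h. jac c d (cinv c x) *v h)) (at x within cmap c ` (cdom c \<inter> cdom d))"
        using transition_derivative[OF c d p(1)] p c by simp
    qed (use B in blast)
    show "inj_on ?\<phi> ?S"
    proof (rule inj_onI)
      fix x y assume "x \<in> ?S" "y \<in> ?S" and eq: "?\<phi> x = ?\<phi> y"
      then obtain p q where "p \<in> cdom c \<inter> cdom d" "x = cmap c p" "q \<in> cdom c \<inter> cdom d" "y = cmap c q"
        using pre by meson
      then show "x = y" using eq c inj_onD[OF cmap_homeo(3)[OF d], of p q] by simp
    qed
    show "(\<lambda>y. indicator (?\<phi> ` ?S) y * density_in d y) \<in> borel_measurable borel"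
      using S(2) B(3) d unfolding im by (intro density_measurable) (auto simp: cimg_def)
    show "(\<lambda>y. indicator ?S y * density_in c y) \<in> borel_measurable borel"
      using S(1) B(2) c by (intro density_measurable) (auto simp: cimg_def)
    show "0 \<le> density_in d y" if "y \<in> ?\<phi> ` ?S" for y
      using that B d unfolding im by (auto intro!: less_imp_le density_pos)
    show "density_in c x = \<bar>det (matrix ((*v) (jac c d (cinv c x))))\<bar> * density_in d (?\<phi> x)" if x: "x \<in> ?S" for x
    proof -
      obtain p where p: "p \<in> cdom c \<inter> cdom d" "x = cmap c p" using pre[OF x] by blast
      show ?thesis
        using density_change[OF c d p(1)] p c d by (simp add: density_in_def matrix_of_matrix_vector_mul)
    qed
  qed
  then show ?thesis using chart_volume(2) c d B unfolding im by simp
qed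

lemma countable_atlas:
  obtains C where "countable C" "C \<subseteq> atlas M" "(\<Union>c\<in>C. cdom c) = topspace T"
proof -
  have "\<exists>\<V>. countable \<V> \<and> \<V> \<subseteq> cdom ` atlas M \<and> \<Union>\<V> = topspace T"
  proof (rule Lindelof_spaceD[OF second_countable_imp_Lindelof_space[OF second_countable_T]])
    show "openin T U" if "U \<in> cdom ` atlas M" for U using that by (elim imageE) (simp only: cdom_open)
    show "\<Union>(cdom ` atlas M) = topspace T" by (rule atlas_cover)
  qed
  then obtain \<V> where \<V>: "countable \<V>" "\<V> \<subseteq> cdom ` atlas M" "\<Union>\<V> = topspace T" by (elim exE conjE)
  then obtain C where "C \<subseteq> atlas M" "countable C" "\<V> = cdom ` C"
    by (metis countable_subset_image)
  with \<V>(3) show ?thesis using that by auto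
qed

text \<open>Countably many charts cover the manifold. Cutting it into disjoint pieces, each contained in one of
these charts, and adding up the chart measures on the pieces gives a measure that has the right
density in every other chart because the chart measures agree on overlaps.\<close>

lemma volume_exists: "\<exists>m. is_volume M m"
proof (cases "topspace T = {}")
  case True
  have "B = {}" if "B \<in> sets borel_T" for B using sets.sets_into_space[OF that] True by simp
  then have "is_volume M (null_measure borel_T)"
    unfolding is_volume_def sets_borel_T[symmetric]
  proof (intro conjI ballI impI)
    fix c B assume "B \<in> sets (null_measure borel_T)"
    then have "B = {}" using \<open>\<And>B. B \<in> sets borel_T \<Longrightarrow> B = {}\<close> by simp
    then show "emeasure (null_measure borel_T) B = (\<integral>\<^sup>+x\<in>cmap c ` B. ennreal (sqrt (det (metric M c (cinv c x)))) \<partial>lborel)"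
      by simp
  qed simp_all
  then show ?thesis ..
next
  case False
  obtain C where C: "countable C" "C \<subseteq> atlas M" "(\<Union>c\<in>C. cdom c) = topspace T" by (rule countable_atlas)
  have "C \<noteq> {}"
  proof
    assume "C = {}"
    then have "topspace T = {}" using C(3) by (simp only: UN_empty)
    with False show False by contradiction
  qed
  define ch where "ch = from_nat_into C"
  have ch: "ch i \<in> atlas M" for i using subsetD[OF C(2) from_nat_into[OF \<open>C \<noteq> {}\<close>, of i]] unfolding ch_def .
  have ch_cover: "(\<Union>i. cdom (ch i)) = topspace T"
  proof -
    have "(\<Union>i. cdom (ch i)) = (\<Union>c\<in>range (from_nat_into C). cdom c)" unfolding ch_def by blast
    then show ?thesis unfolding range_from_nat_into[OF \<open>C \<noteq> {}\<close> C(1)] C(3) .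
  qed
  \<comment> \<open>The disjoint pieces, each contained in the chart of the same number.\<close>
  define D where "D = disjointed (\<lambda>i. cdom (ch i))"
  have D: "D i \<in> sets borel_T" "D i \<subseteq> cdom (ch i)" for i
  proof -
    have "range (\<lambda>i. cdom (ch i)) \<subseteq> sets borel_T" using open_borel_T[OF cdom_open[OF ch]] by blast
    from sets.range_disjointed_sets[OF this] show "D i \<in> sets borel_T" unfolding D_def by blast
    show "D i \<subseteq> cdom (ch i)" unfolding D_def by (rule disjointed_subset)
  qed
  have D_disj: "disjoint_family D" and D_cover: "(\<Union>i. D i) = topspace T"
    unfolding D_def by (auto simp: disjoint_family_disjointed UN_disjointed_eq ch_cover)
  define \<mu> where "\<mu> B = (\<Sum>i. emeasure (chart_volume (ch i)) (B \<inter> D i))" for B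
  define m where "m = measure_of (topspace T) (sets borel_T) \<mu>"
  have "countably_additive (sets borel_T) \<mu>"
    unfolding countably_additive_def
  proof (intro allI impI)
    fix A :: "nat \<Rightarrow> 'a set" assume A: "range A \<subseteq> sets borel_T" "disjoint_family A" "\<Union>(range A) \<in> sets borel_T"
    have "(\<Sum>n. \<mu> (A n)) = (\<Sum>i. \<Sum>n. emeasure (chart_volume (ch i)) (A n \<inter> D i))"
      unfolding \<mu>_def by (rule ennreal_suminf_swap)
    moreover have "(\<Sum>n. emeasure (chart_volume (ch i)) (A n \<inter> D i)) = emeasure (chart_volume (ch i)) (\<Union>(range A) \<inter> D i)" for i
    proof -
      have "(\<Sum>n. emeasure (chart_volume (ch i)) (A n \<inter> D i)) = emeasure (chart_volume (ch i)) (\<Union>n. A n \<inter> D i)"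
        using A D chart_volume(1)[OF ch] by (intro suminf_emeasure) (auto simp: disjoint_family_on_def)
      then show ?thesis by (simp add: Int_UN_distrib2)
    qed
    ultimately show "(\<Sum>n. \<mu> (A n)) = \<mu> (\<Union>(range A))" by (simp add: \<mu>_def)
  qed
  moreover have "positive (sets borel_T) \<mu>" by (simp add: positive_def \<mu>_def)
  moreover have sa: "sigma_algebra (topspace T) (sets borel_T)" using sets.sigma_algebra_axioms[of borel_T] by simp
  ultimately have em: "emeasure m B = \<mu> B" if "B \<in> sets borel_T" for B
    unfolding m_def using that by (intro emeasure_measure_of_sigma)
  have sp: "space m = topspace T" "sets m = sets borel_T"
    unfolding m_def by (simp add: space_measure_of_conv, rule sigma_algebra.sets_measure_of_eq[OF sa])
  have "emeasure m B = (\<integral>\<^sup>+x\<in>cmap c ` B. ennreal (density_in c x) \<partial>lborel)"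
    if c: "c \<in> atlas M" and B: "B \<in> sets borel_T" "B \<subseteq> cdom c" for c B
  proof -
    have "emeasure m B = (\<Sum>i. emeasure (chart_volume c) (B \<inter> D i))"
      unfolding em[OF B(1)] \<mu>_def using B D ch c
      by (intro suminf_cong chart_volume_agree) auto
    also have "\<dots> = emeasure (chart_volume c) (\<Union>i. B \<inter> D i)"
      using B D chart_volume(1)[OF c] disjoint_family_subset[OF D_disj, of "\<lambda>i. B \<inter> D i"]
      by (intro suminf_emeasure) auto
    also have "(\<Union>i. B \<inter> D i) = B" using D_cover B cdom_sub[OF c] by blast
    finally show ?thesis using chart_volume(2)[OF c B] by simp
  qed
  then have "is_volume M m"
    unfolding is_volume_def using sp by (auto simp: sets_borel_T[symmetric] density_in_def)
  then show ?thesis ..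
qed

end

section \<open>Pointwise norms and integrals of wedge products\<close>

text \<open>Cramer's rule.\<close>

lemma continuous_on_matrix_inv_component:
  fixes A :: "'a::topological_space \<Rightarrow> real^'n::finite^'n"
  assumes A: "continuous_on S A" and inv: "\<And>x. x \<in> S \<Longrightarrow> det (A x) \<noteq> 0"
  shows "continuous_on S (\<lambda>x. matrix_inv (A x) $ i $ j)"
proof -
  let ?B = "\<lambda>x. (\<chi> r s. if s = i then axis j 1 $ r else A x $ r $ s) :: real^'n^'n"
  have "matrix_inv (A x) $ i $ j = det (?B x) / det (A x)" if "x \<in> S" for x
  proof -
    have "A x ** matrix_inv (A x) = mat 1"
      using inv[OF that] by (intro matrix_inv_both) (simp add: invertible_det_nz)
    then have "A x *v column j (matrix_inv (A x)) = axis j 1"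
      by (metis matrix_vector_mult_basis matrix_vector_mul_assoc matrix_vector_mul_lid)
    then have "column j (matrix_inv (A x)) = (\<chi> k. det (\<chi> r s. if s = k then axis j 1 $ r else A x $ r $ s) / det (A x))"
      using cramer[OF inv[OF that]] by blast
    then have "column j (matrix_inv (A x)) $ i = det (?B x) / det (A x)" by simp
    then show ?thesis by (simp add: column_def)
  qed
  moreover have "continuous_on S (\<lambda>x. if s = i then axis j 1 $ r else A x $ r $ s)" for r s
    using A by (cases "s = i") (auto intro!: continuous_intros)
  then have "continuous_on S (\<lambda>x. det (?B x) / det (A x))"
    by (intro continuous_intros A) (use inv in auto)
  ultimately show ?thesis by (simp cong: continuous_on_cong)
qed

context riem_manifold
begin

abbreviation vol where "vol \<equiv> volume M"

text \<open>The chosen measure before completion.\<close>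

definition borel_volume where "borel_volume = (SOME m. is_volume M m)"

lemma is_volume_borel_volume: "is_volume M borel_volume"
  unfolding borel_volume_def using volume_exists by (rule someI_ex)

lemma vol_completion: "vol = completion borel_volume"
  by (simp add: volume_def borel_volume_def)

lemma sets_borel_volume: "sets borel_volume = sets borel_T" and space_borel_volume: "space borel_volume = topspace T"
  using is_volume_borel_volume by (auto simp: is_volume_def sets_borel_T)

lemma space_vol [simp]: "space vol = topspace T"
  by (simp add: vol_completion space_borel_volume)

lemma open_in_vol: "openin T U \<Longrightarrow> U \<in> sets vol"
  using open_borel_T by (auto simp: vol_completion sets_borel_volume intro: sets_completionI_sets)

lemma vol_in_chart:
  assumes "c \<in> atlas M" "B \<in> sets borel_T" "B \<subseteq> cdom c"
  shows "emeasure vol B = (\<integral>\<^sup>+x\<in>cmap c ` B. ennreal (density_in c x) \<partial>lborel)"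
proof -
  have "emeasure vol B = emeasure borel_volume B"
    unfolding vol_completion using assms(2) by (simp add: sets_borel_volume)
  then show ?thesis using is_volume_borel_volume assms unfolding is_volume_def density_in_def sets_borel_T[symmetric]
    by (simp add: sets_borel_volume)
qed

lemma chart_continuous:
  assumes c: "c \<in> atlas M" and F: "continuous_on (cimg c) F"
  shows "continuous_map (subtopology T (cdom c)) euclidean (\<lambda>p. F (cmap c p))"
proof -
  have "continuous_map (subtopology T (cdom c)) euclidean (F \<circ> cmap c)"
    using F cmap_homeo(1)[OF c] by (intro continuous_map_compose) auto
  then show ?thesis by (simp add: comp_def)
qed

lemma chart_continuous_pullback:
  assumes c: "c \<in> atlas M" and F: "continuous_on (cimg c) (\<lambda>x. F (cinv c x))"
  shows "continuous_map (subtopology T (cdom c)) euclidean F"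
  by (rule continuous_map_eq[OF chart_continuous[OF c F]]) (use c in auto)

text \<open>Near \<open>p\<close> the density is bounded in a chart, and the image of a small neighbourhood is bounded.\<close>

lemma vol_locally_finite:
  assumes p: "p \<in> topspace T"
  shows "\<exists>U. openin T U \<and> p \<in> U \<and> emeasure vol U < \<infinity>"
proof -
  obtain c where c: "c \<in> atlas M" "p \<in> cdom c" using chart_at[OF p] by blast
  have cont: "continuous_map (subtopology T (cdom c)) euclidean (\<lambda>q. density_in c (cmap c q))"
    by (rule chart_continuous[OF c(1) density_continuous[OF c(1)]])
  have cont': "continuous_map (subtopology T (cdom c)) euclidean (cmap c)"
    using chart_continuous[OF c(1) continuous_on_id] by simp
  define D where "D = density_in c (cmap c p) + 1"
  define U where "U = {q \<in> cdom c. density_in c (cmap c q) \<in> {..<D}} \<inter> {q \<in> cdom c. cmap c q \<in> ball (cmap c p) 1}"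
  have tops: "topspace (subtopology T (cdom c)) = cdom c" using cdom_sub[OF c(1)] by auto
  have U1: "openin (subtopology T (cdom c)) U" unfolding U_def
    using openin_continuous_map_preimage[OF cont, of "{..<D}"] openin_continuous_map_preimage[OF cont', of "ball (cmap c p) 1"]
    unfolding tops by (intro openin_Int) auto
  then have U: "openin T U" by (simp add: openin_open_subtopology[OF cdom_open[OF c(1)]])
  have pU: "p \<in> U" unfolding U_def D_def using c by auto
  have UB: "U \<in> sets borel_T" "U \<subseteq> cdom c" using open_borel_T[OF U] by (auto simp: U_def)
  have "emeasure vol U = (\<integral>\<^sup>+x\<in>cmap c ` U. ennreal (density_in c x) \<partial>lborel)"
    by (rule vol_in_chart[OF c(1) UB])
  also have "\<dots> \<le> (\<integral>\<^sup>+x. ennreal D * indicator (ball (cmap c p) 1) x \<partial>lborel)"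
    by (intro nn_integral_mono) (auto simp: U_def indicator_def intro!: ennreal_leI)
  also have "\<dots> = ennreal D * emeasure lborel (ball (cmap c p) 1)"
    by (subst nn_integral_cmult_indicator) auto
  also have "\<dots> < \<infinity>"
    using emeasure_lborel_ball_finite[of "cmap c p" 1] by (simp add: ennreal_mult_less_top)
  finally show ?thesis using U pU by blast
qed

lemma finite_volume_cover:
  obtains \<U> where "countable \<U>" "\<forall>U\<in>\<U>. openin T U \<and> emeasure vol U < \<infinity>" "\<Union>\<U> = topspace T"
proof -
  have "\<exists>\<V>. countable \<V> \<and> \<V> \<subseteq> {U. openin T U \<and> emeasure vol U < \<infinity>} \<and> \<Union>\<V> = topspace T"
  proof (rule Lindelof_spaceD[OF second_countable_imp_Lindelof_space[OF second_countable_T]])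
    show "\<Union>{U. openin T U \<and> emeasure vol U < \<infinity>} = topspace T"
    proof (intro subset_antisym subsetI)
      show "p \<in> \<Union>{U. openin T U \<and> emeasure vol U < \<infinity>}" if "p \<in> topspace T" for p
        using vol_locally_finite[OF that] by (elim exE conjE) (intro UnionI CollectI conjI)
    qed (auto dest: openin_subset)
  qed auto
  then obtain \<V> where V: "countable \<V>" "\<V> \<subseteq> {U. openin T U \<and> emeasure vol U < \<infinity>}" "\<Union>\<V> = topspace T"
    by (elim exE conjE)
  show ?thesis by (rule that[OF V(1) _ V(3)]) (use V(2) in fast)
qed

lemma compact_in_vol:
  assumes "compactin T K"
  shows "K \<in> sets vol"
proof -
  have "closedin T K" using compactin_imp_closedin[OF hausdorff assms] .
  then have "topspace T - (topspace T - K) \<in> sets vol"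
    using open_in_vol[of "topspace T - K"] sets.compl_sets[of "topspace T - K" vol]
    by (simp add: closedin_def)
  then show ?thesis using compactin_subset_topspace[OF assms] by (simp add: double_diff)
qed

lemma compact_finite_volume:
  assumes K: "compactin T K"
  shows "emeasure vol K < \<infinity>"
proof -
  let ?\<U> = "{U. openin T U \<and> emeasure vol U < \<infinity>}"
  have "K \<subseteq> \<Union>?\<U>" using vol_locally_finite compactin_subset_topspace[OF K] by blast
  then obtain \<F> where F: "finite \<F>" "\<F> \<subseteq> ?\<U>" "K \<subseteq> \<Union>\<F>"
    using compactinD[OF K, of ?\<U>] by auto
  have "emeasure vol K \<le> emeasure vol (\<Union>U\<in>\<F>. U)"
    using F open_in_vol by (intro emeasure_mono) (auto intro!: sets.finite_UN)
  also have "\<dots> \<le> (\<Sum>U\<in>\<F>. emeasure vol U)"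
    using F open_in_vol by (intro emeasure_subadditive_finite) auto
  also have "\<dots> < \<infinity>" using F(2) F(1) by (auto simp: less_top[symmetric])
  finally show ?thesis .
qed

lemma bounded_on_compact:
  fixes f :: "'a \<Rightarrow> real"
  assumes K: "compactin T K" and loc: "\<And>p. p \<in> K \<Longrightarrow> \<exists>V B. openin T V \<and> p \<in> V \<and> (\<forall>q\<in>V. f q \<le> B)"
  shows "\<exists>B\<ge>0. \<forall>q\<in>K. f q \<le> B"
proof -
  let ?\<U> = "{V. openin T V \<and> (\<exists>B. \<forall>q\<in>V. f q \<le> B)}"
  have "K \<subseteq> \<Union>?\<U>" using loc by blast
  then obtain \<F> where F: "finite \<F>" "\<F> \<subseteq> ?\<U>" "K \<subseteq> \<Union>\<F>"
    using compactinD[OF K, of ?\<U>] by auto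
  have "\<forall>V\<in>\<F>. \<exists>B. \<forall>q\<in>V. f q \<le> B" using F(2) by auto
  then obtain b where b: "\<And>V q. V \<in> \<F> \<Longrightarrow> q \<in> V \<Longrightarrow> f q \<le> b V" by metis
  have "f q \<le> (\<Sum>V\<in>\<F>. \<bar>b V\<bar>)" if q: "q \<in> K" for q
  proof -
    obtain V where V: "V \<in> \<F>" "q \<in> V" using q F(3) by auto
    have "f q \<le> \<bar>b V\<bar>" using b[OF V] by simp
    also have "\<dots> \<le> (\<Sum>V\<in>\<F>. \<bar>b V\<bar>)" by (rule member_le_sum[OF V(1) _ F(1)]) simp
    finally show ?thesis .
  qed
  then show ?thesis by (intro exI[of _ "\<Sum>V\<in>\<F>. \<bar>b V\<bar>"]) (auto intro: sum_nonneg)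
qed

lemma continuous_measurable_on:
  assumes U: "openin T U" and f: "continuous_map (subtopology T U) euclidean f"
  shows "f \<in> borel_measurable (restrict_space vol U)"
proof (rule borel_measurableI)
  fix S :: "'b set" assume "open S"
  then have "openin (subtopology T U) {x \<in> topspace (subtopology T U). f x \<in> S}"
    using f by (intro openin_continuous_map_preimage) auto
  moreover have "f -` S \<inter> space (restrict_space vol U) = {x \<in> topspace (subtopology T U). f x \<in> S}"
    by (auto simp: space_restrict_space)
  ultimately have "openin T (f -` S \<inter> space (restrict_space vol U))"
    by (simp add: openin_open_subtopology[OF U])
  then show "f -` S \<inter> space (restrict_space vol U) \<in> sets (restrict_space vol U)"
    using open_in_vol U open_in_vol[OF U]
    by (subst sets_restrict_space_iff) (auto simp: space_restrict_space)
qed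

lemma measurable_from_charts:
  assumes "\<And>c. c \<in> atlas M \<Longrightarrow> f \<in> measurable (restrict_space vol (cdom c)) N"
  shows "f \<in> measurable vol N"
proof -
  obtain C where C: "countable C" "C \<subseteq> atlas M" "(\<Union>c\<in>C. cdom c) = topspace T" by (rule countable_atlas)
  show ?thesis
  proof (rule measurable_piecewise_restrict[where C="cdom ` C"])
    show "countable (cdom ` C)" using C by auto
    show "space vol \<subseteq> \<Union>(cdom ` C)" using C by auto
    fix \<Omega> assume "\<Omega> \<in> cdom ` C"
    then obtain c where c: "c \<in> atlas M" "\<Omega> = cdom c" using C(2) by blast
    show "\<Omega> \<inter> space vol \<in> sets vol" using c open_in_vol[OF cdom_open[OF c(1)]] cdom_sub[OF c(1)]
      by (simp add: Int_absorb2)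
    show "f \<in> measurable (restrict_space vol \<Omega>) N" using assms c by simp
  qed
qed

text \<open>Families of multilinear forms with the transformation behaviour of differential forms on \<open>U\<close>. The
exterior differential of a test form is such a family on sets of interior points.\<close>

definition mform_on :: "'a set \<Rightarrow> nat \<Rightarrow> ('a, 'n) dform \<Rightarrow> bool" where
  "mform_on U k \<omega> \<longleftrightarrow>
     (\<forall>c\<in>atlas M. \<forall>p\<in>cdom c \<inter> U. multilinear_form k (\<omega> c p)) \<and>
     (\<forall>c\<in>atlas M. \<forall>d\<in>atlas M. \<forall>p\<in>cdom c \<inter> cdom d \<inter> U. \<forall>v. \<omega> c p v = \<omega> d p (\<lambda>i. jac c d p *v v i))"

lemma is_dform_mform_on:
  assumes "is_dform M k \<omega>" shows "mform_on U k \<omega>"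
  unfolding mform_on_def
proof (intro conjI ballI allI)
  fix c p assume c: "c \<in> atlas M" "p \<in> cdom c \<inter> U"
  show "multilinear_form k (\<omega> c p)"
    using assms[unfolded is_dform_def, THEN conjunct1, THEN bspec, THEN bspec, OF c(1)] c(2)
    by (intro alt_form_multilinear) blast
next
  fix c d p v assume c: "c \<in> atlas M" "d \<in> atlas M" "p \<in> cdom c \<inter> cdom d \<inter> U"
  show "\<omega> c p v = \<omega> d p (\<lambda>i. jac c d p *v v i)"
    using assms[unfolded is_dform_def, THEN conjunct2, THEN bspec, THEN bspec, THEN bspec, THEN spec, OF c(1,2)] c(3)
    by blast
qed

lemma mform_onD:
  assumes \<omega>: "mform_on U k \<omega>" and c: "c \<in> atlas M" "p \<in> cdom c" "p \<in> U"
  shows "multilinear_form k (\<omega> c p)"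
    and "d \<in> atlas M \<Longrightarrow> p \<in> cdom d \<Longrightarrow> \<omega> c p v = \<omega> d p (\<lambda>i. jac c d p *v v i)"
proof -
  show "multilinear_form k (\<omega> c p)"
    by (rule \<omega>[unfolded mform_on_def, THEN conjunct1, THEN bspec, THEN bspec]) (use c in simp_all)
  show "\<omega> c p v = \<omega> d p (\<lambda>i. jac c d p *v v i)" if "d \<in> atlas M" "p \<in> cdom d"
    by (rule \<omega>[unfolded mform_on_def, THEN conjunct2, THEN bspec, THEN bspec, THEN bspec, THEN spec])
       (use c that in simp_all)
qed

lemma pt_norm_in_chart:
  assumes \<omega>: "mform_on U k \<omega>" and c: "c \<in> atlas M" "p \<in> cdom c" "p \<in> U"
  shows "pt_norm M k \<omega> p = form_norm (metric M c p) k (\<omega> c p)"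
proof -
  define d where "d = chart_at M p"
  have d: "d \<in> atlas M" "p \<in> cdom d" using chart_at[of p] cdom_sub[OF c(1)] c(2) by (auto simp: d_def)
  have G: "metric M c p = transpose (jac c d p) ** metric M d p ** jac c d p"
    using metric_change c d by blast
  have "\<omega> c p = (\<lambda>v. \<omega> d p (\<lambda>i. jac c d p *v v i))" using mform_onD(2)[OF \<omega> c d] by auto
  then have "form_norm (metric M c p) k (\<omega> c p)
      = form_norm (transpose (jac c d p) ** metric M d p ** jac c d p) k (\<lambda>v. \<omega> d p (\<lambda>i. jac c d p *v v i))"
    using G by simp
  also have "\<dots> = form_norm (metric M d p) k (\<omega> d p)"
    using metric_posdef[OF c(1,2)] mform_onD(1)[OF \<omega> d c(3)] unfolding G by (rule form_norm_pullback)
  finally show ?thesis by (simp add: pt_norm_def form_norm_def Let_def d_def)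
qed

lemma pt_norm_chart_at: "pt_norm M k \<omega> p = form_norm (metric M (chart_at M p) p) k (\<omega> (chart_at M p) p)"
  by (simp add: pt_norm_def form_norm_def Let_def)

lemma metric_continuous: "c \<in> atlas M \<Longrightarrow> continuous_on (cimg c) (\<lambda>x. metric M c (cinv c x))"
  by (intro smooth_map_on_continuous smooth_metric)

lemma metric_inv_continuous:
  assumes c: "c \<in> atlas M"
  shows "continuous_map (subtopology T (cdom c)) euclidean (\<lambda>p. matrix_inv (metric M c p) $ i $ j)"
proof (rule chart_continuous_pullback[OF c], rule continuous_on_matrix_inv_component[OF metric_continuous[OF c]])
  show "det (metric M c (cinv c x)) \<noteq> 0" if "x \<in> cimg c" for x
    using posdef_det_pos[OF metric_posdef[OF c cinv_cdom[OF that]]] by simp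
qed

lemma sqrt_det_continuous:
  assumes c: "c \<in> atlas M"
  shows "continuous_map (subtopology T (cdom c)) euclidean (\<lambda>p. sqrt (det (metric M c p)))"
  by (rule chart_continuous_pullback[OF c]) (intro continuous_intros metric_continuous c)

lemma pt_norm_measurable:
  assumes \<omega>: "measurable_form M k \<omega>"
  shows "pt_norm M k \<omega> \<in> borel_measurable vol"
proof (rule measurable_from_charts)
  fix c assume c: "c \<in> atlas M"
  have m: "(\<lambda>p. \<omega> c p v) \<in> borel_measurable (restrict_space vol (cdom c))" for v
    using \<omega> c by (simp add: measurable_form_def)
  have [measurable]: "(\<lambda>p. matrix_inv (metric M c p) $ i $ j) \<in> borel_measurable (restrict_space vol (cdom c))" for i j
    by (rule continuous_measurable_on[OF cdom_open[OF c] metric_inv_continuous[OF c]])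
  have "(\<lambda>p. form_norm (metric M c p) k (\<omega> c p)) \<in> borel_measurable (restrict_space vol (cdom c))"
    unfolding form_norm_def alt_inner_def
    by (intro measurable_compose[OF _ borel_measurable_continuous_onI[OF continuous_on_real_sqrt[OF continuous_on_id]]]
        borel_measurable_divide borel_measurable_sum borel_measurable_times borel_measurable_prod m) auto
  then show "pt_norm M k \<omega> \<in> borel_measurable (restrict_space vol (cdom c))"
    by (rule measurable_cong[THEN iffD1, rotated])
       (use \<omega> c in \<open>auto simp: space_restrict_space measurable_form_def intro!: pt_norm_in_chart[symmetric] is_dform_mform_on[of _ _ UNIV]\<close>)
qed

lemma pt_norm_nonneg:
  assumes "mform_on U k \<omega>" "p \<in> U" "p \<in> topspace T"
  shows "0 \<le> pt_norm M k \<omega> p"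
  unfolding pt_norm_chart_at using chart_at[OF assms(3)] assms
  by (intro form_norm_nonneg metric_posdef mform_onD(1)[OF assms(1)]) auto

lemma pt_norm_continuous_on_chart:
  assumes \<beta>: "mform_on U k \<beta>" and c: "c \<in> atlas M"
    and cont: "\<And>v. continuous_map (subtopology T (cdom c \<inter> U)) euclidean (\<lambda>p. \<beta> c p v)"
  shows "continuous_map (subtopology T (cdom c \<inter> U)) euclidean (pt_norm M k \<beta>)"
proof (rule continuous_map_eq)
  have G: "continuous_map (subtopology T (cdom c \<inter> U)) euclidean (\<lambda>p. matrix_inv (metric M c p) $ i $ j)" for i j
    using metric_inv_continuous[OF c] by (rule continuous_map_from_subtopology_mono) auto
  have "continuous_map (subtopology T (cdom c \<inter> U)) euclidean (\<lambda>p. alt_inner (metric M c p) k (\<beta> c p) (\<beta> c p))"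
    unfolding alt_inner_def divide_inverse
    by (intro continuous_map_sum continuous_map_real_mult continuous_map_prod cont G) (auto simp: finite_PiE)
  then have "continuous_map (subtopology T (cdom c \<inter> U)) euclidean
      (sqrt \<circ> (\<lambda>p. alt_inner (metric M c p) k (\<beta> c p) (\<beta> c p)))"
    by (rule continuous_map_compose) (auto intro: continuous_intros)
  then show "continuous_map (subtopology T (cdom c \<inter> U)) euclidean (\<lambda>p. form_norm (metric M c p) k (\<beta> c p))"
    by (simp add: form_norm_def comp_def)
  show "form_norm (metric M c p) k (\<beta> c p) = pt_norm M k \<beta> p"
    if "p \<in> topspace (subtopology T (cdom c \<inter> U))" for p
    using that pt_norm_in_chart[OF \<beta> c] by auto
qed


text \<open>The function integrated in \<open>form_integral\<close>, extended by \<open>0\<close>.\<close>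

definition integrand :: "'a set \<Rightarrow> (('a, 'n) chart \<Rightarrow> 'a \<Rightarrow> real) \<Rightarrow> ('a, 'n) dform \<Rightarrow> 'a \<Rightarrow> real" where
  "integrand U s \<eta> p = indicator U p *
     (s (chart_at M p) p * \<eta> (chart_at M p) p coord_frame / sqrt (det (metric M (chart_at M p) p)))"

lemma form_integral_integrand: "form_integral M U s \<eta> = integral\<^sup>L vol (integrand U s \<eta>)"
  unfolding form_integral_def set_lebesgue_integral_def integrand_def Let_def by simp

lemma jac_det_nonzero:
  assumes "c \<in> atlas M" "d \<in> atlas M" "p \<in> cdom c" "p \<in> cdom d"
  shows "det (jac c d p) \<noteq> 0"
proof
  assume "det (jac c d p) = 0"
  then have "det (metric M c p) = 0" using metric_change[of c d p] assms by (simp add: det_mul)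
  moreover have "0 < det (metric M c p)" by (rule posdef_det_pos[OF metric_posdef[OF assms(1,3)]])
  ultimately show False by simp
qed

lemma wedge_change:
  assumes \<omega>: "mform_on U j \<omega>" and \<beta>: "mform_on U m \<beta>" and n: "j + m = CARD('n)"
    and c: "c \<in> atlas M" "p \<in> cdom c" and d: "d \<in> atlas M" "p \<in> cdom d" and p: "p \<in> U"
  shows "wedge j m \<omega> \<beta> c p coord_frame = det (jac c d p) * wedge j m \<omega> \<beta> d p coord_frame"
proof -
  have "wedge j m \<omega> \<beta> c p coord_frame = wedge_val j m (\<omega> d p) (\<beta> d p) (\<lambda>i. jac c d p *v coord_frame i)"
    unfolding wedge_eq_wedge_val wedge_val_def mform_onD(2)[OF \<omega> c p d] mform_onD(2)[OF \<beta> c p d] by simp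
  also have "\<dots> = det (jac c d p) * wedge j m \<omega> \<beta> d p coord_frame"
    unfolding wedge_eq_wedge_val
    by (rule wedge_val_top_degree[OF mform_onD(1)[OF \<omega> d p] mform_onD(1)[OF \<beta> d p] n])
  finally show ?thesis .
qed

lemma orientation_change:
  assumes "orientation_on M U s" "c \<in> atlas M" "d \<in> atlas M" "p \<in> cdom c" "p \<in> cdom d" "p \<in> U"
  shows "s d p = sgn (det (jac c d p)) * s c p"
  by (rule assms(1)[unfolded orientation_on_def, THEN conjunct2, THEN bspec, THEN bspec, THEN bspec])
     (use assms in simp_all)

lemma orientation_continuous:
  assumes "orientation_on M U s" "c \<in> atlas M"
  shows "continuous_map (subtopology T (cdom c \<inter> U)) euclideanreal (s c)"
    and "p \<in> cdom c \<Longrightarrow> p \<in> U \<Longrightarrow> \<bar>s c p\<bar> = 1"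
proof -
  note * = assms(1)[unfolded orientation_on_def, THEN conjunct1, THEN bspec, OF assms(2)]
  show "continuous_map (subtopology T (cdom c \<inter> U)) euclideanreal (s c)" using * by (rule conjunct1)
  show "\<bar>s c p\<bar> = 1" if "p \<in> cdom c" "p \<in> U"
    using *[THEN conjunct2, THEN bspec, of p] that by auto
qed

text \<open>The oriented volume form and the wedge product both pick up the Jacobian determinant, so that an
arbitrary chart may replace the selected one. Without this, the integrand need not be measurable,
because the selection of charts is arbitrary.\<close>

lemma integrand_in_chart:
  assumes \<omega>: "mform_on U j \<omega>" and \<beta>: "mform_on U m \<beta>" and n: "j + m = CARD('n)"
    and s: "orientation_on M U s" and c: "c \<in> atlas M" "p \<in> cdom c" and p: "p \<in> U"
  shows "integrand U s (wedge j m \<omega> \<beta>) p = s c p * wedge j m \<omega> \<beta> c p coord_frame / sqrt (det (metric M c p))"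
proof -
  define d where "d = chart_at M p"
  have d: "d \<in> atlas M" "p \<in> cdom d" using chart_at[of p] cdom_sub[OF c(1)] c(2) by (auto simp: d_def)
  let ?J = "det (jac c d p)"
  have J: "?J \<noteq> 0" using jac_det_nonzero c d by blast
  have g: "sqrt (det (metric M c p)) = \<bar>?J\<bar> * sqrt (det (metric M d p))"
    using density_change c d by blast
  have "s c p * wedge j m \<omega> \<beta> c p coord_frame / sqrt (det (metric M c p))
     = s c p * (?J / \<bar>?J\<bar>) * wedge j m \<omega> \<beta> d p coord_frame / sqrt (det (metric M d p))"
    unfolding g wedge_change[OF \<omega> \<beta> n c d p] by simp
  also have "?J / \<bar>?J\<bar> = sgn ?J" by (simp add: sgn_real_def)
  also have "s c p * sgn ?J = s d p" using orientation_change[OF s c(1) d(1) c(2) d(2) p] by simp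
  finally show ?thesis using p by (simp add: integrand_def d_def)
qed

text \<open>The forms against which the defining integrals of a weak differential are taken.\<close>

definition test_form :: "'a set \<Rightarrow> 'a set \<Rightarrow> nat \<Rightarrow> ('a, 'n) dform \<Rightarrow> bool" where
  "test_form U K m \<beta> \<longleftrightarrow> mform_on U m \<beta> \<and> compactin T K \<and> K \<subseteq> U \<and>
     (\<forall>c\<in>atlas M. \<forall>v. continuous_map (subtopology T (cdom c \<inter> U)) euclideanreal (\<lambda>p. \<beta> c p v)) \<and>
     (\<forall>c\<in>atlas M. \<forall>p\<in>cdom c \<inter> U - K. \<beta> c p = (\<lambda>v. 0))"

lemma test_formD:
  assumes "test_form U K m \<beta>"
  shows "mform_on U m \<beta>" "compactin T K" "K \<subseteq> U"
    "c \<in> atlas M \<Longrightarrow> continuous_map (subtopology T (cdom c \<inter> U)) euclideanreal (\<lambda>p. \<beta> c p v)"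
    "c \<in> atlas M \<Longrightarrow> p \<in> cdom c \<Longrightarrow> p \<in> U \<Longrightarrow> p \<notin> K \<Longrightarrow> \<beta> c p = (\<lambda>v. 0)"
  using assms unfolding test_form_def by (blast, blast, blast, blast, blast)

text \<open>On the domain of each of countably many charts, the integrand is given by that chart.\<close>

lemma integrand_measurable:
  assumes U: "openin T U" and \<omega>: "measurable_form M j \<omega>" and \<beta>: "test_form U K m \<beta>" and n: "j + m = CARD('n)"
    and s: "orientation_on M U s"
  shows "integrand U s (wedge j m \<omega> \<beta>) \<in> borel_measurable vol"
proof -
  let ?f = "integrand U s (wedge j m \<omega> \<beta>)"
  have \<omega>': "mform_on U j \<omega>" using \<omega> by (intro is_dform_mform_on) (simp add: measurable_form_def)
  obtain C where C: "countable C" "C \<subseteq> atlas M" "(\<Union>c\<in>C. cdom c) = topspace T" by (rule countable_atlas)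
  have chart_part: "?f \<in> borel_measurable (restrict_space vol (cdom c \<inter> U))" if c: "c \<in> atlas M" for c
  proof -
    let ?R = "restrict_space vol (cdom c \<inter> U)"
    have op: "openin T (cdom c \<inter> U)" using cdom_open[OF c] U by blast
    have 1: "(\<lambda>p. \<omega> c p v) \<in> borel_measurable ?R" for v
      by (rule measurable_restrict_mono[of _ _ "cdom c"]) (use \<omega> c in \<open>simp_all add: measurable_form_def\<close>)
    have 2: "(\<lambda>p. \<beta> c p v) \<in> borel_measurable ?R" for v
      by (rule continuous_measurable_on[OF op test_formD(4)[OF \<beta> c]])
    have 3: "s c \<in> borel_measurable ?R"
      by (rule continuous_measurable_on[OF op orientation_continuous(1)[OF s c]])
    have 4: "(\<lambda>p. sqrt (det (metric M c p))) \<in> borel_measurable ?R"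
      by (rule continuous_measurable_on[OF op continuous_map_from_subtopology_mono[OF sqrt_det_continuous[OF c]]]) auto
    have "(\<lambda>p. s c p * wedge j m \<omega> \<beta> c p coord_frame / sqrt (det (metric M c p))) \<in> borel_measurable ?R"
      unfolding wedge_eq_wedge_val wedge_val_def
      by (intro borel_measurable_divide borel_measurable_times borel_measurable_sum 1 2 3 4) auto
    moreover have "?f p = s c p * wedge j m \<omega> \<beta> c p coord_frame / sqrt (det (metric M c p))" if "p \<in> space ?R" for p
      using that by (intro integrand_in_chart[OF \<omega>' test_formD(1)[OF \<beta>] n s c]) (auto simp: space_restrict_space)
    ultimately show ?thesis by (subst measurable_cong) auto
  qed
  have pieces: "\<Omega> \<inter> space vol \<in> sets vol \<and> ?f \<in> borel_measurable (restrict_space vol \<Omega>)"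
    if "\<Omega> \<in> insert (topspace T - U) ((\<lambda>c. cdom c \<inter> U) ` C)" for \<Omega>
  proof -
    from that consider "\<Omega> = topspace T - U" | c where "c \<in> atlas M" "\<Omega> = cdom c \<inter> U" using C(2) by blast
    then show ?thesis
    proof cases
      case 1
      have "?f \<in> borel_measurable (restrict_space vol \<Omega>)"
        by (subst measurable_cong[where g="\<lambda>_. 0"]) (auto simp: integrand_def 1 space_restrict_space)
      moreover have "topspace T - U \<in> sets vol" using sets.compl_sets[OF open_in_vol[OF U]] by simp
      ultimately show ?thesis using 1 by (simp add: Int_absorb2)
    next
      case 2
      have "openin T \<Omega>" using cdom_open[OF 2(1)] U 2(2) by blast
      then show ?thesis using open_in_vol[of \<Omega>] openin_subset[of T \<Omega>] chart_part[OF 2(1)] 2(2)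
        by (simp add: Int_absorb2)
    qed
  qed
  show ?thesis
  proof (rule measurable_piecewise_restrict[where C="insert (topspace T - U) ((\<lambda>c. cdom c \<inter> U) ` C)"])
    show "countable (insert (topspace T - U) ((\<lambda>c. cdom c \<inter> U) ` C))" using C(1) by simp
    show "space vol \<subseteq> \<Union>(insert (topspace T - U) ((\<lambda>c. cdom c \<inter> U) ` C))"
      using C(3) by auto
  qed (use pieces in blast)+
qed

text \<open>The constant is a bound for the norm of \<open>\<beta>\<close> on the compact set \<open>K\<close> times the constant of
\<open>wedge_val_form_norm_bound\<close>.\<close>

lemma integrand_bound:
  assumes U: "openin T U" and \<beta>: "test_form U K m \<beta>" and n: "j + m = CARD('n)" and s: "orientation_on M U s"
  shows "\<exists>B\<ge>0. \<forall>\<omega>. is_dform M j \<omega> \<longrightarrow> (\<forall>p\<in>topspace T.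
      \<bar>integrand U s (wedge j m \<omega> \<beta>) p\<bar> \<le> B * (indicator K p * pt_norm M j \<omega> p))"
proof -
  note \<beta>' = test_formD[OF \<beta>]
  have "\<exists>V B. openin T V \<and> p \<in> V \<and> (\<forall>q\<in>V. pt_norm M m \<beta> q \<le> B)" if p: "p \<in> K" for p
  proof -
    have "p \<in> topspace T" using p compactin_subset_topspace[OF \<beta>'(2)] by auto
    then obtain c where c: "c \<in> atlas M" "p \<in> cdom c" using chart_at by blast
    have op: "openin T (cdom c \<inter> U)" using cdom_open[OF c(1)] U by blast
    have "continuous_map (subtopology T (cdom c \<inter> U)) euclidean (pt_norm M m \<beta>)"
      by (rule pt_norm_continuous_on_chart[OF \<beta>'(1) c(1) \<beta>'(4)[OF c(1)]])
    from openin_continuous_map_preimage[OF this, of "{..<pt_norm M m \<beta> p + 1}"]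
    have "openin T {q \<in> topspace (subtopology T (cdom c \<inter> U)). pt_norm M m \<beta> q \<in> {..<pt_norm M m \<beta> p + 1}}"
      by (simp add: openin_open_subtopology[OF op])
    moreover have "p \<in> {q \<in> topspace (subtopology T (cdom c \<inter> U)). pt_norm M m \<beta> q \<in> {..<pt_norm M m \<beta> p + 1}}"
      using c p \<beta>'(3) \<open>p \<in> topspace T\<close> by auto
    ultimately show ?thesis
      by (intro exI[of _ "{q \<in> topspace (subtopology T (cdom c \<inter> U)). pt_norm M m \<beta> q \<in> {..<pt_norm M m \<beta> p + 1}}"]
          exI[of _ "pt_norm M m \<beta> p + 1"]) auto
  qed
  from bounded_on_compact[OF \<beta>'(2) this] obtain b where b: "b \<ge> 0" "\<And>q. q \<in> K \<Longrightarrow> pt_norm M m \<beta> q \<le> b" by blast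
  define N where "N = real (card {s. s permutes {..<j+m}}) * sqrt (fact j) * sqrt (fact m)"
  have N: "N \<ge> 0" by (simp add: N_def)
  have "\<bar>integrand U s (wedge j m \<omega> \<beta>) p\<bar> \<le> (N * b) * (indicator K p * pt_norm M j \<omega> p)"
    if \<omega>: "is_dform M j \<omega>" and p: "p \<in> topspace T" for \<omega> p
  proof -
    have \<omega>': "mform_on U j \<omega>" using is_dform_mform_on[OF \<omega>] .
    obtain c where c: "c \<in> atlas M" "p \<in> cdom c" using chart_at p by blast
    consider "p \<notin> U" | "p \<in> U" "p \<notin> K" | "p \<in> U" "p \<in> K" by blast
    then show ?thesis
    proof cases
      case 1
      then have "p \<notin> K" using \<beta>'(3) by auto
      then show ?thesis using 1 by (simp add: integrand_def)
    next
      case 2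
      then have "\<beta> c p = (\<lambda>v. 0)" using \<beta>'(5) c by blast
      then have "wedge j m \<omega> \<beta> c p coord_frame = 0" unfolding wedge_def by simp
      then show ?thesis using 2 by (simp add: integrand_in_chart[OF \<omega>' \<beta>'(1) n s c])
    next
      case 3
      have "\<bar>integrand U s (wedge j m \<omega> \<beta>) p\<bar> = \<bar>wedge j m \<omega> \<beta> c p coord_frame\<bar> / sqrt (det (metric M c p))"
        using orientation_continuous(2)[OF s c 3(1)] posdef_det_pos[OF metric_posdef[OF c]]
        by (simp add: integrand_in_chart[OF \<omega>' \<beta>'(1) n s c 3(1)] abs_mult)
      also have "\<dots> \<le> N * (form_norm (metric M c p) j (\<omega> c p) * form_norm (metric M c p) m (\<beta> c p))"
        unfolding wedge_eq_wedge_val N_def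
        by (rule wedge_val_form_norm_bound[OF mform_onD(1)[OF \<omega>' c 3(1)] mform_onD(1)[OF \<beta>'(1) c 3(1)] n metric_posdef[OF c]])
      also have "\<dots> = N * (pt_norm M j \<omega> p * pt_norm M m \<beta> p)"
        by (simp add: pt_norm_in_chart[OF \<omega>' c 3(1)] pt_norm_in_chart[OF \<beta>'(1) c 3(1)])
      also have "\<dots> \<le> N * (pt_norm M j \<omega> p * b)"
        using b(2)[OF 3(2)] pt_norm_nonneg[OF \<omega>' 3(1) p] by (intro mult_left_mono N)
      finally show ?thesis using 3 by (simp add: mult_ac)
    qed
  qed
  then show ?thesis using N b by (intro exI[of _ "N * b"]) auto
qed

end

section \<open>Test forms and their differentials\<close>

lemma Ck_on_2_symmetric:
  fixes h :: "'e::real_normed_vector \<Rightarrow> real^'n::finite"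
  assumes V: "open V" and h: "Ck_on 2 V h"
  obtains h' h'' where "\<And>x. x \<in> V \<Longrightarrow> (h has_derivative h' x) (at x)"
    "\<And>v x. x \<in> V \<Longrightarrow> ((\<lambda>x. h' x v) has_derivative h'' v x) (at x)"
    "\<And>x v w. x \<in> V \<Longrightarrow> h'' v x w = h'' w x v"
proof -
  obtain h' where h': "\<And>x. x \<in> V \<Longrightarrow> (h has_derivative h' x) (at x)" "\<And>v. Ck_on 1 V (\<lambda>x. h' x v)"
    using h by (auto simp: numeral_2_eq_2)
  have "\<forall>v. \<exists>g. (\<forall>x\<in>V. ((\<lambda>x. h' x v) has_derivative g x) (at x)) \<and> (\<forall>w. continuous_on V (\<lambda>x. g x w))"
    using h'(2) by auto
  then obtain h'' where h'': "\<And>v x. x \<in> V \<Longrightarrow> ((\<lambda>x. h' x v) has_derivative h'' v x) (at x)"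
      "\<And>v w. continuous_on V (\<lambda>x. h'' v x w)"
    by metis
  have "h'' v x w = h'' w x v" if x: "x \<in> V" for x v w
  proof -
    have "h'' v x w $ i = h'' w x v $ i" for i
    proof (rule second_derivative_symmetric[OF V x, of "\<lambda>x. h x $ i" "\<lambda>x v. h' x v $ i" "\<lambda>v x w. h'' v x w $ i"])
      show "((\<lambda>x. h x $ i) has_derivative (\<lambda>v. h' x v $ i)) (at x)" if "x \<in> V" for x
        by (rule bounded_linear.has_derivative[OF bounded_linear_vec_nth h'(1)[OF that]])
      show "((\<lambda>x. h' x v $ i) has_derivative (\<lambda>w. h'' v x w $ i)) (at x)" if "x \<in> V" for x v
        by (rule bounded_linear.has_derivative[OF bounded_linear_vec_nth h''(1)[OF that]])
      show "continuous_on V (\<lambda>x. h'' v x w $ i)" for v w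
        by (intro continuous_intros h''(2))
    qed
    then show ?thesis by (simp add: vec_eq_iff)
  qed
  with h'(1) h''(1) show ?thesis by (rule that)
qed

text \<open>A pointwise linear dependence on an argument is inherited by derivatives.\<close>

lemma frechet_derivative_slot_linear:
  fixes a :: "real^'n::finite \<Rightarrow> (nat \<Rightarrow> real^'n) \<Rightarrow> real"
  assumes W: "open W" "y \<in> W" and a_lin: "\<And>y. y \<in> W \<Longrightarrow> multilinear_form m (a y)" and r: "r < m"
    and a_der: "\<And>w. ((\<lambda>y. a y w) has_derivative a' w) (at y)"
  shows "linear (\<lambda>x. a' (w(r := x)) h)"
proof (rule linearI)
  fix x z
  have "((\<lambda>y. a y (w(r := x)) + a y (w(r := z))) has_derivative (\<lambda>h. a' (w(r := x)) h + a' (w(r := z)) h)) (at y)"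
    by (intro has_derivative_add a_der)
  then have "((\<lambda>y. a y (w(r := x + z))) has_derivative (\<lambda>h. a' (w(r := x)) h + a' (w(r := z)) h)) (at y)"
  proof (rule has_derivative_transform_within_open[OF _ W])
    show "a y (w(r := x)) + a y (w(r := z)) = a y (w(r := x + z))" if "y \<in> W" for y
      using linear_add[OF multilinear_form_linear[OF a_lin[OF that] r]] by simp
  qed
  from has_derivative_unique[OF a_der this] show "a' (w(r := x + z)) h = a' (w(r := x)) h + a' (w(r := z)) h"
    by (rule fun_cong)
next
  fix c x
  have "((\<lambda>y. c * a y (w(r := x))) has_derivative (\<lambda>h. c * a' (w(r := x)) h)) (at y)"
    by (intro has_derivative_mult_right a_der)
  then have "((\<lambda>y. a y (w(r := c *\<^sub>R x))) has_derivative (\<lambda>h. c * a' (w(r := x)) h)) (at y)"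
  proof (rule has_derivative_transform_within_open[OF _ W])
    show "c * a y (w(r := x)) = a y (w(r := c *\<^sub>R x))" if "y \<in> W" for y
      using linear_cmul[OF multilinear_form_linear[OF a_lin[OF that] r]] by simp
  qed
  from has_derivative_unique[OF a_der this] show "a' (w(r := c *\<^sub>R x)) h = c *\<^sub>R a' (w(r := x)) h"
    by (simp add: fun_eq_iff)
qed

context riem_manifold
begin

text \<open>A point is interior if some chart maps it into the interior of its image. By invariance of domain,
every other chart does the same, so that derivatives at interior points are taken in open sets.\<close>

lemma chart_image_open:
  assumes U: "openin T U" "U \<subseteq> interior_of_mfd M" and c: "c \<in> atlas M"
  shows "open (cmap c ` (cdom c \<inter> U))"
proof (subst open_subopen, rule ballI)
  fix x assume "x \<in> cmap c ` (cdom c \<inter> U)"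
  then obtain p where p: "p \<in> cdom c" "p \<in> U" "x = cmap c p" by (elim imageE IntE)
  have "p \<in> interior_of_mfd M" by (rule subsetD[OF U(2) p(2)])
  then have "\<exists>e\<in>atlas M. p \<in> cdom e \<and> cmap e p \<in> interior (cimg e)"
    unfolding interior_of_mfd_def by (rule CollectD)
  then obtain e where e: "e \<in> atlas M" "p \<in> cdom e" "cmap e p \<in> interior (cimg e)" by (elim bexE conjE)
  define A where "A = cmap e ` (cdom e \<inter> (cdom c \<inter> U)) \<inter> interior (cimg e)"
  have "openin T (cdom c \<inter> U)" using cdom_open[OF c] U(1) by (rule openin_Int)
  from image_openin[OF e(1) this] obtain V where V: "open V" "cmap e ` (cdom e \<inter> (cdom c \<inter> U)) = cimg e \<inter> V"
    by (auto simp: openin_open)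
  have "A = V \<inter> interior (cimg e)" unfolding A_def V(2) using interior_subset by blast
  then have openA: "open A" using V(1) by auto
  have A_sub: "\<exists>q. q \<in> cdom e \<and> q \<in> cdom c \<and> q \<in> U \<and> y = cmap e q" if "y \<in> A" for y
    using that unfolding A_def by (elim IntE imageE) blast
  have "continuous_on (cmap e ` (cdom e \<inter> cdom c)) (cmap c \<circ> cinv e)"
    by (rule smooth_map_on_continuous[OF smooth_transition[OF e(1) c]])
  then have contA: "continuous_on A (cmap c \<circ> cinv e)"
    by (rule continuous_on_subset) (auto simp: A_def)
  have "inj_on (cmap c \<circ> cinv e) A"
  proof (rule inj_onI)
    fix y z assume "y \<in> A" "z \<in> A" and eq: "(cmap c \<circ> cinv e) y = (cmap c \<circ> cinv e) z"
    then obtain q q' where "q \<in> cdom e" "q \<in> cdom c" "y = cmap e q" "q' \<in> cdom e" "q' \<in> cdom c" "z = cmap e q'"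
      using A_sub by meson
    then show "y = z" using eq e inj_onD[OF cmap_homeo(3)[OF c], of q q'] by simp
  qed
  then have "open ((cmap c \<circ> cinv e) ` A)" using invariance_of_domain[OF contA openA] by simp
  moreover have "x \<in> (cmap c \<circ> cinv e) ` A"
  proof (rule image_eqI)
    show "x = (cmap c \<circ> cinv e) (cmap e p)" using p e by simp
    show "cmap e p \<in> A" unfolding A_def using p e by blast
  qed
  moreover have "(cmap c \<circ> cinv e) ` A \<subseteq> cmap c ` (cdom c \<inter> U)"
  proof (rule image_subsetI)
    fix y assume "y \<in> A"
    then obtain q where "q \<in> cdom e" "q \<in> cdom c" "q \<in> U" "y = cmap e q" using A_sub by meson
    then show "(cmap c \<circ> cinv e) y \<in> cmap c ` (cdom c \<inter> U)" using e by simp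
  qed
  ultimately show "\<exists>T. open T \<and> x \<in> T \<and> T \<subseteq> cmap c ` (cdom c \<inter> U)" by blast
qed

lemma smooth_form_component:
  assumes "smooth_form M m u" "c \<in> atlas M"
  shows "smooth_map_on (cimg c) (\<lambda>x. u c (cinv c x) w)"
  using assms(1)[unfolded smooth_form_def, THEN conjunct2, THEN bspec, THEN spec, OF assms(2)] .

lemma smooth_form_alt:
  assumes "smooth_form M m u" "c \<in> atlas M" "p \<in> cdom c"
  shows "alt_form m (u c p)"
  using assms(1)[unfolded smooth_form_def, THEN conjunct1, unfolded is_dform_def, THEN conjunct1, THEN bspec, THEN bspec, OF assms(2,3)] .

lemma smooth_form_dform: "smooth_form M m u \<Longrightarrow> is_dform M m u"
  by (simp add: smooth_form_def)

text \<open>The derivative of a coefficient function of \<open>u\<close>, as it occurs in \<open>ext_d\<close>.\<close>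

definition coord_derivative :: "('a, 'n) dform \<Rightarrow> ('a, 'n) chart \<Rightarrow> real^'n::_ \<Rightarrow> (nat \<Rightarrow> real^'n::_) \<Rightarrow> real^'n::_ \<Rightarrow> real" where
  "coord_derivative u c x w = frechet_derivative (\<lambda>x. u c (cinv c x) w) (at x within cimg c)"

lemma ext_d_coord: "ext_d m u c p v = (\<Sum>i\<le>m. (-1) ^ i * coord_derivative u c (cmap c p) (omit i v) (v i))"
  by (simp add: ext_d_def coord_derivative_def omit_def)

context
  fixes U m u
  assumes U: "openin T U" "U \<subseteq> interior_of_mfd M" and u: "smooth_form M m u"
begin

lemma coord_derivative_interior:
  assumes c: "c \<in> atlas M" and x: "x \<in> cmap c ` (cdom c \<inter> U)"
  shows "((\<lambda>x. u c (cinv c x) w) has_derivative coord_derivative u c x w) (at x)"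
    and "coord_derivative u c x w = frechet_derivative (\<lambda>x. u c (cinv c x) w) (at x)"
    and "isCont (\<lambda>x. coord_derivative u c x w h) x"
proof -
  let ?f = "\<lambda>x. u c (cinv c x) w" and ?O = "cmap c ` (cdom c \<inter> U)"
  have O: "open ?O" by (rule chart_image_open[OF U c])
  have O_sub: "?O \<subseteq> cimg c" unfolding cimg_def by blast
  have at: "at y within cimg c = at y" if "y \<in> ?O" for y
    by (rule at_within_open_subset[OF that O O_sub])
  obtain V g where V: "open V" "x \<in> V" "\<And>r. Ck_on r V g" "\<And>y. y \<in> cimg c \<inter> V \<Longrightarrow> g y = ?f y"
    using smooth_map_on_extension[OF smooth_form_component[OF u c] subsetD[OF O_sub x]] by metis
  obtain g' where g': "\<And>y. y \<in> V \<Longrightarrow> (g has_derivative g' y) (at y)" "\<And>v. continuous_on V (\<lambda>y. g' y v)"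
    using V(3)[of 1] by auto
  have OV: "open (?O \<inter> V)" using O V by blast
  have der: "(?f has_derivative g' y) (at y)" if "y \<in> ?O \<inter> V" for y
    by (rule has_derivative_transform_within_open[OF g'(1) OV that]) (use that V(4) O_sub in auto)
  have cd: "coord_derivative u c y w = g' y" if "y \<in> ?O \<inter> V" for y
    using frechet_derivative_at[OF der[OF that]] at[of y] that unfolding coord_derivative_def by simp
  have xOV: "x \<in> ?O \<inter> V" using x V by blast
  show "(?f has_derivative coord_derivative u c x w) (at x)" using der[OF xOV] cd[OF xOV] by simp
  show "coord_derivative u c x w = frechet_derivative ?f (at x)"
    unfolding coord_derivative_def at[OF x] ..
  have "isCont (\<lambda>y. g' y h) x" using g'(2) V by (simp add: continuous_on_eq_continuous_at)
  moreover have "\<forall>\<^sub>F y in nhds x. g' y h = coord_derivative u c y w h"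
    unfolding eventually_nhds using OV xOV cd by (intro exI[of _ "?O \<inter> V"]) auto
  ultimately show "isCont (\<lambda>x. coord_derivative u c x w h) x" by (simp cong: isCont_cong)
qed

lemma ext_d_multilinear:
  assumes c: "c \<in> atlas M" and p: "p \<in> cdom c" "p \<in> U"
  shows "multilinear_form (m + 1) (ext_d m u c p)"
proof -
  let ?x = "cmap c p" and ?W = "cmap c ` (cdom c \<inter> U)"
  have x: "?x \<in> ?W" using p by blast
  have W: "open ?W" by (rule chart_image_open[OF U c])
  have lin: "multilinear_form m (u c (cinv c y))" if "y \<in> ?W" for y
    using that c by (auto intro!: alt_form_multilinear smooth_form_alt[OF u])
  note der = coord_derivative_interior(1)[OF c x]
  show ?thesis unfolding multilinear_form_def
  proof (intro conjI allI impI)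
    fix v w :: "nat \<Rightarrow> (real, 'n) vec" assume vw: "\<forall>i<m+1. v i = w i"
    have "coord_derivative u c ?x (omit i v) = coord_derivative u c ?x (omit i w)" for i
    proof -
      have "((\<lambda>x. u c (cinv c x) (omit i w)) has_derivative coord_derivative u c ?x (omit i v)) (at ?x)"
      proof (rule has_derivative_transform_within_open[OF der W x])
        show "u c (cinv c y) (omit i v) = u c (cinv c y) (omit i w)" if "y \<in> ?W" for y
          using vw by (intro multilinear_form_cong[OF lin[OF that]]) (simp add: omit_def)
      qed
      from has_derivative_unique[OF this der] show ?thesis .
    qed
    then show "ext_d m u c p v = ext_d m u c p w" unfolding ext_d_coord using vw by simp
  next
    fix v :: "nat \<Rightarrow> (real, 'n) vec" and r assume r: "r < m + 1"
    have "linear (\<lambda>x. (-1) ^ i * coord_derivative u c ?x (omit i (v(r := x))) ((v(r := x)) i))" if i: "i \<le> m" for i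
    proof (cases "i = r")
      case True
      have "omit i (v(r := x)) = omit i v" for x using True by (auto simp: omit_def fun_eq_iff)
      moreover have "linear (\<lambda>x. (-1) ^ i *\<^sub>R coord_derivative u c ?x (omit i v) x)"
        by (intro linear_compose_scale_right has_derivative_linear[OF der])
      ultimately show ?thesis using True by simp
    next
      case False
      define r' where "r' = (if r < i then r else r - 1)"
      have r': "r' < m" using False r i by (auto simp: r'_def)
      have "omit i (v(r := x)) = (omit i v)(r' := x)" for x
        using False by (auto simp: omit_def fun_eq_iff r'_def)
      moreover have "linear (\<lambda>x. (-1) ^ i *\<^sub>R coord_derivative u c ?x ((omit i v)(r' := x)) (v i))"
        by (intro linear_compose_scale_right frechet_derivative_slot_linear[OF W x lin r' der])
      ultimately show ?thesis using False by simp
    qed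
    then show "linear (\<lambda>x. ext_d m u c p (v(r := x)))"
      unfolding ext_d_coord by (intro linear_compose_sum) auto
  qed
qed

text \<open>\<open>pullback_exterior_derivative\<close> for the transition map, which near the point coincides with a smooth
map on an open set.\<close>

lemma ext_d_change:
  assumes c: "c \<in> atlas M" "p \<in> cdom c" and d: "d \<in> atlas M" "p \<in> cdom d" and p: "p \<in> U"
  shows "ext_d m u c p v = ext_d m u d p (\<lambda>i. jac c d p *v v i)"
proof -
  let ?\<phi> = "cmap d \<circ> cinv c"
  let ?S = "cmap c ` (cdom c \<inter> cdom d)" and ?O = "cmap c ` (cdom c \<inter> (cdom d \<inter> U))"
  let ?W' = "cmap d ` (cdom d \<inter> U)" and ?x = "cmap c p"
  have UD: "openin T (cdom d \<inter> U)" using cdom_open[OF d(1)] U(1) by (rule openin_Int)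
  have O: "open ?O" using U(2) by (intro chart_image_open[OF UD _ c(1)]) blast
  have xO: "?x \<in> ?O" using c d p by blast
  have OS: "?O \<subseteq> ?S" by blast
  have W': "open ?W'" by (rule chart_image_open[OF U d(1)])
  obtain V h where V: "open V" "?x \<in> V" "\<And>r. Ck_on r V h" "\<And>y. y \<in> ?S \<inter> V \<Longrightarrow> h y = ?\<phi> y"
    using smooth_map_on_extension[OF smooth_transition[OF c(1) d(1)] subsetD[OF OS xO]] by metis
  obtain h' h'' where h: "\<And>x. x \<in> V \<Longrightarrow> (h has_derivative h' x) (at x)"
    "\<And>v x. x \<in> V \<Longrightarrow> ((\<lambda>x. h' x v) has_derivative h'' v x) (at x)"
    "\<And>x v w. x \<in> V \<Longrightarrow> h'' v x w = h'' w x v"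
    using Ck_on_2_symmetric[OF V(1) V(3)] by metis
  define W where "W = ?O \<inter> V"
  have W: "open W" "?x \<in> W" using O V xO by (auto simp: W_def)
  have \<phi>h: "?\<phi> y = h y" if "y \<in> W" for y
  proof -
    have "y \<in> ?O" "y \<in> V" using that by (simp_all only: W_def Int_iff)
    then show ?thesis using V(4)[OF IntI[OF subsetD[OF OS]]] by simp
  qed
  have \<phi>': "(?\<phi> has_derivative h' y) (at y)" if "y \<in> W" for y
    by (rule has_derivative_transform_within_open[OF h(1) W(1) that]) (use that \<phi>h in \<open>auto simp: W_def\<close>)
  have in_W: "\<exists>q. q \<in> cdom c \<and> q \<in> cdom d \<and> q \<in> U \<and> y = cmap c q" if "y \<in> W" for y
    using that unfolding W_def by (elim IntE imageE) blast
  have jac: "h' (cmap c q) = (*v) (jac c d q)" if q: "q \<in> cdom c" "q \<in> cdom d" "q \<in> U" "cmap c q \<in> W" for q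
  proof -
    have "cmap c q \<in> ?O" using q by blast
    then have "at (cmap c q) within ?S = at (cmap c q)" by (rule at_within_open_subset[OF _ O OS])
    then have "(?\<phi> has_derivative (\<lambda>h. jac c d q *v h)) (at (cmap c q))"
      using transition_derivative[OF c(1) d(1), of q] q by simp
    from has_derivative_unique[OF \<phi>'[OF q(4)] this] show ?thesis .
  qed
  let ?a = "\<lambda>y. u d (cinv d y)" and ?b = "\<lambda>x. u c (cinv c x)"
  have \<phi>x: "?\<phi> ?x = cmap d p" using c by simp
  have dx: "cmap d p \<in> ?W'" using d p by blast
  have cx: "?x \<in> cmap c ` (cdom c \<inter> U)" using c p by blast
  have "(\<Sum>i\<le>m. (-1) ^ i * frechet_derivative (\<lambda>x. ?b x (omit i v)) (at ?x) (v i)) =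
    (\<Sum>i\<le>m. (-1) ^ i * frechet_derivative (\<lambda>y. ?a y (omit i (\<lambda>j. h' ?x (v j)))) (at (?\<phi> ?x)) (h' ?x (v i)))"
  proof (rule pullback_exterior_derivative[OF W W'])
    show "?\<phi> ?x \<in> ?W'" using dx \<phi>x by simp
    show "?\<phi> y \<in> ?W'" if y: "y \<in> W" for y
    proof -
      obtain q where "q \<in> cdom c" "q \<in> cdom d" "q \<in> U" "y = cmap c q" using in_W[OF y] by blast
      then show ?thesis using c by simp
    qed
    show "(?\<phi> has_derivative h' ?x) (at ?x)" by (rule \<phi>'[OF W(2)])
    show "((\<lambda>x. h' x v) has_derivative h'' v ?x) (at ?x)" for v by (rule h(2)[OF V(2)])
    show "h'' v ?x w = h'' w ?x v" for v w by (rule h(3)[OF V(2)])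
    show "alt_form m (?a y)" if y: "y \<in> ?W'" for y
    proof -
      obtain q where "q \<in> cdom d" "y = cmap d q" using y by blast
      then show ?thesis using d(1) smooth_form_alt[OF u d(1)] by simp
    qed
    show "((\<lambda>y. ?a y w) has_derivative coord_derivative u d (cmap d p) w) (at (?\<phi> ?x))" for w
      unfolding \<phi>x by (rule coord_derivative_interior(1)[OF d(1) dx])
    show "?b x w = ?a (?\<phi> x) (\<lambda>i. h' x (w i))" if x: "x \<in> W" for x w
    proof -
      obtain q where q: "q \<in> cdom c" "q \<in> cdom d" "q \<in> U" "x = cmap c q" using in_W[OF x] by blast
      have "u c q w = u d q (\<lambda>i. jac c d q *v w i)"
        by (rule mform_onD(2)[OF is_dform_mform_on[OF smooth_form_dform[OF u]] c(1) q(1) UNIV_I d(1) q(2)])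
      then show ?thesis using q c(1) d(1) jac[of q] x by simp
    qed
  qed
  then show ?thesis
    unfolding ext_d_coord coord_derivative_interior(2)[OF c(1) cx] coord_derivative_interior(2)[OF d(1) dx]
    using jac[of p] c d p W(2) \<phi>x by simp
qed

lemma support_closed: "closedin T (form_support M u)"
  unfolding form_support_def by simp

lemma zero_off_support:
  assumes c: "c \<in> atlas M" and p: "p \<in> cdom c" "p \<notin> form_support M u"
  shows "u c p = (\<lambda>v. 0)"
proof (rule ccontr)
  assume "u c p \<noteq> (\<lambda>v. 0)"
  then have "p \<in> {p. \<exists>c\<in>atlas M. p \<in> cdom c \<and> (\<exists>v. u c p v \<noteq> 0)}" using c p by (auto simp: fun_eq_iff)
  moreover have "{p. \<exists>c\<in>atlas M. p \<in> cdom c \<and> (\<exists>v. u c p v \<noteq> 0)} \<subseteq> topspace T"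
    using cdom_sub by blast
  ultimately show False using p(2) closure_of_subset unfolding form_support_def by blast
qed

context
  assumes K: "compactin T (form_support M u)" "form_support M u \<subseteq> U"
begin

lemma test_form_smooth: "test_form U (form_support M u) m u"
  unfolding test_form_def
proof (intro conjI ballI allI K)
  show "mform_on U m u" by (rule is_dform_mform_on[OF smooth_form_dform[OF u]])
  show "continuous_map (subtopology T (cdom c \<inter> U)) euclideanreal (\<lambda>p. u c p v)" if c: "c \<in> atlas M" for c v
    using chart_continuous_pullback[OF c smooth_map_on_continuous[OF smooth_form_component[OF u c]]]
    by (rule continuous_map_from_subtopology_mono) blast
  show "u c p = (\<lambda>v. 0)" if "c \<in> atlas M" "p \<in> cdom c \<inter> U - form_support M u" for c p
    using zero_off_support that by blast
qed

lemma test_form_ext_d: "test_form U (form_support M u) (m + 1) (ext_d m u)"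
  unfolding test_form_def
proof (intro conjI ballI allI K)
  show "mform_on U (m + 1) (ext_d m u)" unfolding mform_on_def
  proof (intro conjI ballI allI)
    show "multilinear_form (m + 1) (ext_d m u c p)" if "c \<in> atlas M" "p \<in> cdom c \<inter> U" for c p
      by (rule ext_d_multilinear) (use that in simp_all)
    show "ext_d m u c p v = ext_d m u d p (\<lambda>i. jac c d p *v v i)"
      if "c \<in> atlas M" "d \<in> atlas M" "p \<in> cdom c \<inter> cdom d \<inter> U" for c d p v
      by (rule ext_d_change) (use that in simp_all)
  qed
  show "continuous_map (subtopology T (cdom c \<inter> U)) euclideanreal (\<lambda>p. ext_d m u c p v)" if c: "c \<in> atlas M" for c v
  proof -
    let ?O = "cmap c ` (cdom c \<inter> U)"
    have cont: "continuous_on ?O (\<lambda>x. \<Sum>i\<le>m. (-1) ^ i * coord_derivative u c x (omit i v) (v i))"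
      by (intro continuous_intros continuous_at_imp_continuous_on ballI coord_derivative_interior(3)[OF c])
    have "continuous_map (subtopology T (cdom c \<inter> U)) (top_of_set (cimg c)) (cmap c)"
      by (rule continuous_map_from_subtopology_mono[OF cmap_homeo(1)[OF c]]) blast
    then have "continuous_map (subtopology T (cdom c \<inter> U)) euclidean (cmap c)"
      by (rule continuous_map_into_fulltopology)
    then have "continuous_map (subtopology T (cdom c \<inter> U)) (top_of_set ?O) (cmap c)"
      by (auto simp: continuous_map_in_subtopology)
    from continuous_map_compose[OF this, of euclideanreal "\<lambda>x. \<Sum>i\<le>m. (-1) ^ i * coord_derivative u c x (omit i v) (v i)"]
    show ?thesis using cont by (simp add: comp_def ext_d_coord)
  qed
  show "ext_d m u c p = (\<lambda>v. 0)" if c: "c \<in> atlas M" and p: "p \<in> cdom c \<inter> U - form_support M u" for c p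
  proof -
    let ?N = "U \<inter> (topspace T - form_support M u)"
    have "openin T ?N" using U(1) support_closed by (intro openin_Int) (auto simp: closedin_def)
    then have O: "open (cmap c ` (cdom c \<inter> ?N))" using U(2) by (intro chart_image_open[OF _ _ c]) auto
    have x: "cmap c p \<in> cmap c ` (cdom c \<inter> ?N)" using p cdom_sub[OF c] by blast
    have xU: "cmap c p \<in> cmap c ` (cdom c \<inter> U)" using p by blast
    have "coord_derivative u c (cmap c p) w = (\<lambda>h. 0)" for w
    proof -
      have "((\<lambda>x. u c (cinv c x) w) has_derivative (\<lambda>h. 0)) (at (cmap c p))"
      proof (rule has_derivative_transform_within_open[OF has_derivative_const[of 0] O x])
        show "0 = u c (cinv c y) w" if "y \<in> cmap c ` (cdom c \<inter> ?N)" for y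
          using that zero_off_support[OF c] c by auto
      qed
      from has_derivative_unique[OF coord_derivative_interior(1)[OF c xU] this] show ?thesis .
    qed
    then show ?thesis by (simp add: fun_eq_iff ext_d_coord)
  qed
qed

end
end
end

section \<open>Orlicz spaces of forms\<close>

lemma diff_form_eq: "diff_form \<omega> \<eta> = \<omega> - \<eta>"
  by (simp add: diff_form_def fun_eq_iff)

lemma scale_form_eq: "scale_form a \<omega> = a *\<^sub>R \<omega>"
  by (simp add: scale_form_def scaleR_fun_def fun_eq_iff)

lemma zero_form_eq: "zero_form = 0"
  by (simp add: zero_form_def fun_eq_iff)

lemma alt_form_add: "alt_form k f \<Longrightarrow> alt_form k g \<Longrightarrow> alt_form k (\<lambda>v. f v + g v)"
proof -
  assume f: "alt_form k f" and g: "alt_form k g"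
  have z: "f v + g v = 0" if "i < j \<and> j < k \<and> v i = v j" for v i j
  proof -
    have "f v = 0" "g v = 0"
      using f[unfolded alt_form_def, THEN conjunct2, THEN conjunct2, rule_format, OF that]
        g[unfolded alt_form_def, THEN conjunct2, THEN conjunct2, rule_format, OF that] by simp_all
    then show ?thesis by simp
  qed
  note m = multilinear_form_add[OF alt_form_multilinear[OF f] alt_form_multilinear[OF g], unfolded multilinear_form_def]
  show ?thesis unfolding alt_form_def
    by (intro conjI m[THEN conjunct1] m[THEN conjunct2]) (intro allI impI, rule z)
qed

lemma alt_form_scale: "alt_form k f \<Longrightarrow> alt_form k (\<lambda>v. a * f v)"
proof -
  assume f: "alt_form k f"
  note f' = f[unfolded alt_form_def]
  show ?thesis unfolding alt_form_def
  proof (intro conjI allI impI)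
    show "a * f v = a * f w" if "\<forall>i<k. v i = w i" for v w
      using f'[THEN conjunct1, rule_format, of v w] that by simp
    show "linear (\<lambda>x. a * f (v(i := x)))" if "i < k" for v i
      using linear_compose_scale_right[OF f'[THEN conjunct2, THEN conjunct1, rule_format, OF that], of a] by simp
    show "a * f v = 0" if "i < j \<and> j < k \<and> v i = v j" for v i j
      using f'[THEN conjunct2, THEN conjunct2, rule_format, OF that] by simp
  qed
qed

lemma alt_form_suminf:
  assumes f: "\<And>j. alt_form k (f j)" and sm: "\<And>v. summable (\<lambda>j. f j v)"
  shows "alt_form k (\<lambda>v. \<Sum>j. f j v)"
  unfolding alt_form_def
proof (intro conjI allI impI)
  show "(\<Sum>j. f j v) = (\<Sum>j. f j w)" if "\<forall>i<k. v i = w i" for v w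
    using that f by (intro suminf_cong) (simp add: alt_form_def)
  show "(\<Sum>j. f j v) = 0" if h: "i < l \<and> l < k \<and> v i = v l" for v i l
  proof -
    have "f j v = 0" for j using f[of j] h unfolding alt_form_def by blast
    then show ?thesis by simp
  qed
  show "linear (\<lambda>x. \<Sum>j. f j (v(i := x)))" if "i < k" for v i
  proof (rule linearI)
    have lin: "linear (\<lambda>x. f j (v(i := x)))" for j using f[of j] that by (simp add: alt_form_def)
    show "(\<Sum>j. f j (v(i := x + y))) = (\<Sum>j. f j (v(i := x))) + (\<Sum>j. f j (v(i := y)))" for x y
      using suminf_add[OF sm sm, of "v(i := x)" "v(i := y)"] linear_add[OF lin] by simp
    show "(\<Sum>j. f j (v(i := r *\<^sub>R x))) = r *\<^sub>R (\<Sum>j. f j (v(i := x)))" for r x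
      using suminf_mult[OF sm[of "v(i := x)"], of r] linear_cmul[OF lin] by simp
  qed
qed

context riem_manifold
begin

lemma is_dform_alt: "is_dform M k \<omega> \<Longrightarrow> c \<in> atlas M \<Longrightarrow> p \<in> cdom c \<Longrightarrow> alt_form k (\<omega> c p)"
  unfolding is_dform_def by (drule conjunct1, drule (1) bspec, drule (1) bspec)

lemma is_dform_change:
  "is_dform M k \<omega> \<Longrightarrow> c \<in> atlas M \<Longrightarrow> d \<in> atlas M \<Longrightarrow> p \<in> cdom c \<inter> cdom d \<Longrightarrow>
    \<omega> c p v = \<omega> d p (\<lambda>i. jac c d p *v v i)"
  unfolding is_dform_def by (drule conjunct2, drule (1) bspec, drule (1) bspec, drule (1) bspec, erule spec)

lemma measurable_formD:
  assumes "measurable_form M k \<omega>"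
  shows "is_dform M k \<omega>" "c \<in> atlas M \<Longrightarrow> (\<lambda>p. \<omega> c p v) \<in> borel_measurable (restrict_space vol (cdom c))"
  using assms by (simp_all add: measurable_form_def)

lemma measurable_formI:
  assumes "\<And>c p. c \<in> atlas M \<Longrightarrow> p \<in> cdom c \<Longrightarrow> alt_form k (\<omega> c p)"
    and "\<And>c d p v. c \<in> atlas M \<Longrightarrow> d \<in> atlas M \<Longrightarrow> p \<in> cdom c \<inter> cdom d \<Longrightarrow> \<omega> c p v = \<omega> d p (\<lambda>i. jac c d p *v v i)"
    and "\<And>c v. c \<in> atlas M \<Longrightarrow> (\<lambda>p. \<omega> c p v) \<in> borel_measurable (restrict_space vol (cdom c))"
  shows "measurable_form M k \<omega>"
  unfolding measurable_form_def is_dform_def by (intro conjI ballI allI assms)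

lemma measurable_form_subspace: "subspace {\<omega>. measurable_form M k \<omega>}"
proof (rule subspaceI; unfold mem_Collect_eq)
  show "measurable_form M k 0"
    by (rule measurable_formI) (simp_all add: alt_form_def linear_zero)
next
  fix \<omega> \<eta> assume \<omega>: "measurable_form M k \<omega>" and \<eta>: "measurable_form M k \<eta>"
  note D = measurable_formD[OF \<omega>] measurable_formD[OF \<eta>]
  show "measurable_form M k (\<omega> + \<eta>)"
  proof (rule measurable_formI)
    show "alt_form k ((\<omega> + \<eta>) c p)" if "c \<in> atlas M" "p \<in> cdom c" for c p
      using alt_form_add[OF is_dform_alt[OF D(1) that] is_dform_alt[OF D(3) that]] by (simp add: plus_fun_def)
    show "(\<omega> + \<eta>) c p v = (\<omega> + \<eta>) d p (\<lambda>i. jac c d p *v v i)"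
      if "c \<in> atlas M" "d \<in> atlas M" "p \<in> cdom c \<inter> cdom d" for c d p v
      using is_dform_change[OF D(1) that] is_dform_change[OF D(3) that] by simp
    show "(\<lambda>p. (\<omega> + \<eta>) c p v) \<in> borel_measurable (restrict_space vol (cdom c))" if "c \<in> atlas M" for c v
      using borel_measurable_add[OF D(2)[OF that] D(4)[OF that]] by simp
  qed
next
  fix a :: real and \<omega> assume \<omega>: "measurable_form M k \<omega>"
  note D = measurable_formD[OF \<omega>]
  show "measurable_form M k (a *\<^sub>R \<omega>)"
  proof (rule measurable_formI)
    show "alt_form k ((a *\<^sub>R \<omega>) c p)" if "c \<in> atlas M" "p \<in> cdom c" for c p
      using alt_form_scale[OF is_dform_alt[OF D(1) that]] by (simp add: scaleR_fun_def)
    show "(a *\<^sub>R \<omega>) c p v = (a *\<^sub>R \<omega>) d p (\<lambda>i. jac c d p *v v i)"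
      if "c \<in> atlas M" "d \<in> atlas M" "p \<in> cdom c \<inter> cdom d" for c d p v
      using is_dform_change[OF D(1) that] by (simp add: scaleR_fun_def)
    show "(\<lambda>p. (a *\<^sub>R \<omega>) c p v) \<in> borel_measurable (restrict_space vol (cdom c))" if "c \<in> atlas M" for c v
      using borel_measurable_times[OF borel_measurable_const D(2)[OF that]] by (simp add: scaleR_fun_def)
  qed
qed

lemma pt_norm_scaleR: "pt_norm M k (a *\<^sub>R \<omega>) p = \<bar>a\<bar> * pt_norm M k \<omega> p"
  unfolding pt_norm_chart_at using form_norm_scale[of _ k a] by (simp add: scaleR_fun_def)

lemma pt_norm_pos:
  assumes "measurable_form M k \<omega>" "p \<in> topspace T" shows "0 \<le> pt_norm M k \<omega> p"
  using pt_norm_nonneg[OF is_dform_mform_on[OF measurable_formD(1)[OF assms(1)], of UNIV] _ assms(2)] by simp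

lemma pt_norm_triangle:
  assumes \<omega>: "measurable_form M k \<omega>" and \<eta>: "measurable_form M k \<eta>" and p: "p \<in> topspace T"
  shows "pt_norm M k (\<omega> + \<eta>) p \<le> pt_norm M k \<omega> p + pt_norm M k \<eta> p"
proof -
  have c: "chart_at M p \<in> atlas M" "p \<in> cdom (chart_at M p)" using chart_at[OF p] by auto
  show ?thesis
    unfolding pt_norm_chart_at
    using form_norm_triangle[OF metric_posdef[OF c] alt_form_multilinear[OF is_dform_alt[OF measurable_formD(1)[OF \<omega>] c]]
        alt_form_multilinear[OF is_dform_alt[OF measurable_formD(1)[OF \<eta>] c]]]
    by (simp add: plus_fun_def)
qed

end

locale orlicz_manifold = riem_manifold M for M :: "('a, 'n::{finite,wellorder}) riem" +
  fixes \<Phi> :: "real \<Rightarrow> real"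
  assumes N_function: "N_function \<Phi>"
begin

lemma \<Phi>_nonneg: "0 \<le> \<Phi> x" and \<Phi>_convex: "convex_on UNIV \<Phi>" and \<Phi>_0 [simp]: "\<Phi> 0 = 0"
  using N_function by (auto simp: N_function_def)

lemma \<Phi>_continuous: "continuous_on UNIV \<Phi>"
  by (rule convex_on_continuous[OF open_UNIV \<Phi>_convex])

lemma \<Phi>_measurable [measurable]: "\<Phi> \<in> borel_measurable borel"
  by (rule borel_measurable_continuous_onI[OF \<Phi>_continuous])

lemma \<Phi>_contract: "0 \<le> t \<Longrightarrow> t \<le> 1 \<Longrightarrow> \<Phi> (t * x) \<le> t * \<Phi> x"
  using convex_onD[OF \<Phi>_convex, of t 0 x] by simp

lemma \<Phi>_mono: assumes "0 \<le> x" "x \<le> y" shows "\<Phi> x \<le> \<Phi> y"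
proof (cases "y = 0")
  case False
  then have y: "y > 0" using assms by simp
  have "\<Phi> (x / y * y) \<le> x / y * \<Phi> y" using assms y by (intro \<Phi>_contract) auto
  also have "\<dots> \<le> 1 * \<Phi> y" using assms y by (intro mult_right_mono \<Phi>_nonneg) auto
  finally show ?thesis using y by simp
qed (use assms in simp)

text \<open>Superlinear growth makes the Orlicz norm stronger than the \<open>L\<close>-one norm on sets of finite measure.\<close>

lemma \<Phi>_superlinear: "\<exists>R\<ge>0. \<forall>x\<ge>0. x \<le> R + \<Phi> x"
proof -
  have "filterlim (\<lambda>x. \<Phi> x / x) at_top at_top" using N_function by (simp add: N_function_def)
  then have "eventually (\<lambda>x. 1 \<le> \<Phi> x / x) at_top" by (simp add: filterlim_at_top)
  then obtain b where b: "\<And>x. x \<ge> b \<Longrightarrow> 1 \<le> \<Phi> x / x" by (auto simp: eventually_at_top_linorder)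
  have "x \<le> max b 1 + \<Phi> x" if "x \<ge> 0" for x
  proof (cases "x \<ge> max b 1")
    case True
    then have "1 \<le> \<Phi> x / x" "x > 0" using b[of x] by auto
    then have "x \<le> \<Phi> x" by (simp add: field_simps)
    then show ?thesis by (simp add: max_def)
  qed (use \<Phi>_nonneg[of x] in linarith)
  then show ?thesis by (intro exI[of _ "max b 1"]) auto
qed

abbreviation L where "L k \<equiv> L_space M \<Phi> k"
abbreviation gauge where "gauge k \<equiv> gauge_norm M \<Phi> k"

text \<open>\<open>K\<close> is admissible in the infimum that defines the gauge norm.\<close>

definition unit_modular :: "nat \<Rightarrow> ('a, 'n) dform \<Rightarrow> real \<Rightarrow> bool" where
  "unit_modular k \<omega> K \<longleftrightarrow> 0 < K \<and> (\<integral>\<^sup>+p. ennreal (\<Phi> (pt_norm M k \<omega> p / K)) \<partial>vol) \<le> 1"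

lemma modular_scale:
  "0 < a \<Longrightarrow> modular M \<Phi> k (scale_form a \<omega>) = (\<integral>\<^sup>+p. ennreal (\<Phi> (a * pt_norm M k \<omega> p)) \<partial>vol)"
  by (simp add: modular_def scale_form_eq pt_norm_scaleR)

lemma gauge_eq: "gauge k \<omega> = Inf {K. unit_modular k \<omega> K}"
proof -
  have "0 < K \<and> modular M \<Phi> k (scale_form (1 / K) \<omega>) \<le> 1 \<longleftrightarrow> unit_modular k \<omega> K" for K
    using modular_scale[of "1 / K" k \<omega>] by (auto simp: unit_modular_def)
  then show ?thesis by (simp add: gauge_norm_def)
qed

lemma L_D: "\<omega> \<in> L k \<Longrightarrow> measurable_form M k \<omega>"
  by (simp add: L_space_def)

lemma L_I: assumes "measurable_form M k \<omega>" "unit_modular k \<omega> K" shows "\<omega> \<in> L k"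
proof -
  have "0 < 1 / K" "modular M \<Phi> k (scale_form (1 / K) \<omega>) < \<infinity>"
    using assms(2) modular_scale[of "1 / K" k \<omega>] by (auto simp: unit_modular_def intro: le_less_trans)
  with assms(1) show ?thesis unfolding L_space_def by blast
qed

lemma unit_modular_mono:
  assumes \<omega>: "measurable_form M k \<omega>" and K: "unit_modular k \<omega> K" and K': "K \<le> K'"
  shows "unit_modular k \<omega> K'"
proof -
  have K0: "K > 0" using K by (simp add: unit_modular_def)
  have "(\<integral>\<^sup>+p. ennreal (\<Phi> (pt_norm M k \<omega> p / K')) \<partial>vol) \<le> (\<integral>\<^sup>+p. ennreal (\<Phi> (pt_norm M k \<omega> p / K)) \<partial>vol)"
    using pt_norm_pos[OF \<omega>] K0 K'
    by (intro nn_integral_mono ennreal_leI \<Phi>_mono) (auto intro!: divide_left_mono divide_nonneg_pos)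
  then show ?thesis using K K' K0 by (auto simp: unit_modular_def)
qed

text \<open>By convexity \<open>\<Phi> (t x) \<le> t \<Phi> x\<close>, so a finite modular is brought below \<open>1\<close> by shrinking the form.\<close>

lemma unit_modular_exists:
  assumes "\<omega> \<in> L k" shows "\<exists>K. unit_modular k \<omega> K"
proof -
  obtain a where a: "a > 0" "modular M \<Phi> k (scale_form a \<omega>) < \<infinity>"
    using assms unfolding L_space_def by blast
  then have "(\<integral>\<^sup>+p. ennreal (\<Phi> (a * pt_norm M k \<omega> p)) \<partial>vol) < \<infinity>"
    using modular_scale[OF a(1), of k \<omega>] by simp
  then obtain r where r: "(\<integral>\<^sup>+p. ennreal (\<Phi> (a * pt_norm M k \<omega> p)) \<partial>vol) = ennreal r" "r \<ge> 0"
    by (cases "\<integral>\<^sup>+p. ennreal (\<Phi> (a * pt_norm M k \<omega> p)) \<partial>vol" rule: ennreal_cases) auto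
  \<comment> \<open>The factor by which a modular \<open>r\<close> has to shrink; adding 1 covers \<open>r = 0\<close>.\<close>
  define t where "t = 1 / (1 + r)"
  have t: "0 < t" "t \<le> 1" using r by (auto simp: t_def)
  have meas: "(\<lambda>p. ennreal (\<Phi> (a * pt_norm M k \<omega> p))) \<in> borel_measurable vol"
    using pt_norm_measurable[OF L_D[OF assms]] by measurable
  have "(\<integral>\<^sup>+p. ennreal (\<Phi> (pt_norm M k \<omega> p / (1 / (a * t)))) \<partial>vol)
      \<le> (\<integral>\<^sup>+p. ennreal t * ennreal (\<Phi> (a * pt_norm M k \<omega> p)) \<partial>vol)"
    using \<Phi>_contract[of t "a * pt_norm M k \<omega> _"] t \<Phi>_nonneg
    by (intro nn_integral_mono) (auto simp: ennreal_mult[symmetric] mult_ac intro!: ennreal_leI)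
  also have "\<dots> = ennreal t * ennreal r"
    using nn_integral_cmult[OF meas] r(1) by simp
  also have "\<dots> \<le> 1" using r t by (simp add: ennreal_mult[symmetric] t_def)
  finally show ?thesis using a t unfolding unit_modular_def by (intro exI[of _ "1 / (a * t)"]) simp
qed

lemma gauge_le: "unit_modular k \<omega> K \<Longrightarrow> gauge k \<omega> \<le> K"
  unfolding gauge_eq by (rule cInf_lower) (auto simp: unit_modular_def intro!: bdd_belowI[of _ 0])

lemma gauge_nonneg: "\<omega> \<in> L k \<Longrightarrow> 0 \<le> gauge k \<omega>"
  unfolding gauge_eq using unit_modular_exists by (intro cInf_greatest) (auto simp: unit_modular_def)

lemma gauge_less:
  assumes "\<omega> \<in> L k" "gauge k \<omega> < K" shows "unit_modular k \<omega> K"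
proof -
  obtain K' where "unit_modular k \<omega> K'" "K' < K"
    using cInf_lessD[of "{K. unit_modular k \<omega> K}" K] unit_modular_exists[OF assms(1)] assms(2) by (auto simp: gauge_eq)
  then show ?thesis using unit_modular_mono[OF L_D[OF assms(1)]] by simp
qed

text \<open>Convexity, with weights proportional to \<open>K\<close> and \<open>K'\<close>.\<close>

lemma unit_modular_add:
  assumes \<omega>: "measurable_form M k \<omega>" "unit_modular k \<omega> K" and \<eta>: "measurable_form M k \<eta>" "unit_modular k \<eta> K'"
  shows "unit_modular k (\<omega> + \<eta>) (K + K')"
proof -
  have K: "K > 0" "K' > 0" using assms by (auto simp: unit_modular_def)
  have sum: "measurable_form M k (\<omega> + \<eta>)" using subspace_add[OF measurable_form_subspace] \<omega>(1) \<eta>(1) by blast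
  define t where "t = K / (K + K')"
  have t: "0 \<le> t" "0 \<le> 1 - t" "t / K = 1 / (K + K')" "(1 - t) / K' = 1 / (K + K')"
  proof -
    have "1 - t = K' / (K + K')" using K add_pos_pos[OF K] by (simp add: t_def field_simps)
    then show "0 \<le> t" "0 \<le> 1 - t" "t / K = 1 / (K + K')" "(1 - t) / K' = 1 / (K + K')" using K by (auto simp: t_def)
  qed
  have pw: "\<Phi> (pt_norm M k (\<omega> + \<eta>) p / (K + K')) \<le> t * \<Phi> (pt_norm M k \<omega> p / K) + (1 - t) * \<Phi> (pt_norm M k \<eta> p / K')"
    if p: "p \<in> topspace T" for p
  proof -
    have "pt_norm M k (\<omega> + \<eta>) p / (K + K') \<le> (pt_norm M k \<omega> p + pt_norm M k \<eta> p) / (K + K')"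
      using pt_norm_triangle[OF \<omega>(1) \<eta>(1) p] K by (intro divide_right_mono) auto
    also have "\<dots> = pt_norm M k \<omega> p * (t / K) + pt_norm M k \<eta> p * ((1 - t) / K')"
      unfolding t by (simp add: add_divide_distrib)
    finally have "\<Phi> (pt_norm M k (\<omega> + \<eta>) p / (K + K')) \<le> \<Phi> (t * (pt_norm M k \<omega> p / K) + (1 - t) * (pt_norm M k \<eta> p / K'))"
      using pt_norm_pos[OF sum p] K by (intro \<Phi>_mono) (auto simp: mult_ac)
    also have "\<dots> \<le> t * \<Phi> (pt_norm M k \<omega> p / K) + (1 - t) * \<Phi> (pt_norm M k \<eta> p / K')"
      using convex_onD[OF \<Phi>_convex, of "1 - t" "pt_norm M k \<omega> p / K" "pt_norm M k \<eta> p / K'"] t by simp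
    finally show ?thesis .
  qed
  have m: "(\<lambda>p. ennreal (\<Phi> (pt_norm M k \<omega> p / K))) \<in> borel_measurable vol"
      "(\<lambda>p. ennreal (\<Phi> (pt_norm M k \<eta> p / K'))) \<in> borel_measurable vol"
    using pt_norm_measurable[OF \<omega>(1)] pt_norm_measurable[OF \<eta>(1)] by measurable
  have "(\<integral>\<^sup>+p. ennreal (\<Phi> (pt_norm M k (\<omega> + \<eta>) p / (K + K'))) \<partial>vol)
     \<le> (\<integral>\<^sup>+p. ennreal t * ennreal (\<Phi> (pt_norm M k \<omega> p / K)) + ennreal (1 - t) * ennreal (\<Phi> (pt_norm M k \<eta> p / K')) \<partial>vol)"
    using pw t \<Phi>_nonneg
    by (intro nn_integral_mono) (simp add: ennreal_mult[symmetric] ennreal_plus[symmetric] ennreal_leI del: ennreal_plus)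
  also have "\<dots> = ennreal t * (\<integral>\<^sup>+p. ennreal (\<Phi> (pt_norm M k \<omega> p / K)) \<partial>vol)
       + ennreal (1 - t) * (\<integral>\<^sup>+p. ennreal (\<Phi> (pt_norm M k \<eta> p / K')) \<partial>vol)"
    using m by (subst nn_integral_add) (auto simp: nn_integral_cmult)
  also have "\<dots> \<le> ennreal t * 1 + ennreal (1 - t) * 1"
    using \<omega>(2) \<eta>(2) by (intro add_mono mult_left_mono) (auto simp: unit_modular_def)
  also have "\<dots> = 1" using t by (simp add: ennreal_plus[symmetric] del: ennreal_plus)
  finally show ?thesis using K by (simp add: unit_modular_def)
qed

lemma unit_modular_scaleR:
  assumes "unit_modular k \<omega> K" "a \<noteq> 0" shows "unit_modular k (a *\<^sub>R \<omega>) (\<bar>a\<bar> * K)"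
  using assms by (simp add: unit_modular_def pt_norm_scaleR)

lemma unit_modular_zero: "K > 0 \<Longrightarrow> unit_modular k 0 K"
  using pt_norm_scaleR[of k 0 0] by (simp add: unit_modular_def)

lemma L_subspace: "subspace (L k)"
proof (rule subspaceI)
  note S = measurable_form_subspace[of k]
  show "0 \<in> L k" using L_I[OF _ unit_modular_zero[of 1]] subspace_0[OF S] by simp
  show "\<omega> + \<eta> \<in> L k" if L: "\<omega> \<in> L k" "\<eta> \<in> L k" for \<omega> \<eta>
  proof -
    obtain K K' where "unit_modular k \<omega> K" "unit_modular k \<eta> K'"
      using unit_modular_exists[OF L(1)] unit_modular_exists[OF L(2)] by blast
    then show ?thesis using L_I unit_modular_add L_D[OF L(1)] L_D[OF L(2)] subspace_add[OF S] by blast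
  qed
  show "a *\<^sub>R \<omega> \<in> L k" if L: "\<omega> \<in> L k" for a \<omega>
  proof (cases "a = 0")
    case True
    then show ?thesis using L_I[OF _ unit_modular_zero[of 1]] subspace_0[OF S] by simp
  next
    case False
    obtain K where "unit_modular k \<omega> K" using unit_modular_exists[OF L] by blast
    then show ?thesis using L_I unit_modular_scaleR[OF _ False] L_D[OF L] subspace_scale[OF S] by blast
  qed
qed

lemma gauge_zero: "gauge k 0 = 0"
proof (rule antisym)
  show "gauge k 0 \<le> 0" by (rule field_le_epsilon) (simp add: gauge_le unit_modular_zero)
  show "0 \<le> gauge k 0" by (rule gauge_nonneg[OF subspace_0[OF L_subspace]])
qed

sublocale L: seminormed "L k" "gauge k" for k
proof
  show "subspace (L k)" by (rule L_subspace)
  show "0 \<le> gauge k \<omega>" if "\<omega> \<in> L k" for \<omega> using gauge_nonneg[OF that] .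
  show "gauge k (\<omega> + \<eta>) \<le> gauge k \<omega> + gauge k \<eta>" if "\<omega> \<in> L k" "\<eta> \<in> L k" for \<omega> \<eta>
  proof (rule field_le_epsilon)
    fix e :: real assume e: "e > 0"
    have "gauge k (\<omega> + \<eta>) \<le> (gauge k \<omega> + e / 2) + (gauge k \<eta> + e / 2)"
      using e that by (intro gauge_le unit_modular_add gauge_less L_D) auto
    then show "gauge k (\<omega> + \<eta>) \<le> gauge k \<omega> + gauge k \<eta> + e" by simp
  qed
  have le: "gauge k (a *\<^sub>R \<omega>) \<le> \<bar>a\<bar> * gauge k \<omega>" if "\<omega> \<in> L k" "a \<noteq> 0" for a \<omega>
  proof (rule field_le_epsilon)
    fix e :: real assume e: "e > 0"
    have "gauge k (a *\<^sub>R \<omega>) \<le> \<bar>a\<bar> * (gauge k \<omega> + e / \<bar>a\<bar>)"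
      using e that by (intro gauge_le unit_modular_scaleR gauge_less) auto
    then show "gauge k (a *\<^sub>R \<omega>) \<le> \<bar>a\<bar> * gauge k \<omega> + e" using that by (simp add: distrib_left)
  qed
  show "gauge k (a *\<^sub>R \<omega>) = \<bar>a\<bar> * gauge k \<omega>" if "\<omega> \<in> L k" for a \<omega>
  proof (cases "a = 0")
    case False
    have "gauge k ((1 / a) *\<^sub>R (a *\<^sub>R \<omega>)) \<le> \<bar>1 / a\<bar> * gauge k (a *\<^sub>R \<omega>)"
      using False that subspace_scale[OF L_subspace] by (intro le) auto
    then have "\<bar>a\<bar> * gauge k \<omega> \<le> gauge k (a *\<^sub>R \<omega>)" using False by (simp add: field_simps)
    then show ?thesis using le[OF that False] by simp
  qed (simp add: gauge_zero)
qed

text \<open>Integrate \<open>N / K \<le> R + \<Phi> (N / K)\<close>, where \<open>N\<close> is the pointwise norm, over \<open>A\<close>; the second summand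
contributes at most \<open>1\<close> for admissible \<open>K\<close>.\<close>

lemma L1_bound:
  assumes A: "A \<in> sets vol" "emeasure vol A < \<infinity>"
  shows "\<exists>C>0. \<forall>\<omega>\<in>L k. (\<integral>\<^sup>+p\<in>A. ennreal (pt_norm M k \<omega> p) \<partial>vol) \<le> ennreal (C * gauge k \<omega>)"
proof -
  obtain R where R: "R \<ge> 0" "\<And>x. x \<ge> 0 \<Longrightarrow> x \<le> R + \<Phi> x" using \<Phi>_superlinear by blast
  obtain m where m: "emeasure vol A = ennreal m" "m \<ge> 0" using A(2) by (cases "emeasure vol A" rule: ennreal_cases) auto
  define C where "C = R * m + 1"
  have C: "C > 0" using R m by (simp add: C_def add_nonneg_pos)
  have bound: "(\<integral>\<^sup>+p\<in>A. ennreal (pt_norm M k \<omega> p) \<partial>vol) \<le> ennreal (C * K)"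
    if \<omega>: "\<omega> \<in> L k" and K: "unit_modular k \<omega> K" for \<omega> K
  proof -
    have K0: "K > 0" using K by (simp add: unit_modular_def)
    have meas: "(\<lambda>p. ennreal (\<Phi> (pt_norm M k \<omega> p / K))) \<in> borel_measurable vol"
      using pt_norm_measurable[OF L_D[OF \<omega>]] by measurable
    have "(\<integral>\<^sup>+p\<in>A. ennreal (pt_norm M k \<omega> p) \<partial>vol)
       \<le> (\<integral>\<^sup>+p. ennreal K * (ennreal R * indicator A p + ennreal (\<Phi> (pt_norm M k \<omega> p / K))) \<partial>vol)"
    proof (rule nn_integral_mono)
      fix p assume "p \<in> space vol"
      then have "pt_norm M k \<omega> p / K \<le> R + \<Phi> (pt_norm M k \<omega> p / K)"
        using pt_norm_pos[OF L_D[OF \<omega>]] K0 by (intro R(2)) auto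
      then have "pt_norm M k \<omega> p \<le> K * (R + \<Phi> (pt_norm M k \<omega> p / K))" using K0 by (simp add: field_simps)
      then have "ennreal (pt_norm M k \<omega> p) \<le> ennreal K * (ennreal R + ennreal (\<Phi> (pt_norm M k \<omega> p / K)))"
        using K0 R(1) \<Phi>_nonneg by (simp add: ennreal_mult[symmetric] ennreal_plus[symmetric] ennreal_leI del: ennreal_plus)
      then show "ennreal (pt_norm M k \<omega> p) * indicator A p
         \<le> ennreal K * (ennreal R * indicator A p + ennreal (\<Phi> (pt_norm M k \<omega> p / K)))"
        by (cases "p \<in> A") auto
    qed
    also have "\<dots> = ennreal K * (ennreal R * emeasure vol A + (\<integral>\<^sup>+p. ennreal (\<Phi> (pt_norm M k \<omega> p / K)) \<partial>vol))"
      using meas A(1) by (simp add: nn_integral_cmult nn_integral_add nn_integral_cmult_indicator)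
    also have "\<dots> \<le> ennreal K * (ennreal R * ennreal m + 1)"
      unfolding m(1) using K by (intro mult_left_mono add_mono) (auto simp: unit_modular_def)
    also have "\<dots> = ennreal (C * K)"
    proof -
      have "ennreal R * ennreal m + 1 = ennreal C"
        unfolding C_def using R(1) m(2) by (simp add: ennreal_mult ennreal_plus)
      then show ?thesis using K0 C by (simp add: ennreal_mult mult.commute)
    qed
    finally show ?thesis .
  qed
  have "(\<integral>\<^sup>+p\<in>A. ennreal (pt_norm M k \<omega> p) \<partial>vol) \<le> ennreal (C * gauge k \<omega>)" if \<omega>: "\<omega> \<in> L k" for \<omega>
  proof (rule ennreal_le_epsilon)
    fix e :: real assume e: "e > 0"
    have "(\<integral>\<^sup>+p\<in>A. ennreal (pt_norm M k \<omega> p) \<partial>vol) \<le> ennreal (C * (gauge k \<omega> + e / C))"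
      using e C by (intro bound[OF \<omega>] gauge_less[OF \<omega>]) simp
    also have "\<dots> = ennreal (C * gauge k \<omega>) + ennreal e"
      using C e gauge_nonneg[OF \<omega>] by (subst ennreal_plus[symmetric]) (simp_all add: distrib_left)
    finally show "(\<integral>\<^sup>+p\<in>A. ennreal (pt_norm M k \<omega> p) \<partial>vol) \<le> ennreal (C * gauge k \<omega>) + ennreal e" .
  qed
  then show ?thesis using C by blast
qed

lemma L_loc_integrable:
  assumes "\<omega> \<in> L k" shows "loc_integrable_form M k \<omega>"
  unfolding loc_integrable_form_def
proof (intro conjI allI impI)
  show "measurable_form M k \<omega>" by (rule L_D[OF assms])
  fix K assume K: "compactin T K"
  obtain C where "(\<integral>\<^sup>+p\<in>K. ennreal (pt_norm M k \<omega> p) \<partial>vol) \<le> ennreal (C * gauge k \<omega>)"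
    using L1_bound[OF compact_in_vol[OF K] compact_finite_volume[OF K]] assms by blast
  then show "(\<integral>\<^sup>+p\<in>K. ennreal (pt_norm M k \<omega> p) \<partial>vol) < \<infinity>" by (auto intro: le_less_trans)
qed

text \<open>Fatou's lemma, since \<open>\<Phi>\<close> is continuous.\<close>

lemma unit_modular_Fatou:
  assumes \<omega>: "measurable_form M k \<omega>" and \<omega>n: "\<And>n. measurable_form M k (\<omega>n n)"
    and lim: "AE p in vol. (\<lambda>n. pt_norm M k (\<omega>n n) p) \<longlonglongrightarrow> pt_norm M k \<omega> p"
    and K: "\<And>n. unit_modular k (\<omega>n n) K"
  shows "unit_modular k \<omega> K"
proof -
  have K0: "K > 0" using K by (auto simp: unit_modular_def)
  let ?F = "\<lambda>n p. ennreal (\<Phi> (pt_norm M k (\<omega>n n) p / K))"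
  have meas: "?F n \<in> borel_measurable vol" for n
    using pt_norm_measurable[OF \<omega>n, of n] by measurable
  have "AE p in vol. ennreal (\<Phi> (pt_norm M k \<omega> p / K)) = liminf (\<lambda>n. ?F n p)"
    using lim
  proof (rule AE_mp, intro AE_I2 impI)
    fix p assume "(\<lambda>n. pt_norm M k (\<omega>n n) p) \<longlonglongrightarrow> pt_norm M k \<omega> p"
    then have "(\<lambda>n. pt_norm M k (\<omega>n n) p / K) \<longlonglongrightarrow> pt_norm M k \<omega> p / K" using K0 by (intro tendsto_intros) auto
    then have "(\<lambda>n. \<Phi> (pt_norm M k (\<omega>n n) p / K)) \<longlonglongrightarrow> \<Phi> (pt_norm M k \<omega> p / K)"
      using \<Phi>_continuous by (intro isCont_tendsto_compose[where g=\<Phi>]) (simp_all add: continuous_on_eq_continuous_at)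
    then have "(\<lambda>n. ?F n p) \<longlonglongrightarrow> ennreal (\<Phi> (pt_norm M k \<omega> p / K))" by (rule tendsto_ennrealI)
    then show "ennreal (\<Phi> (pt_norm M k \<omega> p / K)) = liminf (\<lambda>n. ?F n p)"
      by (intro lim_imp_Liminf[symmetric]) auto
  qed
  then have "(\<integral>\<^sup>+p. ennreal (\<Phi> (pt_norm M k \<omega> p / K)) \<partial>vol) = (\<integral>\<^sup>+p. liminf (\<lambda>n. ?F n p) \<partial>vol)"
    by (rule nn_integral_cong_AE)
  also have "\<dots> \<le> liminf (\<lambda>n. \<integral>\<^sup>+p. ?F n p \<partial>vol)" by (rule nn_integral_liminf[OF meas])
  also have "\<dots> \<le> liminf (\<lambda>n. 1)" using K by (intro Liminf_mono) (auto simp: unit_modular_def)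
  also have "\<dots> = 1" by (simp add: Liminf_const)
  finally show ?thesis using K0 by (simp add: unit_modular_def)
qed

text \<open>By \<open>L1_bound\<close> and monotone convergence, the series of pointwise norms is summable almost everywhere on
each of countably many sets of finite measure that cover the manifold. Off the exceptional set \<open>D\<close>
the coefficients are summable in all charts, because they are bounded by multiples of the norms; the
sum is set to \<open>0\<close> on \<open>D\<close>, which does not depend on charts. The remainders are estimated by the
Fatou property, applied to the finite sections of the tails.\<close>

lemma L_series_complete:
  assumes x: "\<And>j::nat. x j \<in> L k" and sm: "summable (\<lambda>j. gauge k (x j))"
  shows "\<exists>s\<in>L k. (\<lambda>n. gauge k (s - (\<Sum>j<n. x j))) \<longlonglongrightarrow> 0"
proof -
  note xm = L_D[OF x]
  let ?S = "\<lambda>p. \<Sum>j. ennreal (pt_norm M k (x j) p)"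
  have Smeas: "?S \<in> borel_measurable vol" using pt_norm_measurable[OF xm] by measurable
  define D where "D = {p \<in> topspace T. ?S p = \<infinity>}"
  have D_sets: "D \<in> sets vol"
  proof -
    have "{p \<in> space vol. ?S p \<in> {\<infinity>}} \<in> sets vol" using Smeas by measurable
    then show ?thesis by (simp add: D_def)
  qed
  obtain \<U> where \<U>: "countable \<U>" "\<forall>U\<in>\<U>. openin T U \<and> emeasure vol U < \<infinity>" "\<Union>\<U> = topspace T"
    by (rule finite_volume_cover)
  have AE_U: "AE p in vol. p \<in> U \<longrightarrow> ?S p \<noteq> \<infinity>" if U: "U \<in> \<U>" for U
  proof -
    have Us: "U \<in> sets vol" using bspec[OF \<U>(2) U] open_in_vol by blast
    obtain C where C: "C > 0" "\<And>\<omega>. \<omega> \<in> L k \<Longrightarrow> (\<integral>\<^sup>+p\<in>U. ennreal (pt_norm M k \<omega> p) \<partial>vol) \<le> ennreal (C * gauge k \<omega>)"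
      using L1_bound[OF Us] bspec[OF \<U>(2) U] by blast
    have m: "(\<lambda>p. ennreal (pt_norm M k (x j) p) * indicator U p) \<in> borel_measurable vol" for j
      using pt_norm_measurable[OF xm] Us by measurable
    have "(\<integral>\<^sup>+p. ?S p * indicator U p \<partial>vol) = (\<Sum>j. \<integral>\<^sup>+p\<in>U. ennreal (pt_norm M k (x j) p) \<partial>vol)"
      by (subst nn_integral_suminf[symmetric, OF m]) simp
    also have "\<dots> \<le> (\<Sum>j. ennreal (C * gauge k (x j)))"
      using C(2) x by (intro suminf_le summableI) auto
    also have "\<dots> < \<infinity>"
    proof -
      have "(\<Sum>j. ennreal (C * gauge k (x j))) \<noteq> top"
      proof (rule ennreal_suminf_neq_top[OF summable_mult[OF sm]])
        show "0 \<le> C * gauge k (x j)" for j using C(1) gauge_nonneg[OF x] by simp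
      qed
      then show ?thesis by (simp add: less_top)
    qed
    finally have fin: "(\<integral>\<^sup>+p. ?S p * indicator U p \<partial>vol) \<noteq> \<infinity>" by simp
    have "(\<lambda>p. ?S p * indicator U p) \<in> borel_measurable vol"
      by (intro borel_measurable_times_ennreal Smeas borel_measurable_indicator Us)
    from nn_integral_PInf_AE[OF this fin] have "AE p in vol. ?S p * indicator U p \<noteq> \<infinity>" .
    then show ?thesis by (rule AE_mp) (intro AE_I2 impI, auto simp: indicator_def)
  qed
  have "AE p in vol. \<forall>U\<in>\<U>. p \<in> U \<longrightarrow> ?S p \<noteq> \<infinity>"
    unfolding AE_ball_countable[OF \<U>(1)] using AE_U by (rule ballI)
  then have AE_D: "AE p in vol. p \<notin> D"
    by (rule AE_mp) (intro AE_I2 impI, use \<U>(3) in \<open>auto simp: D_def\<close>)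
  have sm_pt: "summable (\<lambda>j. pt_norm M k (x j) p)" if "p \<in> topspace T" "p \<notin> D" for p
    using that pt_norm_pos[OF xm that(1)] by (intro summable_suminf_not_top) (auto simp: D_def)
  have sm_val: "summable (\<lambda>j. x j c p v)" if c: "c \<in> atlas M" "p \<in> cdom c" and "p \<notin> D" for c p v
  proof -
    have p: "p \<in> topspace T" using c cdom_sub by blast
    obtain C where C: "\<And>f. multilinear_form k f \<Longrightarrow> \<bar>f v\<bar> \<le> C * form_norm (metric M c p) k f"
      using form_norm_bounds_values[OF metric_posdef[OF c], of k v] by blast
    have "norm (x j c p v) \<le> C * pt_norm M k (x j) p" for j
      using C[OF alt_form_multilinear[OF is_dform_alt[OF measurable_formD(1)[OF xm] c]]]
        pt_norm_in_chart[OF is_dform_mform_on[OF measurable_formD(1)[OF xm]] c UNIV_I] by simp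
    then show ?thesis
      by (rule summable_comparison_test'[OF summable_mult[OF sm_pt[OF p \<open>p \<notin> D\<close>], of C]])
  qed
  define s :: "('a, 'n) dform" where "s c p v = (if p \<in> D then 0 else \<Sum>j. x j c p v)" for c p v
  have sm_form: "measurable_form M k s"
  proof (rule measurable_formI)
    show "alt_form k (s c p)" if c: "c \<in> atlas M" "p \<in> cdom c" for c p
    proof (cases "p \<in> D")
      case True then show ?thesis by (simp add: s_def[abs_def] alt_form_def linear_zero)
    next
      case False
      then show ?thesis
        using alt_form_suminf[OF is_dform_alt[OF measurable_formD(1)[OF xm] c] sm_val[OF c False]]
        by (simp add: s_def[abs_def])
    qed
    show "s c p v = s d p (\<lambda>i. jac c d p *v v i)"
      if "c \<in> atlas M" "d \<in> atlas M" "p \<in> cdom c \<inter> cdom d" for c d p v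
      using is_dform_change[OF measurable_formD(1)[OF xm] that] by (simp add: s_def)
    show "(\<lambda>p. s c p v) \<in> borel_measurable (restrict_space vol (cdom c))" if c: "c \<in> atlas M" for c v
      unfolding s_def
    proof (intro measurable_If borel_measurable_suminf borel_measurable_const measurable_formD(2)[OF xm c])
      have "D \<inter> cdom c \<in> sets vol" using D_sets open_in_vol[OF cdom_open[OF c]] by (rule sets.Int)
      moreover have "{p \<in> space (restrict_space vol (cdom c)). p \<in> D} = D \<inter> cdom c"
        using cdom_sub[OF c] by (auto simp: space_restrict_space)
      moreover have "cdom c \<inter> space vol \<in> sets vol"
        using open_in_vol[OF cdom_open[OF c]] cdom_sub[OF c] by (simp add: Int_absorb2)
      ultimately show "{p \<in> space (restrict_space vol (cdom c)). p \<in> D} \<in> sets (restrict_space vol (cdom c))"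
        by (simp add: sets_restrict_space_iff)
    qed
  qed
  define a where "a n = (\<Sum>j. gauge k (x (j + n)))" for n
  have sm_n: "summable (\<lambda>j. gauge k (x (j + n)))" for n by (rule summable_ignore_initial_segment[OF sm])
  have tail: "s - (\<Sum>j<n. x j) \<in> L k \<and> gauge k (s - (\<Sum>j<n. x j)) \<le> a n" for n
  proof -
    let ?E = "s - (\<Sum>j<n. x j)" and ?F = "\<lambda>m. \<Sum>j<m. x (j + n)"
    have Em: "measurable_form M k ?E"
      using subspace_diff[OF measurable_form_subspace, of s k] sm_form subspace_sum[OF measurable_form_subspace, of "{..<n}" x k] xm by simp
    have FL: "?F m \<in> L k" for m by (intro subspace_sum[OF L_subspace] x)
    have gF: "gauge k (?F m) \<le> a n" for m
    proof -
      have "gauge k (?F m) \<le> (\<Sum>j<m. gauge k (x (j + n)))" by (rule L.p_sum) (rule x)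
      also have "\<dots> \<le> a n" unfolding a_def by (rule sum_le_suminf[OF sm_n]) (auto intro: gauge_nonneg x)
      finally show ?thesis .
    qed
    have lim: "AE p in vol. (\<lambda>m. pt_norm M k (?F m) p) \<longlonglongrightarrow> pt_norm M k ?E p"
      using AE_D
    proof (rule AE_mp, intro AE_I2 impI)
      fix p assume "p \<in> space vol" and p: "p \<notin> D"
      then have c: "chart_at M p \<in> atlas M" "p \<in> cdom (chart_at M p)" using chart_at by auto
      have "(\<lambda>m. ?F m (chart_at M p) p v) \<longlonglongrightarrow> ?E (chart_at M p) p v" for v
      proof -
        have "(\<lambda>j. x j (chart_at M p) p v) sums s (chart_at M p) p v"
          using sm_val[OF c p] p by (simp add: s_def summable_sums)
        then have "(\<lambda>j. x (j + n) (chart_at M p) p v) sums (s (chart_at M p) p v - (\<Sum>j<n. x j (chart_at M p) p v))"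
          by (rule sums_split_initial_segment)
        then show ?thesis by (simp add: sums_def sum_fun_apply)
      qed
      then show "(\<lambda>m. pt_norm M k (?F m) p) \<longlonglongrightarrow> pt_norm M k ?E p"
        unfolding pt_norm_chart_at by (rule form_norm_tendsto)
    qed
    \<comment> \<open>The strict inequality is needed since admissibility is known only above the gauge norm.\<close>
    have um: "unit_modular k ?E K" if "K > a n" for K
      using gF that by (intro unit_modular_Fatou[OF Em L_D[OF FL] lim] gauge_less[OF FL]) (rule le_less_trans)
    have "gauge k ?E \<le> a n" by (rule field_le_epsilon) (simp add: gauge_le um)
    moreover have "?E \<in> L k" using L_I[OF Em um[of "a n + 1"]] by simp
    ultimately show ?thesis by simp
  qed
  have sL: "s \<in> L k" using tail[of 0] by simp
  have "a \<longlonglongrightarrow> 0"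
  proof -
    have "(\<lambda>n. (\<Sum>j. gauge k (x j)) - (\<Sum>j<n. gauge k (x j))) \<longlonglongrightarrow> (\<Sum>j. gauge k (x j)) - (\<Sum>j. gauge k (x j))"
      by (intro tendsto_intros summable_LIMSEQ[OF sm])
    moreover have "a = (\<lambda>n. (\<Sum>j. gauge k (x j)) - (\<Sum>j<n. gauge k (x j)))"
      unfolding a_def using suminf_minus_initial_segment[OF sm] by (intro ext)
    ultimately show ?thesis by simp
  qed
  then have "(\<lambda>n. gauge k (s - (\<Sum>j<n. x j))) \<longlonglongrightarrow> 0"
    by (rule Lim_null_comparison[rotated]) (use tail gauge_nonneg in \<open>auto intro!: always_eventually\<close>)
  with sL show ?thesis by blast
qed

sublocale L: complete_seminormed "L k" "gauge k" for k
  by unfold_locales (rule L_series_complete)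

end

section \<open>Closedness of the weak differential\<close>

context riem_manifold
begin

lemma loc_integrable_formD:
  assumes "loc_integrable_form M k \<omega>"
  shows "measurable_form M k \<omega>" "compactin T K \<Longrightarrow> (\<integral>\<^sup>+p\<in>K. ennreal (pt_norm M k \<omega> p) \<partial>vol) < \<infinity>"
  using assms by (simp_all add: loc_integrable_form_def)

lemma integrand_add: "integrand U s (wedge j m (\<omega> + \<eta>) \<beta>) p
    = integrand U s (wedge j m \<omega> \<beta>) p + integrand U s (wedge j m \<eta> \<beta>) p"
  by (simp add: integrand_def wedge_def distrib_left distrib_right sum.distrib add_divide_distrib)

lemma integrand_scale: "integrand U s (wedge j m (a *\<^sub>R \<omega>) \<beta>) p = a * integrand U s (wedge j m \<omega> \<beta>) p"
  by (simp add: integrand_def wedge_def scaleR_fun_def sum_distrib_left mult_ac)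

context
  fixes U K s j m \<beta>
  assumes U: "openin T U" and \<beta>: "test_form U K m \<beta>" and n: "j + m = CARD('n)" and s: "orientation_on M U s"
begin

lemma integrand_integrable:
  assumes \<omega>: "loc_integrable_form M j \<omega>"
  shows "integrable vol (integrand U s (wedge j m \<omega> \<beta>))"
proof (rule integrableI_bounded)
  note \<omega>' = loc_integrable_formD[OF \<omega>]
  show "integrand U s (wedge j m \<omega> \<beta>) \<in> borel_measurable vol"
    by (rule integrand_measurable[OF U \<omega>'(1) \<beta> n s])
  obtain B where B: "B \<ge> 0" "\<And>p. p \<in> topspace T \<Longrightarrow>
      \<bar>integrand U s (wedge j m \<omega> \<beta>) p\<bar> \<le> B * (indicator K p * pt_norm M j \<omega> p)"
    using integrand_bound[OF U \<beta> n s] measurable_formD(1)[OF \<omega>'(1)] by blast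
  have m: "(\<lambda>p. ennreal (pt_norm M j \<omega> p) * indicator K p) \<in> borel_measurable vol"
    using pt_norm_measurable[OF \<omega>'(1)] compact_in_vol[OF test_formD(2)[OF \<beta>]] by measurable
  have "(\<integral>\<^sup>+p. ennreal (norm (integrand U s (wedge j m \<omega> \<beta>) p)) \<partial>vol)
     \<le> (\<integral>\<^sup>+p. ennreal B * (ennreal (pt_norm M j \<omega> p) * indicator K p) \<partial>vol)"
  proof (rule nn_integral_mono)
    fix p assume "p \<in> space vol"
    then have "ennreal (norm (integrand U s (wedge j m \<omega> \<beta>) p)) \<le> ennreal (B * (indicator K p * pt_norm M j \<omega> p))"
      using B(2) by (intro ennreal_leI) simp
    also have "\<dots> = ennreal B * (ennreal (pt_norm M j \<omega> p) * indicator K p)"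
      using B(1) by (cases "p \<in> K") (simp_all add: ennreal_mult')
    finally show "ennreal (norm (integrand U s (wedge j m \<omega> \<beta>) p)) \<le> ennreal B * (ennreal (pt_norm M j \<omega> p) * indicator K p)" .
  qed
  also have "\<dots> = ennreal B * (\<integral>\<^sup>+p\<in>K. ennreal (pt_norm M j \<omega> p) \<partial>vol)" by (rule nn_integral_cmult[OF m])
  also have "\<dots> < \<infinity>" using \<omega>'(2)[OF test_formD(2)[OF \<beta>]] by (simp add: ennreal_mult_less_top)
  finally show "(\<integral>\<^sup>+p. ennreal (norm (integrand U s (wedge j m \<omega> \<beta>) p)) \<partial>vol) < \<infinity>" .
qed

lemma form_integral_add:
  assumes "loc_integrable_form M j \<omega>" "loc_integrable_form M j \<eta>"
  shows "form_integral M U s (wedge j m (\<omega> + \<eta>) \<beta>)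
    = form_integral M U s (wedge j m \<omega> \<beta>) + form_integral M U s (wedge j m \<eta> \<beta>)"
  unfolding form_integral_integrand integrand_add[abs_def]
  by (rule Bochner_Integration.integral_add) (rule integrand_integrable assms)+

end

text \<open>The two integrals in the definition of the weak differential have test forms as second factors, and
this is all that is used of \<open>u\<close>. The last premise allows the identity to be transferred from other
pairs of forms.\<close>

lemma weak_dI:
  assumes "loc_integrable_form M j \<omega>" "loc_integrable_form M (j + 1) \<theta>"
    and "\<And>U s m u K. openin T U \<Longrightarrow> orientation_on M U s \<Longrightarrow> j + (m + 1) = CARD('n) \<Longrightarrow> j + 1 + m = CARD('n) \<Longrightarrow>
      test_form U K (m + 1) (ext_d m u) \<Longrightarrow> test_form U K m u \<Longrightarrow>
      (\<And>\<omega> \<theta>. weak_d M j \<omega> \<theta> \<Longrightarrow> form_integral M U s (wedge j (m + 1) \<omega> (ext_d m u)) =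
            (-1) ^ (j + 1) * form_integral M U s (wedge (j + 1) m \<theta> u)) \<Longrightarrow>
      form_integral M U s (wedge j (m + 1) \<omega> (ext_d m u)) =
            (-1) ^ (j + 1) * form_integral M U s (wedge (j + 1) m \<theta> u)"
  shows "weak_d M j \<omega> \<theta>"
  unfolding weak_d_def
proof (intro conjI allI impI assms(1,2))
  fix U s m u
  assume a: "openin T U \<and> connectedin T U \<and> U \<subseteq> interior_of_mfd M \<and> orientation_on M U s \<and>
     j + 1 + m = CARD('n) \<and> smooth_form M m u \<and> compactin T (form_support M u) \<and> form_support M u \<subseteq> U"
  show "form_integral M U s (wedge j (m + 1) \<omega> (ext_d m u)) =
            (-1) ^ (j + 1) * form_integral M U s (wedge (j + 1) m \<theta> u)"
  proof (rule assms(3)[where K="form_support M u"])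
    show "test_form U (form_support M u) (m + 1) (ext_d m u)" using a by (intro test_form_ext_d) simp_all
    show "test_form U (form_support M u) m u" using a by (intro test_form_smooth) simp_all
    show "form_integral M U s (wedge j (m + 1) \<omega> (ext_d m u)) =
            (-1) ^ (j + 1) * form_integral M U s (wedge (j + 1) m \<theta> u)" if "weak_d M j \<omega> \<theta>" for \<omega> \<theta>
      by (rule that[unfolded weak_d_def, THEN conjunct2, THEN conjunct2, rule_format, OF a])
  qed (use a in simp_all)
qed

lemma weak_d_loc:
  assumes "weak_d M j \<omega> \<theta>"
  shows "loc_integrable_form M j \<omega>" "loc_integrable_form M (j + 1) \<theta>"
  using assms[unfolded weak_d_def, THEN conjunct1] assms[unfolded weak_d_def, THEN conjunct2, THEN conjunct1] .

lemma loc_integrable_add: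
  assumes \<omega>: "loc_integrable_form M k \<omega>" and \<eta>: "loc_integrable_form M k \<eta>"
  shows "loc_integrable_form M k (\<omega> + \<eta>)"
  unfolding loc_integrable_form_def
proof (intro conjI allI impI)
  note \<omega>' = loc_integrable_formD[OF \<omega>] and \<eta>' = loc_integrable_formD[OF \<eta>]
  show "measurable_form M k (\<omega> + \<eta>)" using subspace_add[OF measurable_form_subspace] \<omega>'(1) \<eta>'(1) by blast
  fix K assume K: "compactin T K"
  note [measurable] = pt_norm_measurable[OF \<omega>'(1)] pt_norm_measurable[OF \<eta>'(1)] compact_in_vol[OF K]
  have "(\<integral>\<^sup>+p\<in>K. ennreal (pt_norm M k (\<omega> + \<eta>) p) \<partial>vol)
     \<le> (\<integral>\<^sup>+p. ennreal (pt_norm M k \<omega> p) * indicator K p + ennreal (pt_norm M k \<eta> p) * indicator K p \<partial>vol)"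
  proof (rule nn_integral_mono)
    fix p assume "p \<in> space vol"
    then have p: "p \<in> topspace T" by simp
    have "ennreal (pt_norm M k (\<omega> + \<eta>) p) \<le> ennreal (pt_norm M k \<omega> p) + ennreal (pt_norm M k \<eta> p)"
      using pt_norm_triangle[OF \<omega>'(1) \<eta>'(1) p] pt_norm_pos[OF \<omega>'(1) p] pt_norm_pos[OF \<eta>'(1) p]
      by (simp add: ennreal_plus[symmetric] ennreal_leI del: ennreal_plus)
    then show "ennreal (pt_norm M k (\<omega> + \<eta>) p) * indicator K p
        \<le> ennreal (pt_norm M k \<omega> p) * indicator K p + ennreal (pt_norm M k \<eta> p) * indicator K p"
      by (cases "p \<in> K") simp_all
  qed
  also have "\<dots> = (\<integral>\<^sup>+p\<in>K. ennreal (pt_norm M k \<omega> p) \<partial>vol) + (\<integral>\<^sup>+p\<in>K. ennreal (pt_norm M k \<eta> p) \<partial>vol)"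
    by (rule nn_integral_add) measurable
  also have "\<dots> < \<infinity>" using \<omega>'(2)[OF K] \<eta>'(2)[OF K] by simp
  finally show "(\<integral>\<^sup>+p\<in>K. ennreal (pt_norm M k (\<omega> + \<eta>) p) \<partial>vol) < \<infinity>" .
qed

lemma loc_integrable_scale:
  assumes \<omega>: "loc_integrable_form M k \<omega>"
  shows "loc_integrable_form M k (a *\<^sub>R \<omega>)"
  unfolding loc_integrable_form_def
proof (intro conjI allI impI)
  note \<omega>' = loc_integrable_formD[OF \<omega>]
  show "measurable_form M k (a *\<^sub>R \<omega>)" using subspace_scale[OF measurable_form_subspace] \<omega>'(1) by blast
  fix K assume K: "compactin T K"
  note [measurable] = pt_norm_measurable[OF \<omega>'(1)] compact_in_vol[OF K]
  have "(\<integral>\<^sup>+p\<in>K. ennreal (pt_norm M k (a *\<^sub>R \<omega>) p) \<partial>vol) = (\<integral>\<^sup>+p. ennreal \<bar>a\<bar> * (ennreal (pt_norm M k \<omega> p) * indicator K p) \<partial>vol)"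
    by (intro nn_integral_cong) (simp add: pt_norm_scaleR ennreal_mult' mult.assoc)
  also have "\<dots> = ennreal \<bar>a\<bar> * (\<integral>\<^sup>+p\<in>K. ennreal (pt_norm M k \<omega> p) \<partial>vol)"
    by (rule nn_integral_cmult) measurable
  also have "\<dots> < \<infinity>" using \<omega>'(2)[OF K] by (simp add: ennreal_mult_less_top)
  finally show "(\<integral>\<^sup>+p\<in>K. ennreal (pt_norm M k (a *\<^sub>R \<omega>) p) \<partial>vol) < \<infinity>" .
qed

lemma weak_d_add:
  assumes 1: "weak_d M j \<omega> \<theta>" and 2: "weak_d M j \<omega>' \<theta>'"
  shows "weak_d M j (\<omega> + \<omega>') (\<theta> + \<theta>')"
proof (rule weak_dI)
  note l = weak_d_loc[OF 1] weak_d_loc[OF 2]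
  show "loc_integrable_form M j (\<omega> + \<omega>')" "loc_integrable_form M (j + 1) (\<theta> + \<theta>')"
    by (intro loc_integrable_add l)+
  fix U s m u K
  assume U: "openin T U" and s: "orientation_on M U s" and n: "j + (m + 1) = CARD('n)" "j + 1 + m = CARD('n)"
    and t: "test_form U K (m + 1) (ext_d m u)" "test_form U K m u"
    and weak: "\<And>\<omega> \<theta>. weak_d M j \<omega> \<theta> \<Longrightarrow> form_integral M U s (wedge j (m + 1) \<omega> (ext_d m u)) =
            (-1) ^ (j + 1) * form_integral M U s (wedge (j + 1) m \<theta> u)"
  show "form_integral M U s (wedge j (m + 1) (\<omega> + \<omega>') (ext_d m u)) =
            (-1) ^ (j + 1) * form_integral M U s (wedge (j + 1) m (\<theta> + \<theta>') u)"
    unfolding form_integral_add[OF U t(1) n(1) s l(1) l(3)] form_integral_add[OF U t(2) n(2) s l(2) l(4)]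
      weak[OF 1] weak[OF 2] by (simp add: distrib_left)
qed

lemma weak_d_scale:
  assumes 1: "weak_d M j \<omega> \<theta>"
  shows "weak_d M j (a *\<^sub>R \<omega>) (a *\<^sub>R \<theta>)"
proof (rule weak_dI)
  note l = weak_d_loc[OF 1]
  show "loc_integrable_form M j (a *\<^sub>R \<omega>)" "loc_integrable_form M (j + 1) (a *\<^sub>R \<theta>)"
    by (intro loc_integrable_scale l)+
  fix U s m u
  assume weak: "\<And>\<omega> \<theta>. weak_d M j \<omega> \<theta> \<Longrightarrow> form_integral M U s (wedge j (m + 1) \<omega> (ext_d m u)) =
            (-1) ^ (j + 1) * form_integral M U s (wedge (j + 1) m \<theta> u)"
  show "form_integral M U s (wedge j (m + 1) (a *\<^sub>R \<omega>) (ext_d m u)) =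
            (-1) ^ (j + 1) * form_integral M U s (wedge (j + 1) m (a *\<^sub>R \<theta>) u)"
    unfolding form_integral_integrand integrand_scale[abs_def]
    using weak[OF 1] by (simp add: form_integral_integrand)
qed

lemma weak_d_zero:
  "weak_d M j 0 0"
proof (rule weak_dI)
  have "measurable_form M k 0" for k using subspace_0[OF measurable_form_subspace] by simp
  moreover have "pt_norm M k 0 p = 0" for k p using pt_norm_scaleR[of k 0 0 p] by simp
  ultimately show "loc_integrable_form M j 0" "loc_integrable_form M (j + 1) 0"
    by (simp_all add: loc_integrable_form_def)
qed (simp add: form_integral_integrand integrand_def[abs_def] wedge_def)

end

context orlicz_manifold
begin

text \<open>The integrand is bounded by a multiple of the pointwise norm on a compact set, whose integral is
bounded by \<open>L1_bound\<close>.\<close>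

lemma form_integral_gauge_bound:
  assumes U: "openin T U" and \<beta>: "test_form U K m \<beta>" and n: "j + m = CARD('n)" and s: "orientation_on M U s"
  shows "\<exists>C. \<forall>\<omega>\<in>L j. \<bar>form_integral M U s (wedge j m \<omega> \<beta>)\<bar> \<le> C * gauge j \<omega>"
proof -
  note K = test_formD(2)[OF \<beta>]
  obtain B where B: "B \<ge> 0" "\<And>\<omega> p. is_dform M j \<omega> \<Longrightarrow> p \<in> topspace T \<Longrightarrow>
      \<bar>integrand U s (wedge j m \<omega> \<beta>) p\<bar> \<le> B * (indicator K p * pt_norm M j \<omega> p)"
    using integrand_bound[OF U \<beta> n s] by blast
  obtain C where C: "C > 0" "\<And>\<omega>. \<omega> \<in> L j \<Longrightarrow> (\<integral>\<^sup>+p\<in>K. ennreal (pt_norm M j \<omega> p) \<partial>vol) \<le> ennreal (C * gauge j \<omega>)"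
    using L1_bound[OF compact_in_vol[OF K] compact_finite_volume[OF K]] by blast
  have "\<bar>form_integral M U s (wedge j m \<omega> \<beta>)\<bar> \<le> (B * C) * gauge j \<omega>" if \<omega>: "\<omega> \<in> L j" for \<omega>
  proof -
    note \<omega>m = L_D[OF \<omega>]
    let ?f = "integrand U s (wedge j m \<omega> \<beta>)" and ?g = "\<lambda>p. indicator K p * pt_norm M j \<omega> p"
    have m: "?g \<in> borel_measurable vol"
      using pt_norm_measurable[OF \<omega>m] compact_in_vol[OF K] by measurable
    have g0: "AE p in vol. 0 \<le> ?g p" using pt_norm_pos[OF \<omega>m] by (intro AE_I2) (simp add: indicator_def)
    have nn: "(\<integral>\<^sup>+p. ennreal (?g p) \<partial>vol) = (\<integral>\<^sup>+p\<in>K. ennreal (pt_norm M j \<omega> p) \<partial>vol)"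
      by (intro nn_integral_cong) (simp add: indicator_def)
    have ig: "integrable vol ?g"
      using m g0 loc_integrable_formD(2)[OF L_loc_integrable[OF \<omega>] K] nn by (intro integrableI_nonneg) simp_all
    have "ennreal (integral\<^sup>L vol ?g) \<le> ennreal (C * gauge j \<omega>)"
      using nn_integral_eq_integral[OF ig g0] C(2)[OF \<omega>] nn by simp
    then have ib: "integral\<^sup>L vol ?g \<le> C * gauge j \<omega>"
      using C(1) gauge_nonneg[OF \<omega>] by (subst (asm) ennreal_le_iff) simp_all
    have "\<bar>integral\<^sup>L vol ?f\<bar> \<le> (\<integral>p. \<bar>?f p\<bar> \<partial>vol)" by (rule integral_abs_bound)
    also have "\<dots> \<le> (\<integral>p. B * ?g p \<partial>vol)"
    proof (rule integral_mono)
      show "integrable vol (\<lambda>p. \<bar>?f p\<bar>)"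
        using integrand_integrable[OF U \<beta> n s L_loc_integrable[OF \<omega>]] by (rule integrable_abs)
      show "\<bar>?f p\<bar> \<le> B * ?g p" if "p \<in> space vol" for p
        using B(2)[OF measurable_formD(1)[OF \<omega>m], of p] that by simp
    qed (use ig in simp)
    also have "\<dots> = B * integral\<^sup>L vol ?g" by simp
    also have "\<dots> \<le> B * (C * gauge j \<omega>)" by (intro mult_left_mono ib B)
    finally show ?thesis by (simp add: form_integral_integrand mult.assoc)
  qed
  then show ?thesis by blast
qed

lemma form_integral_tendsto:
  assumes U: "openin T U" and \<beta>: "test_form U K m \<beta>" and n: "j + m = CARD('n)" and s: "orientation_on M U s"
    and x: "\<And>i. x i \<in> L j" "y \<in> L j" "(\<lambda>i. gauge j (y - x i)) \<longlonglongrightarrow> 0"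
  shows "(\<lambda>i. form_integral M U s (wedge j m (x i) \<beta>)) \<longlonglongrightarrow> form_integral M U s (wedge j m y \<beta>)"
proof -
  let ?I = "\<lambda>\<omega>. form_integral M U s (wedge j m \<omega> \<beta>)"
  obtain C where C: "\<And>\<omega>. \<omega> \<in> L j \<Longrightarrow> \<bar>?I \<omega>\<bar> \<le> C * gauge j \<omega>"
    using form_integral_gauge_bound[OF U \<beta> n s] by blast
  have yx: "y - x i \<in> L j" for i by (rule subspace_diff[OF L_subspace x(2,1)])
  have eq: "?I (y - x i) = ?I y - ?I (x i)" for i
  proof -
    have "?I (y - x i + x i) = ?I (y - x i) + ?I (x i)"
      by (rule form_integral_add[OF U \<beta> n s L_loc_integrable[OF yx] L_loc_integrable[OF x(1)]])
    then show ?thesis by simp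
  qed
  have "(\<lambda>i. C * gauge j (y - x i)) \<longlonglongrightarrow> C * 0" by (intro tendsto_intros x(3))
  then have "(\<lambda>i. ?I y - ?I (x i)) \<longlonglongrightarrow> 0"
    by (intro Lim_null_comparison[of "\<lambda>i. ?I y - ?I (x i)" "\<lambda>i. C * gauge j (y - x i)"])
       (use C[OF yx] in \<open>auto simp: eq intro!: always_eventually\<close>)
  then have "(\<lambda>i. ?I y - (?I y - ?I (x i))) \<longlonglongrightarrow> ?I y - 0" by (intro tendsto_intros)
  then show ?thesis by simp
qed

end

text \<open>The defining identities pass to the limit because both sides are continuous for the gauge norms.\<close>

lemma weak_d_closed:
  fixes M :: "('a, 'n::{finite,wellorder}) riem"
  assumes 1: "orlicz_manifold M \<Phi>1" and 2: "orlicz_manifold M \<Phi>2"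
    and x: "\<And>i. x i \<in> L_space M \<Phi>1 j" "u \<in> L_space M \<Phi>1 j" "(\<lambda>i. gauge_norm M \<Phi>1 j (u - x i)) \<longlonglongrightarrow> 0"
    and y: "\<And>i. y i \<in> L_space M \<Phi>2 (j + 1)" "v \<in> L_space M \<Phi>2 (j + 1)" "(\<lambda>i. gauge_norm M \<Phi>2 (j + 1) (v - y i)) \<longlonglongrightarrow> 0"
    and d: "\<And>i. weak_d M j (x i) (y i)"
  shows "weak_d M j u v"
proof -
  interpret X: orlicz_manifold M \<Phi>1 by (rule 1)
  interpret Y: orlicz_manifold M \<Phi>2 by (rule 2)
  show ?thesis
  proof (rule X.weak_dI[OF X.L_loc_integrable[OF x(2)] Y.L_loc_integrable[OF y(2)]])
    fix U s m \<beta> K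
    assume U: "openin (top_of M) U" and s: "orientation_on M U s" and n: "j + (m + 1) = CARD('n)" "j + 1 + m = CARD('n)"
      and t: "X.test_form U K (m + 1) (ext_d m \<beta>)" "X.test_form U K m \<beta>"
      and weak: "\<And>\<omega> \<theta>. weak_d M j \<omega> \<theta> \<Longrightarrow> form_integral M U s (wedge j (m + 1) \<omega> (ext_d m \<beta>)) =
            (-1) ^ (j + 1) * form_integral M U s (wedge (j + 1) m \<theta> \<beta>)"
    have "(\<lambda>i. form_integral M U s (wedge j (m + 1) (x i) (ext_d m \<beta>)))
        \<longlonglongrightarrow> form_integral M U s (wedge j (m + 1) u (ext_d m \<beta>))"
      by (rule X.form_integral_tendsto[OF U t(1) n(1) s x])
    moreover have "(\<lambda>i. (-1) ^ (j + 1) * form_integral M U s (wedge (j + 1) m (y i) \<beta>))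
        \<longlonglongrightarrow> (-1) ^ (j + 1) * form_integral M U s (wedge (j + 1) m v \<beta>)"
      by (intro tendsto_intros Y.form_integral_tendsto[OF U t(2) n(2) s y])
    ultimately show "form_integral M U s (wedge j (m + 1) u (ext_d m \<beta>)) =
            (-1) ^ (j + 1) * form_integral M U s (wedge (j + 1) m v \<beta>)"
      unfolding weak[OF d] by (rule LIMSEQ_unique)
  qed
qed

context orlicz_manifold
begin

lemma Z_subspace: "subspace (Z_space M \<Phi> k)"
proof (rule subspaceI)
  show "0 \<in> Z_space M \<Phi> k" unfolding Z_space_def zero_form_eq using weak_d_zero subspace_0[OF L_subspace] by blast
  show "\<omega> + \<eta> \<in> Z_space M \<Phi> k" if "\<omega> \<in> Z_space M \<Phi> k" "\<eta> \<in> Z_space M \<Phi> k" for \<omega> \<eta>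
    using that weak_d_add[of k \<omega> 0 \<eta> 0] subspace_add[OF L_subspace] unfolding Z_space_def zero_form_eq by simp
  show "a *\<^sub>R \<omega> \<in> Z_space M \<Phi> k" if "\<omega> \<in> Z_space M \<Phi> k" for a \<omega>
    using that weak_d_scale[of k \<omega> 0 a] subspace_scale[OF L_subspace] unfolding Z_space_def zero_form_eq by simp
qed

text \<open>The cocycles are closed in a complete space: partial sums have differential \<open>0\<close>, and
\<open>weak_d_closed\<close> applies to them and the constant sequence \<open>0\<close>.\<close>

lemma Z_complete: "complete_seminormed (Z_space M \<Phi> k) (gauge k)"
proof
  have ZL: "\<omega> \<in> L k" if "\<omega> \<in> Z_space M \<Phi> k" for \<omega> using that by (simp add: Z_space_def)
  show "subspace (Z_space M \<Phi> k)" by (rule Z_subspace)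
  show "0 \<le> gauge k \<omega>" if "\<omega> \<in> Z_space M \<Phi> k" for \<omega> using gauge_nonneg[OF ZL[OF that]] .
  show "gauge k (\<omega> + \<eta>) \<le> gauge k \<omega> + gauge k \<eta>" if "\<omega> \<in> Z_space M \<Phi> k" "\<eta> \<in> Z_space M \<Phi> k" for \<omega> \<eta>
    by (rule L.p_triangle) (rule ZL that)+
  show "gauge k (a *\<^sub>R \<omega>) = \<bar>a\<bar> * gauge k \<omega>" if "\<omega> \<in> Z_space M \<Phi> k" for a \<omega>
    by (rule L.p_scaleR[OF ZL[OF that]])
  show "\<exists>s\<in>Z_space M \<Phi> k. (\<lambda>n. gauge k (s - (\<Sum>j<n. x j))) \<longlonglongrightarrow> 0"
    if x: "\<And>j::nat. x j \<in> Z_space M \<Phi> k" and sm: "summable (\<lambda>j. gauge k (x j))" for x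
  proof -
    obtain s where s: "s \<in> L k" "(\<lambda>n. gauge k (s - (\<Sum>j<n. x j))) \<longlonglongrightarrow> 0"
      using L_series_complete[OF ZL[OF x] sm] by blast
    have part: "(\<Sum>j<n. x j) \<in> Z_space M \<Phi> k" for n by (rule subspace_sum[OF Z_subspace]) (rule x)
    have "weak_d M k s 0"
    proof (rule weak_d_closed[OF orlicz_manifold_axioms orlicz_manifold_axioms])
      show "(\<Sum>j<n. x j) \<in> L k" for n by (rule ZL[OF part])
      show "0 \<in> L (k + 1)" "0 \<in> L (k + 1)" by (rule subspace_0[OF L_subspace])+
      show "weak_d M k (\<Sum>j<n. x j) 0" for n using part[of n] by (simp add: Z_space_def zero_form_eq)
      show "(\<lambda>i. gauge (k + 1) (0 - 0)) \<longlonglongrightarrow> 0" by (simp add: gauge_zero)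
    qed (use s in simp_all)
    then show ?thesis using s by (intro bexI[of _ s]) (simp_all add: Z_space_def zero_form_eq)
  qed
qed

end

section \<open>Vanishing cohomology\<close>

text \<open>The cohomology is a single class exactly if the relation is total on the cocycles. The classes of \<open>0\<close>
and \<open>\<omega>\<close> agree if \<open>- \<omega>\<close> has a primitive.\<close>

lemma cohomology_zero_iff:
  fixes M :: "('a, 'n::{finite,wellorder}) riem"
  assumes 1: "orlicz_manifold M \<Phi>1" and 2: "orlicz_manifold M \<Phi>2" and k: "1 \<le> k"
  shows "H_space M \<Phi>1 \<Phi>2 k = {H_zero M \<Phi>1 \<Phi>2 k} \<longleftrightarrow>
    (\<forall>\<omega>\<in>Z_space M \<Phi>2 k. \<exists>\<beta>\<in>L_space M \<Phi>1 (k - 1). weak_d M (k - 1) \<beta> \<omega>)"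
proof -
  interpret X: orlicz_manifold M \<Phi>1 by (rule 1)
  interpret Y: orlicz_manifold M \<Phi>2 by (rule 2)
  let ?Z = "Z_space M \<Phi>2 k" and ?R = "cohom_rel M \<Phi>1 \<Phi>2 k"
  have Z0: "0 \<in> ?Z" by (rule subspace_0[OF Y.Z_subspace])
  have R_iff: "(\<omega>, \<eta>) \<in> ?R \<longleftrightarrow> \<omega> \<in> ?Z \<and> \<eta> \<in> ?Z \<and> (\<exists>\<beta>\<in>L_space M \<Phi>1 (k - 1). weak_d M (k - 1) \<beta> (\<omega> - \<eta>))" for \<omega> \<eta>
  proof -
    have "\<omega> - \<eta> \<in> L_space M \<Phi>2 k" if "\<omega> \<in> ?Z" "\<eta> \<in> ?Z"
      using subspace_diff[OF Y.Z_subspace that] by (simp add: Z_space_def)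
    then show ?thesis unfolding cohom_rel_def B_space_def diff_form_eq by blast
  qed
  show ?thesis
  proof
    assume H: "H_space M \<Phi>1 \<Phi>2 k = {H_zero M \<Phi>1 \<Phi>2 k}"
    show "\<forall>\<omega>\<in>?Z. \<exists>\<beta>\<in>L_space M \<Phi>1 (k - 1). weak_d M (k - 1) \<beta> \<omega>"
    proof
      fix \<omega> assume \<omega>: "\<omega> \<in> ?Z"
      have "?R `` {\<omega>} \<in> H_space M \<Phi>1 \<Phi>2 k" unfolding H_space_def using \<omega> by (rule quotientI)
      then have "?R `` {\<omega>} = ?R `` {0}" using H by (simp add: H_zero_def zero_form_eq)
      moreover have "weak_d M (k - 1) 0 0" "0 \<in> L_space M \<Phi>1 (k - 1)"
        using X.weak_d_zero subspace_0[OF X.L_subspace] by auto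
      then have "(\<omega>, \<omega>) \<in> ?R" using \<omega> R_iff by auto
      ultimately have "(0, \<omega>) \<in> ?R" by blast
      then obtain \<beta> where \<beta>: "\<beta> \<in> L_space M \<Phi>1 (k - 1)" "weak_d M (k - 1) \<beta> (- \<omega>)" using R_iff by auto
      have "weak_d M (k - 1) (- \<beta>) \<omega>" using X.weak_d_scale[OF \<beta>(2), of "-1"] by simp
      moreover have "- \<beta> \<in> L_space M \<Phi>1 (k - 1)" by (rule subspace_neg[OF X.L_subspace \<beta>(1)])
      ultimately show "\<exists>\<beta>\<in>L_space M \<Phi>1 (k - 1). weak_d M (k - 1) \<beta> \<omega>" by blast
    qed
  next
    assume ex: "\<forall>\<omega>\<in>?Z. \<exists>\<beta>\<in>L_space M \<Phi>1 (k - 1). weak_d M (k - 1) \<beta> \<omega>"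
    have R_all: "(\<omega>, \<eta>) \<in> ?R" if "\<omega> \<in> ?Z" "\<eta> \<in> ?Z" for \<omega> \<eta>
      unfolding R_iff using that bspec[OF ex subspace_diff[OF Y.Z_subspace that]] by (intro conjI)
    have R_sub: "\<eta> \<in> ?Z" if "(\<omega>, \<eta>) \<in> ?R" for \<omega> \<eta> using that unfolding R_iff by (elim conjE)
    have "?R `` {\<omega>} = ?Z" if \<omega>: "\<omega> \<in> ?Z" for \<omega>
      by (rule subset_antisym) (auto intro: R_sub R_all[OF \<omega>] simp del: split_paired_All)
    then show "H_space M \<Phi>1 \<Phi>2 k = {H_zero M \<Phi>1 \<Phi>2 k}"
      unfolding H_space_def quotient_def H_zero_def zero_form_eq using Z0 by auto
  qed
qed

theorem theorem3p3:
  fixes M :: "('a, 'n::{finite,wellorder}) riem"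
    and \<Phi>\<^sub>I \<Phi>\<^sub>I\<^sub>I :: "real \<Rightarrow> real"
    and k :: nat
  assumes "riemannian_manifold M"
    and "N_function \<Phi>\<^sub>I" and "N_function \<Phi>\<^sub>I\<^sub>I"
    and "1 \<le> k" and "k \<le> CARD('n)"
  shows "H_space M \<Phi>\<^sub>I \<Phi>\<^sub>I\<^sub>I k = {H_zero M \<Phi>\<^sub>I \<Phi>\<^sub>I\<^sub>I k} \<longleftrightarrow>
    (\<exists>C::real. \<forall>\<omega>\<in>L_space M \<Phi>\<^sub>I\<^sub>I k. weak_d M k \<omega> zero_form \<longrightarrow>
       (\<exists>\<theta>\<in>L_space M \<Phi>\<^sub>I (k - 1). weak_d M (k - 1) \<theta> \<omega> \<and>
          gauge_norm M \<Phi>\<^sub>I (k - 1) \<theta> \<le> C * gauge_norm M \<Phi>\<^sub>I\<^sub>I k \<omega>))"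
proof -
  interpret X: orlicz_manifold M \<Phi>\<^sub>I by unfold_locales (rule assms)+
  interpret Y: orlicz_manifold M \<Phi>\<^sub>I\<^sub>I by unfold_locales (rule assms)
  note H_iff = cohomology_zero_iff[OF X.orlicz_manifold_axioms Y.orlicz_manifold_axioms assms(4)]
  have k: "k - 1 + 1 = k" using assms(4) by simp
  let ?Z = "Z_space M \<Phi>\<^sub>I\<^sub>I k"
  show ?thesis
  proof
    assume "H_space M \<Phi>\<^sub>I \<Phi>\<^sub>I\<^sub>I k = {H_zero M \<Phi>\<^sub>I \<Phi>\<^sub>I\<^sub>I k}"
    then have surj: "\<exists>\<beta>\<in>L_space M \<Phi>\<^sub>I (k - 1). weak_d M (k - 1) \<beta> \<omega>" if "\<omega> \<in> ?Z" for \<omega>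
      using H_iff that by blast
    have "\<exists>C. \<forall>\<omega>\<in>?Z. \<exists>\<theta>\<in>L_space M \<Phi>\<^sub>I (k - 1). weak_d M (k - 1) \<theta> \<omega> \<and>
        gauge_norm M \<Phi>\<^sub>I (k - 1) \<theta> \<le> C * gauge_norm M \<Phi>\<^sub>I\<^sub>I k \<omega>"
    proof (rule open_mapping_relation[OF X.L.complete_seminormed_axioms Y.Z_complete])
      show "weak_d M (k - 1) (x + x') (y + y')" if "weak_d M (k - 1) x y" "weak_d M (k - 1) x' y'" for x y x' y'
        by (rule X.weak_d_add[OF that])
      show "weak_d M (k - 1) (a *\<^sub>R x) (a *\<^sub>R y)" if "weak_d M (k - 1) x y" for x y a
        by (rule X.weak_d_scale[OF that])
      show "weak_d M (k - 1) u v"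
        if "\<And>n::nat. x n \<in> L_space M \<Phi>\<^sub>I (k - 1)" "\<And>n. y n \<in> ?Z" "\<And>n. weak_d M (k - 1) (x n) (y n)"
          "u \<in> L_space M \<Phi>\<^sub>I (k - 1)" "v \<in> ?Z"
          "(\<lambda>n. gauge_norm M \<Phi>\<^sub>I (k - 1) (u - x n)) \<longlonglongrightarrow> 0" "(\<lambda>n. gauge_norm M \<Phi>\<^sub>I\<^sub>I k (v - y n)) \<longlonglongrightarrow> 0" for x y u v
        by (rule weak_d_closed[OF X.orlicz_manifold_axioms Y.orlicz_manifold_axioms, where x=x and y=y and j="k - 1", unfolded k])
           (use that in \<open>simp_all add: k Z_space_def\<close>)
    qed (rule surj)
    then show "\<exists>C. \<forall>\<omega>\<in>L_space M \<Phi>\<^sub>I\<^sub>I k. weak_d M k \<omega> zero_form \<longrightarrow>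
       (\<exists>\<theta>\<in>L_space M \<Phi>\<^sub>I (k - 1). weak_d M (k - 1) \<theta> \<omega> \<and>
          gauge_norm M \<Phi>\<^sub>I (k - 1) \<theta> \<le> C * gauge_norm M \<Phi>\<^sub>I\<^sub>I k \<omega>)"
      by (auto simp: Z_space_def)
  next
    assume "\<exists>C. \<forall>\<omega>\<in>L_space M \<Phi>\<^sub>I\<^sub>I k. weak_d M k \<omega> zero_form \<longrightarrow>
       (\<exists>\<theta>\<in>L_space M \<Phi>\<^sub>I (k - 1). weak_d M (k - 1) \<theta> \<omega> \<and>
          gauge_norm M \<Phi>\<^sub>I (k - 1) \<theta> \<le> C * gauge_norm M \<Phi>\<^sub>I\<^sub>I k \<omega>)"
    then have "\<forall>\<omega>\<in>?Z. \<exists>\<beta>\<in>L_space M \<Phi>\<^sub>I (k - 1). weak_d M (k - 1) \<beta> \<omega>"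
      unfolding Z_space_def by blast
    then show "H_space M \<Phi>\<^sub>I \<Phi>\<^sub>I\<^sub>I k = {H_zero M \<Phi>\<^sub>I \<Phi>\<^sub>I\<^sub>I k}" using H_iff by blast
  qed
qed

end
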